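(* Let $r>0$, $\mu\in\mathbb{R}$, $\sigma\neq 0$ be such that $\sigma^2<r+\mu$ (equivalently $m+1<0$) and $\sigma^2\geq\mu$ (equivalently $m+n+1\geq 0$). Let $H_\infty\in\,]0,G_\infty]$ and let $H:\,]0,\infty[\,\to\mathbb{R}$ be the solution to the ODE $$\dot H(s)=\frac{\dot F(s)\Bigl((n+1)\bigl(H(s)/s\bigr)^{n-m}-(m+1)\Bigr)H(s)}{-mn\bigl(G(s)-H(s)\bigr)\Bigl(1-\bigl(H(s)/s\bigr)^{n-m}\Bigr)},\quad s>0,$$ such that $0<H(s)<G(s)$ and $\dot H(s)>0$ for all $s>0$, $\lim_{s\downarrow 0}H(s)=0$ and $\lim_{s\uparrow\infty}H(s)=H_\infty$ (for each $H_\infty\in\,]0,G_\infty]$ there is exactly one such solution). Define, for $0<x\leq s$, $$w(x,s)=\begin{cases}x^{-1}F(s)-1, & \text{if } 0<x\leq H(s),\\ A(s)x^n+B(s)x^m, & \text{if } H(s)<x\leq s,\end{cases}$$ where $$A(s)=\frac{mH(s)-(m+1)F(s)}{(n-m)H^{n+1}(s)},\qquad B(s)=\frac{(n+1)F(s)-nH(s)}{(n-m)H^{m+1}(s)} .$$ Let $H_\infty^\circ=\frac{m+1}{m}\in\,]0,G_\infty[$. Then the following statements hold. (I) The function $w$ is $C^1$, and its restriction to $\{(x,s)\in\mathbb{R}_+^2 \mid 0<x\leq s \text{ and } x\neq H(s)\}$ is $C^2$. (II) If $H_\infty\in\,]H_\infty^\circ,G_\infty]$, then $w$ does not satisfy the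 variational inequality (VI) because there exist $0<x\leq s$ such that $w(x,s)<0$. (III) If $H_\infty\in\,]0,H_\infty^\circ]$, then $w$ is strictly positive and satisfies the variational inequality (VI) as well as the boundary condition $w_s(s,s)=0$ for all $s>0$. (IV) If $H_\infty\in\,]0,H_\infty^\circ[$, then $w$ does not satisfy the transversality condition (TV). Moreover, there is a constant $A_\infty=A_\infty(H_\infty)>0$ such that, if $(\tau_\ell)$ is any sequence of bounded $(\mathcal F_t)$-stopping times such that $\lim_{\ell\uparrow\infty}\tau_\ell=\infty$, then $$\lim_{\ell\uparrow\infty}\mathsf{E}\bigl[e^{-r\tau_\ell}w(X_{\tau_\ell},S_{\tau_\ell})\bigr]\geq A_\infty x^n>0 .$$ (V) If $H_\infty=H_\infty^\circ$, then $w$ satisfies the transversality condition (TV). Furthermore, if $(\tau_\ell)$ is any sequence of bounded $(\mathcal F_t)$-stopping times such that $\lim_{\ell\uparrow\infty}\tau_\ell=\infty$, then $$\lim_{\ell\uparrow\infty}\mathsf{E}\bigl[e^{-r\tau_\ell}w(X_{\tau_\ell},S_{\tau_\ell})\bigr]=0 .$$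
   Context: Fix a filtered probability space $(\Omega,\mathcal F,(\mathcal F_t),\mathsf P)$ satisfying the usual conditions and supporting a standard one-dimensional $(\mathcal F_t)$-Brownian motion $W$. For an initial condition $0<x\leq s$, let $X$ be the geometric Brownian motion $\mathrm dX_t=\mu X_t\,\mathrm dt+\sigma X_t\,\mathrm dW_t$, $X_0=x$, and let $S_t=\max\{s,\max_{0\leq u\leq t}X_u\}$ be its running maximum process; expectations depend on the initial condition $(x,s)$, which is arbitrary with $0<x\leq s$. The constants $m<0<n$ are the two roots of the quadratic equation $\frac12\sigma^2k^2+(\mu-\frac12\sigma^2)k-r=0$. $F(s)=1-e^{-s}$, $G(s)=\frac{(m+1)(n+1)}{mn}F(s)$ for $s>0$, and $G_\infty=\lim_{s\uparrow\infty}G(s)=\frac{(m+1)(n+1)}{mn}\in\,]0,1]$. A dot denotes differentiation with respect to $s$, and $H^{k}(s)$ means $(H(s))^{k}$. Variational inequality (VI): $\max\bigl\{\mathscr L w(x,s),\ x^{-1}F(s)-1-w(x,s)\bigr\}=0$, where $\mathscr L w(x,s)=\frac12\sigma^2x^2w_{xx}(x,s)+\mu x w_x(x,s)-r w(x,s)$; it is understood at the points $0<x<s$ with $x\neq H(s)$, at which $w$ is $C^2$. Transversality condition (TV): $\lim_{T\uparrow\infty}e^{-rT}\,\mathsf E\bigl[w(X_T,S_T)\bigr]=0$ (for every initial condition $0<x\leq s$). *)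

theory Defs
  imports "HOL-Probability.Probability"
begin

section \<open>Stochastic setting\<close>

text \<open>Time is the half-line \<open>[0,\<infinity>)\<close> inside the type of reals; only the values of filtrations and
  processes at nonnegative times matter. The measures \<open>Filt t\<close> merely carry sigma-algebras.\<close>

definition usual_conditions :: "'a measure \<Rightarrow> (real \<Rightarrow> 'a measure) \<Rightarrow> bool" where
  "usual_conditions M Filt \<longleftrightarrow>
     filtration (space M) Filt \<and>
     (\<forall>t\<ge>0. subalgebra M (Filt t)) \<and>
     complete_measure M \<and>
     null_sets M \<subseteq> sets (Filt 0) \<and>
     (\<forall>t\<ge>0. sets (Filt t) = (\<Inter>u\<in>{t<..}. sets (Filt u)))"

definition adapted_continuous ::
    "'a measure \<Rightarrow> (real \<Rightarrow> 'a measure) \<Rightarrow> (real \<Rightarrow> 'a \<Rightarrow> real) \<Rightarrow> bool" where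
  "adapted_continuous M Filt Y \<longleftrightarrow>
     (\<forall>t\<ge>0. Y t \<in> borel_measurable (Filt t)) \<and>
     (AE \<omega> in M. continuous_on {0..} (\<lambda>t. Y t \<omega>))"

definition brownian_motion ::
    "'a measure \<Rightarrow> (real \<Rightarrow> 'a measure) \<Rightarrow> (real \<Rightarrow> 'a \<Rightarrow> real) \<Rightarrow> bool" where
  "brownian_motion M Filt W \<longleftrightarrow>
     adapted_continuous M Filt W \<and>
     (AE \<omega> in M. W 0 \<omega> = 0) \<and>
     (\<forall>u t. 0 \<le> u \<and> u < t \<longrightarrow>
        distributed M lborel (\<lambda>\<omega>. W t \<omega> - W u \<omega>) (\<lambda>z. ennreal (normal_density 0 (sqrt (t - u)) z)) \<and>
        prob_space.indep_set M (sets (Filt u))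
          (sets (vimage_algebra (space M) (\<lambda>\<omega>. W t \<omega> - W u \<omega>) borel)))"

text \<open>The Ito integral over \<open>[0,t]\<close> of an adapted integrand \<open>Y\<close> with continuous paths: \<open>J\<close> is the
  limit in probability of the left-endpoint Riemann sums as the mesh of the partition
  \<open>0 = p 0 \<le> \<dots> \<le> p N = t\<close> tends to zero. This determines \<open>J\<close> up to null sets.\<close>

definition has_ito_integral ::
    "'a measure \<Rightarrow> (real \<Rightarrow> 'a \<Rightarrow> real) \<Rightarrow> (real \<Rightarrow> 'a \<Rightarrow> real) \<Rightarrow> real \<Rightarrow> ('a \<Rightarrow> real) \<Rightarrow> bool" where
  "has_ito_integral M W Y t J \<longleftrightarrow>
     J \<in> borel_measurable M \<and>
     (\<forall>\<epsilon>>0. \<exists>\<delta>>0. \<forall>(N::nat) p.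
        p 0 = 0 \<and> p N = t \<and> (\<forall>i<N. p i \<le> p (Suc i) \<and> p (Suc i) - p i < \<delta>) \<longrightarrow>
        measure M {\<omega> \<in> space M.
          \<epsilon> < \<bar>(\<Sum>i<N. Y (p i) \<omega> * (W (p (Suc i)) \<omega> - W (p i) \<omega>)) - J \<omega>\<bar>} < \<epsilon>)"

text \<open>Strong solution of \<open>dX = \<mu> X dt + \<sigma> X dW\<close>, \<open>X 0 = x\<close>.\<close>

definition geometric_brownian_motion ::
    "'a measure \<Rightarrow> (real \<Rightarrow> 'a measure) \<Rightarrow> (real \<Rightarrow> 'a \<Rightarrow> real) \<Rightarrow> real \<Rightarrow> real \<Rightarrow> real \<Rightarrow>
     (real \<Rightarrow> 'a \<Rightarrow> real) \<Rightarrow> bool" where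
  "geometric_brownian_motion M Filt W \<mu> \<sigma> x X \<longleftrightarrow>
     adapted_continuous M Filt X \<and>
     (AE \<omega> in M. X 0 \<omega> = x) \<and>
     (\<forall>t\<ge>0. \<exists>J. has_ito_integral M W (\<lambda>u \<omega>. \<sigma> * X u \<omega>) t J \<and>
        (AE \<omega> in M. X t \<omega> = x + integral {0..t} (\<lambda>u. \<mu> * X u \<omega>) + J \<omega>))"

definition running_max :: "real \<Rightarrow> (real \<Rightarrow> 'a \<Rightarrow> real) \<Rightarrow> real \<Rightarrow> 'a \<Rightarrow> real" where
  "running_max s X t \<omega> = max s (SUP u\<in>{0..t}. X u \<omega>)"

section \<open>The free boundary and the candidate value function\<close>

definition F :: "real \<Rightarrow> real" where
  "F s = 1 - exp (- s)"

definition G_lim :: "real \<Rightarrow> real \<Rightarrow> real" where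
  "G_lim m n = (m + 1) * (n + 1) / (m * n)"

definition G :: "real \<Rightarrow> real \<Rightarrow> real \<Rightarrow> real" where
  "G m n s = G_lim m n * F s"

definition H_circ :: "real \<Rightarrow> real" where
  "H_circ m = (m + 1) / m"

definition ode_rhs :: "real \<Rightarrow> real \<Rightarrow> real \<Rightarrow> real \<Rightarrow> real" where
  "ode_rhs m n s h =
     deriv F s * ((n + 1) * (h / s) powr (n - m) - (m + 1)) * h /
     (- m * n * (G m n s - h) * (1 - (h / s) powr (n - m)))"

definition A :: "real \<Rightarrow> real \<Rightarrow> (real \<Rightarrow> real) \<Rightarrow> real \<Rightarrow> real" where
  "A m n H s = (m * H s - (m + 1) * F s) / ((n - m) * H s powr (n + 1))"

definition B :: "real \<Rightarrow> real \<Rightarrow> (real \<Rightarrow> real) \<Rightarrow> real \<Rightarrow> real" where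
  "B m n H s = ((n + 1) * F s - n * H s) / ((n - m) * H s powr (m + 1))"

text \<open>Meaningful for \<open>0 < x \<le> s\<close> only.\<close>

definition w_fun :: "real \<Rightarrow> real \<Rightarrow> (real \<Rightarrow> real) \<Rightarrow> real \<Rightarrow> real \<Rightarrow> real" where
  "w_fun m n H x s =
     (if x \<le> H s then F s / x - 1 else A m n H s * x powr n + B m n H s * x powr m)"

section \<open>Regularity, variational inequality, transversality\<close>

text \<open>On sets that are not open, such as \<open>{(x, s). 0 < x \<and> x \<le> s}\<close>, derivatives are taken within
  the set; so on the diagonal they are the continuous extensions from the interior.\<close>

definition C1_on :: "('a::real_normed_vector \<Rightarrow> 'b::real_normed_vector) \<Rightarrow> 'a set \<Rightarrow> bool" where
  "C1_on f D \<longleftrightarrow>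
     (\<exists>f'. (\<forall>p\<in>D. (f has_derivative blinfun_apply (f' p)) (at p within D)) \<and> continuous_on D f')"

definition C2_on :: "('a::real_normed_vector \<Rightarrow> 'b::real_normed_vector) \<Rightarrow> 'a set \<Rightarrow> bool" where
  "C2_on f D \<longleftrightarrow>
     (\<exists>f'. (\<forall>p\<in>D. (f has_derivative blinfun_apply (f' p)) (at p within D)) \<and> C1_on f' D)"

definition generator ::
    "real \<Rightarrow> real \<Rightarrow> real \<Rightarrow> (real \<Rightarrow> real \<Rightarrow> real) \<Rightarrow> real \<Rightarrow> real \<Rightarrow> real" where
  "generator r \<mu> \<sigma> w x s =
     1/2 * \<sigma>\<^sup>2 * x\<^sup>2 * deriv (deriv (\<lambda>y. w y s)) x + \<mu> * x * deriv (\<lambda>y. w y s) x - r * w x s"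

definition variational_inequality ::
    "real \<Rightarrow> real \<Rightarrow> real \<Rightarrow> (real \<Rightarrow> real) \<Rightarrow> (real \<Rightarrow> real \<Rightarrow> real) \<Rightarrow> bool" where
  "variational_inequality r \<mu> \<sigma> H w \<longleftrightarrow>
     (\<forall>x s. 0 < x \<and> x < s \<and> x \<noteq> H s \<longrightarrow>
        max (generator r \<mu> \<sigma> w x s) (F s / x - 1 - w x s) = 0)"

text \<open>Here and below \<open>X x\<close> is the process started at \<open>x\<close>. Integrability is demanded explicitly
  because the Bochner integral of a non-integrable function is 0.\<close>

definition transversality ::
    "'a measure \<Rightarrow> real \<Rightarrow> (real \<Rightarrow> real \<Rightarrow> 'a \<Rightarrow> real) \<Rightarrow> (real \<Rightarrow> real \<Rightarrow> real) \<Rightarrow> bool" where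
  "transversality M r X w \<longleftrightarrow>
     (\<forall>x s. 0 < x \<and> x \<le> s \<longrightarrow>
        (\<forall>T\<ge>0. integrable M (\<lambda>\<omega>. w (X x T \<omega>) (running_max s (X x) T \<omega>))) \<and>
        ((\<lambda>T. exp (- r * T) * (\<integral>\<omega>. w (X x T \<omega>) (running_max s (X x) T \<omega>) \<partial>M)) \<longlongrightarrow> 0) at_top)"

definition exhausting_stopping_times ::
    "'a measure \<Rightarrow> (real \<Rightarrow> 'a measure) \<Rightarrow> (nat \<Rightarrow> 'a \<Rightarrow> real) \<Rightarrow> bool" where
  "exhausting_stopping_times M Filt \<tau> \<longleftrightarrow>
     (\<forall>l. stopping_time Filt (\<tau> l) \<and> (\<exists>C. \<forall>\<omega>\<in>space M. 0 \<le> \<tau> l \<omega> \<and> \<tau> l \<omega> \<le> C)) \<and>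
     (AE \<omega> in M. filterlim (\<lambda>l. \<tau> l \<omega>) at_top sequentially)"

definition stopped_value ::
    "real \<Rightarrow> (real \<Rightarrow> real \<Rightarrow> real) \<Rightarrow> (real \<Rightarrow> 'a \<Rightarrow> real) \<Rightarrow> real \<Rightarrow> ('a \<Rightarrow> real) \<Rightarrow> 'a \<Rightarrow> real" where
  "stopped_value r w X s \<tau> \<omega> =
     exp (- r * \<tau> \<omega>) * w (X (\<tau> \<omega>) \<omega>) (running_max s X (\<tau> \<omega>) \<omega>)"

end

(* The coefficients of the waiting region satisfy A' = - exp(-s) H^(-n-1) q / (1 - q) and
   B' = exp(-s) H^(-m-1) / (1 - q) with q = (H/s)^(n-m), by the ODE.  So the two branches of w fit
   to first order along x = H(s), w_s vanishes on the diagonal, and A decreases to a limit A_inf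
   that has the sign of H_circ - H_inf; (I)-(III) follow, the inequality w >= F/x - 1 of (III)
   because x (w - F/x + 1) has a nondecreasing derivative which vanishes at x = H(s).

   For (IV) and (V), |w(x,s') - A_inf x^n| <= C + eps x^n + eps x^m whenever s' >= s, with C
   depending on eps and s only.  Since exp(-r t) X_t^k is an exponential martingale for k = m and
   k = n, the expectation of the stopped value differs from A_inf x^n by at most
   C E[exp(-r tau)] + eps (x^n + x^m), so its limit is exactly A_inf x^n in both cases.

   The explicit form of X comes from the Riemann-sum definition of the Ito integral: with
   Z_t = exp(- sigma W_t + (sigma^2/2 - mu) t), the increments of X Z along a grid are small in
   mean square, so that X Z is constant. *)
theory Submission
  imports Defs "HOL-Real_Asymp.Real_Asymp"
begin

section \<open>Functions of class C1 and C2\<close>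

text \<open>\<open>X\<close> is accessible only through Riemann sums, whose limits are controlled in
  probability and at one fixed time each, and \<open>X\<close> is not assumed to be square
  integrable. This forces two grids and truncated processes in the proof that X Z is constant, with
  the fine mesh, the coarse mesh, the tolerance and the truncation level sent to their limits in
  this order. The constant in the growth estimate exists for the following reasons. If x <= H(s'),
  then x <= H_inf, and 1/x is absorbed by eps x^m because m < -1. If x > H(s'), then x > H(s), so
  that B x^m is bounded, and A is within eps of A_inf unless s', and with it x, stays bounded. The
  curve x = G(s) is where the generator applied to the payoff F/x - 1 vanishes; H < G therefore
  gives the sign of the generator in the stopping region. In (II) the limit of A is negative, so A
  x^n drags w down to minus infinity along x = s/2, below the payoff, which is always above
  -1.\<close>

lemma C1_onE:
  assumes "C1_on f D"
  obtains f' where "\<And>p. p \<in> D \<Longrightarrow> (f has_derivative blinfun_apply (f' p)) (at p within D)"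
    "continuous_on D f'"
  using assms unfolding C1_on_def by blast

lemma C1_on_imp_continuous_on:
  assumes "C1_on f D"
  shows "continuous_on D f"
  using assms unfolding C1_on_def
  by (meson has_derivative_continuous_on)

lemma C1_on_subset:
  assumes "C1_on f D" "E \<subseteq> D"
  shows "C1_on f E"
  using assms unfolding C1_on_def
  by (meson continuous_on_subset has_derivative_subset subsetD)

lemma C1_on_bounded_linear:
  assumes "bounded_linear L"
  shows "C1_on L D"
  unfolding C1_on_def
proof (intro exI conjI ballI)
  show "(L has_derivative blinfun_apply (Blinfun L)) (at p within D)" for p
    by (simp add: bounded_linear_Blinfun_apply[OF assms] bounded_linear_imp_has_derivative[OF assms])
qed simp

lemma C1_on_const: "C1_on (\<lambda>_. c) D"
  unfolding C1_on_def by (rule exI[of _ "\<lambda>_. 0"]) (auto simp: zero_blinfun.rep_eq)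

lemma C1_on_add:
  assumes "C1_on f D" "C1_on g D"
  shows "C1_on (\<lambda>p. f p + g p) D"
proof -
  from assms(1) obtain f' where f: "\<And>p. p \<in> D \<Longrightarrow> (f has_derivative blinfun_apply (f' p)) (at p within D)" "continuous_on D f'"
    by (rule C1_onE) blast
  from assms(2) obtain g' where g: "\<And>p. p \<in> D \<Longrightarrow> (g has_derivative blinfun_apply (g' p)) (at p within D)" "continuous_on D g'"
    by (rule C1_onE) blast
  show ?thesis unfolding C1_on_def
  proof (intro exI conjI ballI)
    show "((\<lambda>p. f p + g p) has_derivative blinfun_apply (f' p + g' p)) (at p within D)" if "p \<in> D" for p
      using has_derivative_add[OF f(1) g(1), OF that that] by (simp add: plus_blinfun.rep_eq)
    show "continuous_on D (\<lambda>p. f' p + g' p)"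
      by (intro continuous_intros f g)
  qed
qed

lemma C1_on_scaleR:
  fixes f :: "'a::real_normed_vector \<Rightarrow> real"
  assumes "C1_on f D" "C1_on g D"
  shows "C1_on (\<lambda>p. f p *\<^sub>R g p) D"
proof -
  from assms(1) obtain f' where f: "\<And>p. p \<in> D \<Longrightarrow> (f has_derivative blinfun_apply (f' p)) (at p within D)" "continuous_on D f'"
    by (rule C1_onE) blast
  from assms(2) obtain g' where g: "\<And>p. p \<in> D \<Longrightarrow> (g has_derivative blinfun_apply (g' p)) (at p within D)" "continuous_on D g'"
    by (rule C1_onE) blast
  show ?thesis unfolding C1_on_def
  proof (intro exI conjI ballI)
    show "((\<lambda>p. f p *\<^sub>R g p) has_derivative
        blinfun_apply (f p *\<^sub>R g' p + (blinfun_scaleR_left (g p) o\<^sub>L f' p))) (at p within D)" if "p \<in> D" for p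
      using has_derivative_scaleR[OF f(1) g(1), OF that that]
      by (simp add: plus_blinfun.rep_eq scaleR_blinfun.rep_eq)
    show "continuous_on D (\<lambda>p. f p *\<^sub>R g' p + (blinfun_scaleR_left (g p) o\<^sub>L f' p))"
      by (intro continuous_intros f g C1_on_imp_continuous_on assms
          bounded_bilinear.continuous_on[OF bounded_bilinear_blinfun_compose]
          bounded_linear.continuous_on[OF bounded_linear_blinfun_scaleR_left])
  qed
qed

lemma C1_on_mult:
  fixes f g :: "'a::real_normed_vector \<Rightarrow> real"
  assumes "C1_on f D" "C1_on g D"
  shows "C1_on (\<lambda>p. f p * g p) D"
  using C1_on_scaleR[OF assms] by simp

lemma C1_on_compose:
  assumes "C1_on \<phi> T" "C1_on g D" "g ` D \<subseteq> T"
  shows "C1_on (\<lambda>p. \<phi> (g p)) D"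
proof -
  from assms(1) obtain f' where f: "\<And>p. p \<in> T \<Longrightarrow> (\<phi> has_derivative blinfun_apply (f' p)) (at p within T)" "continuous_on T f'"
    by (rule C1_onE) blast
  from assms(2) obtain g' where g: "\<And>p. p \<in> D \<Longrightarrow> (g has_derivative blinfun_apply (g' p)) (at p within D)" "continuous_on D g'"
    by (rule C1_onE) blast
  show ?thesis unfolding C1_on_def
  proof (intro exI conjI ballI)
    show "((\<lambda>p. \<phi> (g p)) has_derivative blinfun_apply (f' (g p) o\<^sub>L g' p)) (at p within D)" if "p \<in> D" for p
    proof -
      have "(\<phi> has_derivative blinfun_apply (f' (g p))) (at (g p) within g ` D)"
        using f(1)[of "g p"] that assms(3) by (meson has_derivative_subset imageI subsetD)
      from has_derivative_in_compose[OF g(1)[OF that] this]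
      show ?thesis by (simp add: comp_def blinfun_compose.rep_eq)
    qed
    show "continuous_on D (\<lambda>p. f' (g p) o\<^sub>L g' p)"
      by (intro bounded_bilinear.continuous_on[OF bounded_bilinear_blinfun_compose] g
         continuous_on_compose2[OF f(2)] C1_on_imp_continuous_on assms)
  qed
qed

lemma C1_on_has_real_derivative:
  assumes "\<And>u. u \<in> T \<Longrightarrow> (\<phi> has_real_derivative \<phi>' u) (at u)" "continuous_on T \<phi>'"
  shows "C1_on \<phi> T"
  unfolding C1_on_def
proof (intro exI conjI ballI)
  show "(\<phi> has_derivative blinfun_apply (\<phi>' u *\<^sub>R id_blinfun)) (at u within T)" if "u \<in> T" for u
    using assms(1)[OF that] by (simp add: has_field_derivative_def scaleR_blinfun.rep_eq has_derivative_at_withinI cong: if_cong)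
  show "continuous_on T (\<lambda>u. \<phi>' u *\<^sub>R id_blinfun)"
    by (intro continuous_intros assms)
qed

lemma C1_on_powr: "C1_on (\<lambda>u::real. u powr k) {0<..}"
  by (rule C1_on_has_real_derivative[where \<phi>' = "\<lambda>u. k * u powr (k - 1)"])
     (auto intro!: derivative_eq_intros continuous_intros)

lemma C1_on_inverse: "C1_on (inverse :: real \<Rightarrow> real) {0<..}"
  by (rule C1_on_has_real_derivative[where \<phi>' = "\<lambda>u. - (inverse u * inverse u)"])
     (auto intro!: derivative_eq_intros continuous_intros)

lemma has_derivative_partials:
  fixes f :: "real \<times> real \<Rightarrow> real"
  assumes "(f has_derivative (\<lambda>v. a * fst v + b * snd v)) net"
  shows "(f has_derivative blinfun_apply (a *\<^sub>R fst_blinfun + b *\<^sub>R snd_blinfun)) net"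
  using assms by (simp add: plus_blinfun.rep_eq scaleR_blinfun.rep_eq)

lemma C1_on_partials:
  fixes f :: "real \<times> real \<Rightarrow> real"
  assumes "\<And>p. p \<in> D \<Longrightarrow> (f has_derivative (\<lambda>v. a p * fst v + b p * snd v)) (at p within D)"
    and "continuous_on D a" "continuous_on D b"
  shows "C1_on f D"
  unfolding C1_on_def
  by (intro exI[of _ "\<lambda>p. a p *\<^sub>R fst_blinfun + b p *\<^sub>R snd_blinfun"] conjI ballI
      has_derivative_partials assms(1) continuous_intros assms(2,3))

lemma C2_on_partials:
  fixes f :: "real \<times> real \<Rightarrow> real"
  assumes "\<And>p. p \<in> D \<Longrightarrow> (f has_derivative (\<lambda>v. a p * fst v + b p * snd v)) (at p within D)"
    and "C1_on a D" "C1_on b D"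
  shows "C2_on f D"
  unfolding C2_on_def
  by (intro exI[of _ "\<lambda>p. a p *\<^sub>R fst_blinfun + b p *\<^sub>R snd_blinfun"] conjI ballI
      has_derivative_partials assms(1) C1_on_add C1_on_scaleR assms(2,3) C1_on_const)

text \<open>Since \<open>U\<close> is a neighbourhood of \<open>p\<close>, the filters within
  \<open>D\<close> and within \<open>D \<inter> U\<close> coincide. In the application
  \<open>D\<close> is not open, as it contains the diagonal.\<close>

lemma has_derivative_within_Int_open:
  assumes "open U" "p \<in> U" "p \<in> D" "(f has_derivative f') (at p within (D \<inter> U))"
    and "\<And>y. y \<in> D \<inter> U \<Longrightarrow> h y = f y"
  shows "(h has_derivative f') (at p within D)"
proof -
  have "(h has_derivative f') (at p within (D \<inter> U))"
    by (rule has_derivative_transform[OF _ _ assms(4)]) (use assms in auto)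
  moreover have "at p within (D \<inter> U) = at p within D"
    by (rule at_within_nhd[OF assms(2,1)]) auto
  ultimately show ?thesis by simp
qed

text \<open>Both pieces are relatively open in \<open>D\<close> and disjoint, so the derivative can
  be patched by testing \<open>p \<in> U\<close> and nothing has to match. In the application the
  pieces lie on the two sides of the free boundary.\<close>

lemma C1_on_glue_open:
  assumes "open U" "open V" "U \<inter> V = {}" "D \<subseteq> U \<union> V"
    and "C1_on f (D \<inter> U)" "C1_on g (D \<inter> V)"
    and hf: "\<And>p. p \<in> D \<inter> U \<Longrightarrow> h p = f p" and hg: "\<And>p. p \<in> D \<inter> V \<Longrightarrow> h p = g p"
  shows "C1_on h D"
proof -
  from assms(5) obtain f' where f: "\<And>p. p \<in> D \<inter> U \<Longrightarrow> (f has_derivative blinfun_apply (f' p)) (at p within D \<inter> U)" "continuous_on (D \<inter> U) f'"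
    by (rule C1_onE) blast
  from assms(6) obtain g' where g: "\<And>p. p \<in> D \<inter> V \<Longrightarrow> (g has_derivative blinfun_apply (g' p)) (at p within D \<inter> V)" "continuous_on (D \<inter> V) g'"
    by (rule C1_onE) blast
  define h' where "h' p = (if p \<in> U then f' p else g' p)" for p
  have eq: "h' p = f' p" if "p \<in> D \<inter> U" for p using that by (auto simp: h'_def)
  have eq2: "h' p = g' p" if "p \<in> D \<inter> V" for p using that assms(3) by (auto simp: h'_def)
  show ?thesis unfolding C1_on_def
  proof (intro exI conjI ballI)
    fix p assume "p \<in> D"
    then consider "p \<in> D \<inter> U" | "p \<in> D \<inter> V" using assms(4) by auto
    then show "(h has_derivative blinfun_apply (h' p)) (at p within D)"
    proof cases
      case 1
      with assms f(1)[OF 1] eq[OF 1] show ?thesis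
        by (auto intro: has_derivative_within_Int_open[of U])
    next
      case 2
      with assms g(1)[OF 2] eq2[OF 2] show ?thesis
        by (auto intro: has_derivative_within_Int_open[of V])
    qed
  next
    have "continuous_on (D \<inter> U) h'" "continuous_on (D \<inter> V) h'"
      using continuous_on_cong[of "D \<inter> U" "D \<inter> U" h' f'] continuous_on_cong[of "D \<inter> V" "D \<inter> V" h' g']
        f(2) g(2) eq eq2 by blast+
    then have "continuous_on (D \<inter> U \<union> D \<inter> V) h'"
      by (rule continuous_on_Un_local_open[rotated 2])
         (use assms(1,2,4) in \<open>auto simp: openin_open Int_Un_distrib[symmetric]\<close>)
    moreover have "D \<inter> U \<union> D \<inter> V = D" using assms(4) by auto
    ultimately show "continuous_on D h'" by simp
  qed
qed

text \<open>The patched derivative is again a function glued from two pieces, now with values in a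
  space of linear maps, so \<open>C1_on_glue_open\<close> applies to it.\<close>

lemma C2_on_glue_open:
  assumes "open U" "open V" "U \<inter> V = {}" "D \<subseteq> U \<union> V"
    and "C2_on f (D \<inter> U)" "C2_on g (D \<inter> V)"
    and hf: "\<And>p. p \<in> D \<inter> U \<Longrightarrow> h p = f p" and hg: "\<And>p. p \<in> D \<inter> V \<Longrightarrow> h p = g p"
  shows "C2_on h D"
proof -
  from assms(5) obtain f' where f: "\<And>p. p \<in> D \<inter> U \<Longrightarrow> (f has_derivative blinfun_apply (f' p)) (at p within D \<inter> U)" "C1_on f' (D \<inter> U)"
    unfolding C2_on_def by blast
  from assms(6) obtain g' where g: "\<And>p. p \<in> D \<inter> V \<Longrightarrow> (g has_derivative blinfun_apply (g' p)) (at p within D \<inter> V)" "C1_on g' (D \<inter> V)"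
    unfolding C2_on_def by blast
  define h' where "h' p = (if p \<in> U then f' p else g' p)" for p
  have eq: "h' p = f' p" if "p \<in> D \<inter> U" for p using that by (auto simp: h'_def)
  have eq2: "h' p = g' p" if "p \<in> D \<inter> V" for p using that assms(3) by (auto simp: h'_def)
  show ?thesis unfolding C2_on_def
  proof (intro exI conjI ballI)
    fix p assume "p \<in> D"
    then consider "p \<in> D \<inter> U" | "p \<in> D \<inter> V" using assms(4) by auto
    then show "(h has_derivative blinfun_apply (h' p)) (at p within D)"
    proof cases
      case 1
      with assms f(1)[OF 1] eq[OF 1] show ?thesis
        by (auto intro: has_derivative_within_Int_open[of U])
    next
      case 2
      with assms g(1)[OF 2] eq2[OF 2] show ?thesis
        by (auto intro: has_derivative_within_Int_open[of V])
    qed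
  next
    show "C1_on h' D"
      by (rule C1_on_glue_open[OF assms(1-4) f(2) g(2)]) (use eq eq2 in auto)
  qed
qed

section \<open>The free boundary\<close>

lemma F_pos: "0 < s \<Longrightarrow> 0 < F s"
  by (simp add: F_def)

lemma F_less_self: "0 < s \<Longrightarrow> F s < s"
  unfolding F_def using exp_ge_add_one_self[of "- s"] exp_minus_greater[of s] by linarith

lemma F_less_1: "F s < 1"
  by (simp add: F_def)

lemma F_has_real_derivative: "(F has_real_derivative exp (- s)) (at s)"
  unfolding F_def[abs_def] by (auto intro!: derivative_eq_intros)

lemma F_tendsto: "(F \<longlongrightarrow> 1) at_top"
proof -
  have "((\<lambda>s::real. 1 - exp (- s)) \<longlongrightarrow> 1 - 0) at_top"
    by (intro tendsto_intros filterlim_compose[OF exp_at_bot] filterlim_uminus_at_bot_at_top)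
  then show ?thesis by (simp add: F_def[abs_def])
qed

section \<open>Ordering of the curves \<open>H\<close>, \<open>G\<close>, \<open>F\<close> and the
  diagonal\<close>

locale free_boundary =
  fixes m n H_inf :: real and H :: "real \<Rightarrow> real"
  assumes m: "m < - 1" and n: "0 < n" and mn: "0 \<le> m + n + 1"
    and H_inf: "0 < H_inf"
    and ode: "\<And>s. 0 < s \<Longrightarrow> (H has_real_derivative ode_rhs m n s (H s)) (at s)"
    and H_bounds: "\<And>s. 0 < s \<Longrightarrow> 0 < H s \<and> H s < G m n s"
    and H_increasing: "\<And>s. 0 < s \<Longrightarrow> deriv H s > 0"
    and H_tendsto: "(H \<longlongrightarrow> H_inf) at_top"
begin

text \<open>The numerator of \<open>G_lim\<close> is \<open>m * n + (m + n + 1)\<close> and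
  \<open>m * n < 0\<close>, so the assumption \<open>0 \<le> m + n + 1\<close> gives
  \<open>G_lim m n \<le> 1\<close>. The chain \<open>H < G \<le> F < s\<close> then keeps the
  boundary strictly below the diagonal.\<close>

lemma G_le_F: "0 < s \<Longrightarrow> G m n s \<le> F s"
proof -
  assume "0 < s"
  have "m * n < 0" using m n by (simp add: mult_neg_pos)
  then have "G_lim m n \<le> 1"
    using mn unfolding G_lim_def by (simp add: divide_le_eq algebra_simps)
  then show ?thesis unfolding G_def using F_pos[OF \<open>0 < s\<close>] mult_right_mono[of "G_lim m n" 1 "F s"] by simp
qed

lemma H_less_F: "0 < s \<Longrightarrow> H s < F s"
  using H_bounds[of s] G_le_F[of s] by linarith

lemma H_less_self: "0 < s \<Longrightarrow> H s < s"
  using H_less_F F_less_self by (meson less_trans)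

lemma ode_rhs_pos: "0 < s \<Longrightarrow> 0 < ode_rhs m n s (H s)"
  using ode H_increasing DERIV_imp_deriv by metis

lemma H_strict_mono:
  assumes "0 < s" "s < t"
  shows "H s < H t"
  by (rule DERIV_pos_imp_increasing[where f = H, OF assms(2)])
     (use ode ode_rhs_pos assms in \<open>meson less_le_trans\<close>)

lemma H_mono: "0 < s \<Longrightarrow> s \<le> t \<Longrightarrow> H s \<le> H t"
  using H_strict_mono[of s t] by (cases "s = t") auto

lemma H_le_H_inf: "0 < s \<Longrightarrow> H s \<le> H_inf"
  by (rule tendsto_lowerbound[OF H_tendsto])
     (use H_mono in \<open>auto simp: eventually_at_top_linorder intro!: exI[of _ s]\<close>)

section \<open>Derivatives of the coefficients \<open>A\<close> and \<open>B\<close>\<close>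

definition q :: "real \<Rightarrow> real" where "q s = (H s / s) powr (n - m)"

lemma q_bounds: "0 < s \<Longrightarrow> 0 < q s \<and> q s < 1"
  using H_bounds[of s] H_less_self[of s] m n powr_less_mono2[of "n - m" "H s / s" 1]
  unfolding q_def by auto

text \<open>The ODE cleared of its denominator, which is nonzero because \<open>H < G\<close> and
  \<open>q < 1\<close>; in this form the factor \<open>m * n * (G - H)\<close> can be replaced by an
  expression in \<open>F\<close> and \<open>H\<close>.\<close>

lemma ode_rhs_eq:
  assumes "0 < s"
  shows "m * n * (G m n s - H s) * (1 - q s) * ode_rhs m n s (H s) = - exp (- s) * ((n + 1) * q s - (m + 1)) * H s"
proof -
  have "deriv F s = exp (- s)"
    by (rule DERIV_imp_deriv[OF F_has_real_derivative])
  moreover have "G m n s - H s \<noteq> 0" "1 - q s \<noteq> 0" using H_bounds[OF assms] q_bounds[OF assms] by auto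
  moreover have "m \<noteq> 0" "n \<noteq> 0" using m n by auto
  ultimately show ?thesis unfolding ode_rhs_def q_def[symmetric]
    by (simp add: divide_simps)
qed

text \<open>\<open>dA\<close> and \<open>dB\<close> are written as products with
  \<open>inverse\<close>, so that their regularity follows from the product and composition rules
  for \<open>C1_on\<close>.\<close>

definition dA :: "real \<Rightarrow> real" where
  "dA s = - (exp (- s) * H s powr (- n - 1) * q s * inverse (1 - q s))"

definition dB :: "real \<Rightarrow> real" where
  "dB s = exp (- s) * H s powr (- m - 1) * inverse (1 - q s)"

text \<open>The pair \<open>(k, l) = (m, n)\<close> serves \<open>A\<close> and
  \<open>(n, m)\<close> serves \<open>B\<close>. In the product rule the terms with the derivative
  of \<open>H\<close> combine to \<open>((k+1)(l+1) F - k l H) H'\<close>, which is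
  \<open>m n (G - H) H'\<close> by the definition of \<open>G\<close>, and this is exactly the
  quantity that the ODE determines.\<close>

lemma coefficient_derivative:
  fixes k l :: real
  assumes "0 < s" and c: "k * l = m * n" "(k + 1) * (l + 1) = (m + 1) * (n + 1)"
  shows "((\<lambda>s. (k * H s - (k + 1) * F s) * H s powr (- l - 1)) has_real_derivative
     exp (- s) * H s powr (- l - 1) * (((n + 1) * q s - (m + 1)) / (1 - q s) * (- 1) - (k + 1))) (at s)"
proof -
  define h where "h = H s"
  define d where "d = ode_rhs m n s h"
  define P where "P = h powr (- l - 2)"
  have h: "0 < h" using H_bounds[OF assms(1)] by (simp add: h_def)
  have P1: "h powr (- l - 1) = P * h"
    unfolding P_def using h powr_add[of h "- l - 2" 1] by (simp add: minus_diff_commute)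
  have D: "(H has_real_derivative d) (at s)" using ode[OF assms(1)] by (simp add: d_def h_def)
  have q: "1 - q s \<noteq> 0" using q_bounds[OF assms(1)] by auto
  have GF: "m * n * G m n s = (k + 1) * (l + 1) * F s"
    using m n c unfolding G_def G_lim_def by simp
  have e: "m * n * (G m n s - h) * (1 - q s) * d = - exp (- s) * ((n + 1) * q s - (m + 1)) * h"
    using ode_rhs_eq[OF assms(1)] unfolding d_def h_def .
  then have "m * n * (G m n s - h) * d = exp (- s) * h * (((n + 1) * q s - (m + 1)) / (1 - q s) * (- 1))"
    using q by (simp add: field_simps)
  moreover have "m * n * (G m n s - h) * d = ((k + 1) * (l + 1) * F s - k * l * h) * d"
    using GF c by (simp add: algebra_simps)
  ultimately have e2: "exp (- s) * h * (((n + 1) * q s - (m + 1)) / (1 - q s) * (- 1)) = ((k + 1) * (l + 1) * F s - k * l * h) * d"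
    by simp
  have "((\<lambda>s. (k * H s - (k + 1) * F s) * H s powr (- l - 1)) has_real_derivative
     (k * d - (k + 1) * exp (- s)) * h powr (- l - 1) + (k * h - (k + 1) * F s) * ((- l - 1) * P * d)) (at s)"
  proof -
    have "((\<lambda>s. H s powr (- l - 1)) has_real_derivative (- l - 1) * h powr (- l - 1 - 1) * d) (at s)"
      using DERIV_chain2[OF has_real_derivative_powr D] h unfolding h_def by blast
    then have "((\<lambda>s. H s powr (- l - 1)) has_real_derivative (- l - 1) * P * d) (at s)"
      unfolding P_def by (simp add: algebra_simps)
    from DERIV_mult[OF DERIV_diff[OF DERIV_cmult[OF D, of k] DERIV_cmult[OF F_has_real_derivative, of "k + 1"]] this]
    show ?thesis by (simp only: h_def mult.commute add.commute)
  qed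
  moreover have "(k * d - (k + 1) * exp (- s)) * h powr (- l - 1) + (k * h - (k + 1) * F s) * ((- l - 1) * P * d)
    = P * (((k + 1) * (l + 1) * F s - k * l * h) * d - (k + 1) * exp (- s) * h)"
    unfolding P1 by (simp add: algebra_simps)
  moreover have "\<dots> = exp (- s) * h powr (- l - 1) * (((n + 1) * q s - (m + 1)) / (1 - q s) * (- 1) - (k + 1))"
    unfolding e2[symmetric] P1 by (simp add: algebra_simps)
  ultimately show ?thesis by (simp add: h_def)
qed

lemma A_eq: "A m n H s = (m * H s - (m + 1) * F s) * H s powr (- n - 1) / (n - m)"
proof -
  have "- n - 1 = - (n + 1)" by simp
  then show ?thesis unfolding A_def by (simp only: powr_minus) (simp add: divide_inverse)
qed

text \<open>With the signs arranged this way \<open>B\<close> is \<open>A_eq\<close> with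
  \<open>m\<close> and \<open>n\<close> exchanged, as \<open>coefficient_derivative\<close>
  requires.\<close>

lemma B_eq: "B m n H s = (n * H s - (n + 1) * F s) * H s powr (- m - 1) / (m - n)"
proof -
  have e: "- m - 1 = - (m + 1)" by simp
  have "B m n H s = - (n * H s - (n + 1) * F s) / - (m - n) * H s powr (- m - 1)"
    unfolding B_def e powr_minus by (simp add: divide_inverse)
  then show ?thesis unfolding minus_divide_divide by (simp only: times_divide_eq_left)
qed

lemma A_has_real_derivative:
  assumes "0 < s"
  shows "(A m n H has_real_derivative dA s) (at s)"
proof -
  have q: "1 - q s \<noteq> 0" "n - m \<noteq> 0" using q_bounds[OF assms] m n by auto
  have "((\<lambda>s. (m * H s - (m + 1) * F s) * H s powr (- n - 1) / (n - m)) has_real_derivative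
    exp (- s) * H s powr (- n - 1) * (((n + 1) * q s - (m + 1)) / (1 - q s) * (- 1) - (m + 1)) / (n - m)) (at s)"
    by (intro DERIV_cdivide coefficient_derivative assms) auto
  moreover have "((n + 1) * q s - (m + 1)) / (1 - q s) * (- 1) - (m + 1) = - ((n - m) * q s * inverse (1 - q s))"
    using q by (simp add: divide_simps) (simp add: algebra_simps)
  ultimately have "((\<lambda>s. (m * H s - (m + 1) * F s) * H s powr (- n - 1) / (n - m)) has_real_derivative dA s) (at s)"
    using q unfolding dA_def by (simp add: mult.assoc)
  then show ?thesis
    by (rule DERIV_cong_ev[THEN iffD1, rotated -1])
       (use eventually_nhds_in_open[of "{0<..}" s] assms A_eq in \<open>auto elim!: eventually_mono\<close>)
qed

lemma B_has_real_derivative: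
  assumes "0 < s"
  shows "(B m n H has_real_derivative dB s) (at s)"
proof -
  have q: "1 - q s \<noteq> 0" "m - n \<noteq> 0" using q_bounds[OF assms] m n by auto
  have "((\<lambda>s. (n * H s - (n + 1) * F s) * H s powr (- m - 1) / (m - n)) has_real_derivative
    exp (- s) * H s powr (- m - 1) * (((n + 1) * q s - (m + 1)) / (1 - q s) * (- 1) - (n + 1)) / (m - n)) (at s)"
    by (intro DERIV_cdivide coefficient_derivative assms) auto
  moreover have "((n + 1) * q s - (m + 1)) / (1 - q s) * (- 1) - (n + 1) = (m - n) * inverse (1 - q s)"
    using q by (simp add: divide_simps) (simp add: algebra_simps)
  ultimately have "((\<lambda>s. (n * H s - (n + 1) * F s) * H s powr (- m - 1) / (m - n)) has_real_derivative dB s) (at s)"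
    using q unfolding dB_def by (simp add: mult.assoc)
  then show ?thesis
    by (rule DERIV_cong_ev[THEN iffD1, rotated -1])
       (use eventually_nhds_in_open[of "{0<..}" s] assms B_eq in \<open>auto elim!: eventually_mono\<close>)
qed

lemma dA_neg: "0 < s \<Longrightarrow> dA s < 0"
  using q_bounds[of s] H_bounds[of s] unfolding dA_def by auto

section \<open>Limits, signs and bounds of the coefficients\<close>

definition A_inf :: real where "A_inf = (m * H_inf - (m + 1)) / ((n - m) * H_inf powr (n + 1))"

lemma A_tendsto: "(A m n H \<longlongrightarrow> A_inf) at_top"
proof -
  have "((\<lambda>s. (m * H s - (m + 1) * F s) / ((n - m) * H s powr (n + 1))) \<longlongrightarrow>
     (m * H_inf - (m + 1) * 1) / ((n - m) * H_inf powr (n + 1))) at_top"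
    by (intro tendsto_intros H_tendsto F_tendsto) (use m n H_inf in auto)
  then show ?thesis by (simp add: A_def[abs_def] A_inf_def)
qed

lemma A_strict_antimono:
  assumes "0 < s" "s < t"
  shows "A m n H t < A m n H s"
  by (rule DERIV_neg_imp_decreasing[where f = "A m n H", OF assms(2)])
     (use A_has_real_derivative dA_neg assms in \<open>meson less_le_trans\<close>)

lemma A_gt_A_inf:
  assumes "0 < s"
  shows "A_inf < A m n H s"
proof -
  have "A_inf \<le> A m n H (s + 1)"
    by (rule tendsto_upperbound[OF A_tendsto])
       (use A_strict_antimono[of "s + 1"] assms
         in \<open>auto simp: eventually_at_top_linorder le_less intro!: exI[of _ "s + 1"]\<close>)
  also have "\<dots> < A m n H s" using A_strict_antimono[of s "s + 1"] assms by simp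
  finally show ?thesis .
qed

text \<open>\<open>H_circ m\<close> is the zero of the numerator of \<open>A_inf\<close> as a
  function of \<open>H_inf\<close>, and the remaining factor is positive because
  \<open>m < 0\<close>. A statement about \<open>sgn\<close> serves the three cases of the theorem
  at once.\<close>

lemma sgn_A_inf: "sgn A_inf = sgn (H_circ m - H_inf)"
proof -
  have "(m * H_inf - (m + 1)) / K = ((m + 1) / m - H_inf) * (- m / K)" for K
    using m by (cases "K = 0") (auto simp: field_simps)
  then have "A_inf = (H_circ m - H_inf) * (- m / ((n - m) * H_inf powr (n + 1)))"
    unfolding A_inf_def H_circ_def .
  moreover have "0 < - m / ((n - m) * H_inf powr (n + 1))"
    using m n H_inf by (intro divide_pos_pos mult_pos_pos) auto
  ultimately show ?thesis by (simp only: sgn_mult sgn_pos mult_1_right)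
qed

lemma B_pos: "0 < s \<Longrightarrow> 0 < B m n H s"
proof -
  assume s: "0 < s"
  have "n * H s < n * F s" using H_less_F[OF s] n by simp
  then have "0 < (n + 1) * F s - n * H s" using F_pos[OF s] by (simp add: algebra_simps)
  then show ?thesis unfolding B_def using m n H_bounds[OF s] by simp
qed

text \<open>The exponent \<open>- m - 1\<close> is positive because \<open>m < - 1\<close>, so
  \<open>H \<le> H_inf\<close> and \<open>F < 1\<close> bound \<open>B\<close> uniformly in
  \<open>s\<close>.\<close>

lemma B_le:
  assumes "0 < s"
  shows "B m n H s \<le> (n + 1) / (n - m) * H_inf powr (- m - 1)"
proof -
  have "B m n H s = ((n + 1) * F s - n * H s) / (n - m) * H s powr (- m - 1)"
    using B_eq[of s] m n by (simp add: field_simps)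
  also have "\<dots> \<le> (n + 1) / (n - m) * H_inf powr (- m - 1)"
  proof (intro mult_mono divide_right_mono powr_mono2)
    have "(n + 1) * F s \<le> (n + 1) * 1" using F_less_1[of s] n by (intro mult_left_mono) auto
    moreover have "0 \<le> n * H s" using n H_bounds[OF assms] by auto
    ultimately show "(n + 1) * F s - n * H s \<le> n + 1" by simp
  qed (use m n H_bounds[OF assms] H_le_H_inf[OF assms] in auto)
  finally show ?thesis .
qed


section \<open>The two branches and their first-order fit along the boundary\<close>

definition stop_value :: "real \<times> real \<Rightarrow> real" where
  "stop_value p = F (snd p) / fst p - 1"

text \<open>Both branches are taken on the whole open quadrant, not only on their own region: they
  are smooth across the curve \<open>x = H s\<close>, so one-sided derivatives of \<open>w\<close>
  there are derivatives of a branch.\<close>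

definition wait_value :: "real \<times> real \<Rightarrow> real" where
  "wait_value p = A m n H (snd p) * fst p powr n + B m n H (snd p) * fst p powr m"

lemma w_fun_eq: "w_fun m n H x s = (if x \<le> H s then stop_value (x, s) else wait_value (x, s))"
  by (simp add: w_fun_def stop_value_def wait_value_def)

definition stop_dx :: "real \<times> real \<Rightarrow> real" where
  "stop_dx p = - (F (snd p) * (inverse (fst p) * inverse (fst p)))"

definition stop_ds :: "real \<times> real \<Rightarrow> real" where
  "stop_ds p = exp (- snd p) * inverse (fst p)"

definition wait_dx :: "real \<times> real \<Rightarrow> real" where
  "wait_dx p = A m n H (snd p) * (n * fst p powr (n - 1)) + B m n H (snd p) * (m * fst p powr (m - 1))"

definition wait_ds :: "real \<times> real \<Rightarrow> real" where
  "wait_ds p = dA (snd p) * fst p powr n + dB (snd p) * fst p powr m"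

lemma has_derivative_compose_fst:
  fixes p :: "real \<times> real"
  assumes "(\<phi> has_real_derivative d) (at (fst p))"
  shows "((\<lambda>p. \<phi> (fst p)) has_derivative (\<lambda>v. fst v * d)) (at p within D)"
  by (rule DERIV_compose_FDERIV[where f = \<phi> and g = fst, OF assms]) (intro has_derivative_fst has_derivative_ident)

lemma has_derivative_compose_snd:
  fixes p :: "real \<times> real"
  assumes "(\<phi> has_real_derivative d) (at (snd p))"
  shows "((\<lambda>p. \<phi> (snd p)) has_derivative (\<lambda>v. snd v * d)) (at p within D)"
  by (rule DERIV_compose_FDERIV[where f = \<phi> and g = snd, OF assms]) (intro has_derivative_snd has_derivative_ident)

lemma stop_value_has_derivative:
  assumes "0 < fst p"
  shows "(stop_value has_derivative (\<lambda>v. stop_dx p * fst v + stop_ds p * snd v)) (at p within D)"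
proof -
  have I: "(inverse has_real_derivative - (inverse (fst p) * inverse (fst p))) (at (fst p))"
    using assms by (auto intro!: derivative_eq_intros)
  have "((\<lambda>p. F (snd p) * inverse (fst p) - 1) has_derivative
     (\<lambda>v. F (snd p) * (fst v * - (inverse (fst p) * inverse (fst p)))
        + snd v * exp (- snd p) * inverse (fst p) - 0)) (at p within D)"
    by (intro has_derivative_diff has_derivative_mult has_derivative_const
        has_derivative_compose_snd[OF F_has_real_derivative] has_derivative_compose_fst[OF I])
  then show ?thesis
    unfolding stop_value_def[abs_def] stop_dx_def stop_ds_def divide_inverse
    by (rule has_derivative_eq_rhs) (auto simp: algebra_simps)
qed

lemma wait_value_has_derivative:
  assumes "0 < fst p" "0 < snd p"
  shows "(wait_value has_derivative (\<lambda>v. wait_dx p * fst v + wait_ds p * snd v)) (at p within D)"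
proof -
  have P: "((\<lambda>u. u powr k) has_real_derivative k * fst p powr (k - 1)) (at (fst p))" for k
    using assms by (auto intro!: derivative_eq_intros)
  have "(wait_value has_derivative
     (\<lambda>v. (A m n H (snd p) * (fst v * (n * fst p powr (n - 1))) + snd v * dA (snd p) * fst p powr n)
        + (B m n H (snd p) * (fst v * (m * fst p powr (m - 1))) + snd v * dB (snd p) * fst p powr m))) (at p within D)"
    unfolding wait_value_def[abs_def]
    by (intro has_derivative_add has_derivative_mult has_derivative_compose_fst[OF P]
        has_derivative_compose_snd[OF A_has_real_derivative] has_derivative_compose_snd[OF B_has_real_derivative] assms)
  then show ?thesis
    unfolding wait_dx_def wait_ds_def
    by (rule has_derivative_eq_rhs) (auto simp: algebra_simps)
qed

lemma A_powr: "0 < s \<Longrightarrow> A m n H s * H s powr n = (m * H s - (m + 1) * F s) / ((n - m) * H s)"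
  using H_bounds[of s] unfolding A_def by (simp add: powr_add)

lemma B_powr: "0 < s \<Longrightarrow> B m n H s * H s powr m = ((n + 1) * F s - n * H s) / ((n - m) * H s)"
  using H_bounds[of s] unfolding B_def by (simp add: powr_add)

text \<open>\<open>A s\<close> and \<open>B s\<close> solve the two linear equations that match
  value and \<open>x\<close>-derivative of the branches at \<open>x = H s\<close>; this lemma and
  \<open>dx_fit\<close> check the two equations.\<close>

lemma value_fit:
  assumes "0 < s"
  shows "wait_value (H s, s) = stop_value (H s, s)"
proof -
  have h: "H s \<noteq> 0" "n - m \<noteq> 0" using H_bounds[OF assms] m n by auto
  have "wait_value (H s, s) = ((m * H s - (m + 1) * F s) + ((n + 1) * F s - n * H s)) / ((n - m) * H s)"
    unfolding wait_value_def fst_conv snd_conv A_powr[OF assms] B_powr[OF assms] add_divide_distrib ..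
  also have "(m * H s - (m + 1) * F s) + ((n + 1) * F s - n * H s) = (n - m) * (F s - H s)"
    by (simp add: algebra_simps)
  also have "(n - m) * (F s - H s) / ((n - m) * H s) = F s / H s - 1"
    using h by (simp add: diff_divide_distrib)
  finally show ?thesis by (simp add: stop_value_def)
qed

lemma dx_fit:
  assumes "0 < s"
  shows "wait_dx (H s, s) = stop_dx (H s, s)"
proof -
  have h: "0 < H s" "n - m \<noteq> 0" using H_bounds[OF assms] m n by auto
  have "wait_dx (H s, s) = (n * (A m n H s * H s powr n) + m * (B m n H s * H s powr m)) / H s"
    using h unfolding wait_dx_def by (simp add: powr_diff add_divide_distrib mult_ac)
  also have "n * (A m n H s * H s powr n) + m * (B m n H s * H s powr m)
     = (n * (m * H s - (m + 1) * F s) + m * ((n + 1) * F s - n * H s)) / ((n - m) * H s)"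
    unfolding A_powr[OF assms] B_powr[OF assms] times_divide_eq_right add_divide_distrib ..
  also have "n * (m * H s - (m + 1) * F s) + m * ((n + 1) * F s - n * H s) = (n - m) * (- F s)"
    by (simp add: algebra_simps)
  also have "(n - m) * (- F s) / ((n - m) * H s) / H s = - F s / (H s * H s)"
    using h by simp
  finally show ?thesis by (simp add: stop_dx_def divide_inverse)
qed

text \<open>This fit uses the ODE, through \<open>dA\<close> and \<open>dB\<close>: all powers of
  \<open>H\<close> cancel to \<open>inverse (H s)\<close>, and the remaining factor is
  \<open>(1 - q) / (1 - q) = 1\<close>.\<close>

lemma ds_fit:
  assumes "0 < s" 
  shows "wait_ds (H s, s) = stop_ds (H s, s)"
proof -
  have h: "0 < H s" using H_bounds assms by auto
  have q: "1 - q s \<noteq> 0" using q_bounds[OF assms] by auto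
  have "H s powr (- n - 1) * H s powr n = inverse (H s)" "H s powr (- m - 1) * H s powr m = inverse (H s)"
    using h by (simp_all add: powr_add[symmetric] powr_minus)
  moreover have "wait_ds (H s, s) = exp (- s) * ((H s powr (- m - 1) * H s powr m) * inverse (1 - q s)
      - (H s powr (- n - 1) * H s powr n) * q s * inverse (1 - q s))"
    unfolding wait_ds_def dA_def dB_def by (simp add: algebra_simps)
  ultimately have "wait_ds (H s, s) = exp (- s) * inverse (H s) * (- q s * inverse (1 - q s) + inverse (1 - q s))"
    by (simp add: algebra_simps)
  also have "- q s * inverse (1 - q s) + inverse (1 - q s) = 1"
    using q by (simp add: field_simps)
  finally show ?thesis by (simp add: stop_ds_def)
qed

text \<open>Since \<open>q = H powr (n - m) * s powr (m - n)\<close>, the product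
  \<open>H powr (- n - 1) * q * s powr n\<close> equals \<open>H powr (- m - 1) * s powr m\<close>,
  and the two terms of \<open>wait_ds\<close> cancel. This is what the power
  \<open>(H s / s) powr (n - m)\<close> in the ODE achieves.\<close>

lemma wait_ds_diagonal:
  assumes "0 < s" 
  shows "wait_ds (s, s) = 0"
proof -
  have h: "0 < H s" using H_bounds assms by auto
  have "q s = H s powr (n - m) * s powr (m - n)"
    using h assms powr_minus_divide[of s "n - m"] unfolding q_def by (simp add: powr_divide)
  then have "H s powr (- n - 1) * q s * s powr n = (H s powr (- n - 1) * H s powr (n - m)) * (s powr (m - n) * s powr n)"
    by simp
  also have "H s powr (- n - 1) * H s powr (n - m) = H s powr (- m - 1)"
    unfolding powr_add[symmetric] by (rule arg_cong[where f = "(powr) (H s)"]) simp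
  also have "s powr (m - n) * s powr n = s powr m"
    unfolding powr_add[symmetric] by simp
  finally have e: "H s powr (- n - 1) * q s * s powr n = H s powr (- m - 1) * s powr m" .
  have "wait_ds (s, s) = exp (- s) * inverse (1 - q s) * (H s powr (- m - 1) * s powr m - H s powr (- n - 1) * q s * s powr n)"
    unfolding wait_ds_def dA_def dB_def by (simp add: algebra_simps)
  then show ?thesis unfolding e by simp
qed

section \<open>Regularity of \<open>w\<close>\<close>

lemma continuous_on_H: "continuous_on {0<..} H"
  by (rule continuous_at_imp_continuous_on) (auto intro: DERIV_isCont ode)

text \<open>The right-hand side of the ODE is continuous along the solution because no denominator
  vanishes. This makes \<open>dA\<close> and \<open>dB\<close> C1, which is the second order of
  smoothness in (I).\<close>

lemma C1_on_H: "C1_on H {0<..}"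
proof (rule C1_on_has_real_derivative)
  have d: "deriv F = (\<lambda>s. exp (- s))"
    by (rule ext, rule DERIV_imp_deriv, rule F_has_real_derivative)
  have "H s / s \<noteq> 0" "1 - (H s / s) powr (n - m) \<noteq> 0" "G m n s - H s \<noteq> 0" if "0 < s" for s
    using q_bounds[OF that] H_bounds[OF that] that unfolding q_def by auto
  then have nz: "\<forall>s\<in>{0<..}. H s / s \<noteq> 0 \<or> 0 < n - m"
    "\<forall>s\<in>{0<..}. - m * n * (G m n s - H s) * (1 - (H s / s) powr (n - m)) \<noteq> 0"
    using m n by auto
  have Q: "continuous_on {0<..} (\<lambda>s. (H s / s) powr (n - m))"
    by (intro continuous_on_powr continuous_on_divide continuous_on_H continuous_on_id continuous_on_const)
       (use H_bounds in force)+
  have GH: "continuous_on {0<..} (\<lambda>s. G m n s)"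
    unfolding G_def F_def by (intro continuous_intros)
  show "continuous_on {0<..} (\<lambda>s. ode_rhs m n s (H s))"
    unfolding ode_rhs_def d
    by (intro continuous_on_divide continuous_on_mult continuous_on_diff continuous_on_const Q GH
        continuous_on_H continuous_on_exp continuous_on_minus continuous_on_id nz)
qed (use ode in auto)

lemma C1_on_F: "C1_on F T"
  by (rule C1_on_has_real_derivative[OF F_has_real_derivative]) (intro continuous_intros)

lemma C1_on_H_powr: "C1_on (\<lambda>s. H s powr k) {0<..}"
  by (rule C1_on_compose[OF C1_on_powr C1_on_H]) (use H_bounds in auto)

lemma C1_on_q: "C1_on q {0<..}"
proof -
  have "C1_on (\<lambda>s. (H s * inverse s) powr (n - m)) {0<..}"
    by (rule C1_on_compose[OF C1_on_powr C1_on_mult[OF C1_on_H C1_on_inverse]]) (use H_bounds in auto)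
  then show ?thesis unfolding q_def[abs_def] divide_inverse .
qed

lemma C1_on_inverse_1_minus_q: "C1_on (\<lambda>s. inverse (1 - q s)) {0<..}"
proof -
  have "C1_on (\<lambda>s. 1 + (- 1) * q s) {0<..}"
    by (intro C1_on_add C1_on_mult C1_on_const C1_on_q)
  then show ?thesis
    by (intro C1_on_compose[OF C1_on_inverse]) (use q_bounds in auto)
qed

lemma C1_on_exp_minus: "C1_on (\<lambda>s::real. exp (- s)) T"
  by (rule C1_on_has_real_derivative[where \<phi>' = "\<lambda>s. - exp (- s)"])
     (auto intro!: derivative_eq_intros continuous_intros)

lemma C1_on_dA: "C1_on dA {0<..}"
proof -
  have "C1_on (\<lambda>s. (- 1) * (exp (- s) * H s powr (- n - 1) * q s * inverse (1 - q s))) {0<..}"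
    by (intro C1_on_mult C1_on_const C1_on_q C1_on_H_powr C1_on_inverse_1_minus_q C1_on_exp_minus)
  then show ?thesis by (simp add: dA_def[abs_def])
qed

lemma C1_on_dB: "C1_on dB {0<..}"
  unfolding dB_def[abs_def]
  by (intro C1_on_mult C1_on_const C1_on_q C1_on_H_powr C1_on_inverse_1_minus_q C1_on_exp_minus)

lemma C1_on_A: "C1_on (A m n H) {0<..}"
  by (rule C1_on_has_real_derivative[where \<phi>' = dA])
     (use A_has_real_derivative C1_on_imp_continuous_on[OF C1_on_dA] in auto)

lemma C1_on_B: "C1_on (B m n H) {0<..}"
  by (rule C1_on_has_real_derivative[where \<phi>' = dB])
     (use B_has_real_derivative C1_on_imp_continuous_on[OF C1_on_dB] in auto)

abbreviation quadrant :: "(real \<times> real) set" where "quadrant \<equiv> {p. 0 < fst p \<and> 0 < snd p}"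

lemma C1_on_fst_snd:
  "C1_on \<phi> {0<..} \<Longrightarrow> C1_on (\<lambda>p. \<phi> (fst p)) quadrant"
  "C1_on \<phi> {0<..} \<Longrightarrow> C1_on (\<lambda>p. \<phi> (snd p)) quadrant"
  by (rule C1_on_compose[OF _ C1_on_bounded_linear], assumption, auto intro: bounded_linear_fst bounded_linear_snd)+

lemma C1_on_stop_dx: "C1_on stop_dx quadrant"
proof -
  have "C1_on (\<lambda>p. (- 1) * (F (snd p) * (inverse (fst p) * inverse (fst p)))) quadrant"
    by (intro C1_on_mult C1_on_const C1_on_fst_snd C1_on_F C1_on_inverse)
  then show ?thesis by (simp add: stop_dx_def[abs_def])
qed

lemma C1_on_stop_ds: "C1_on stop_ds quadrant"
  unfolding stop_ds_def[abs_def]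
  by (intro C1_on_mult C1_on_fst_snd(1)[OF C1_on_inverse] C1_on_fst_snd(2)[OF C1_on_exp_minus])

lemma C1_on_wait_dx: "C1_on wait_dx quadrant"
  unfolding wait_dx_def[abs_def]
  by (intro C1_on_add C1_on_mult C1_on_const C1_on_fst_snd(1)[OF C1_on_powr] C1_on_fst_snd(2)[OF C1_on_A]
      C1_on_fst_snd(2)[OF C1_on_B])

lemma C1_on_wait_ds: "C1_on wait_ds quadrant"
  unfolding wait_ds_def[abs_def]
  by (intro C1_on_add C1_on_mult C1_on_const C1_on_fst_snd(1)[OF C1_on_powr] C1_on_fst_snd(2)[OF C1_on_dA]
      C1_on_fst_snd(2)[OF C1_on_dB])

lemma C2_on_stop_value: "E \<subseteq> quadrant \<Longrightarrow> C2_on stop_value E"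
  by (rule C2_on_partials[where a = stop_dx and b = stop_ds])
     (auto intro!: stop_value_has_derivative C1_on_subset[OF C1_on_stop_dx] C1_on_subset[OF C1_on_stop_ds])

lemma C2_on_wait_value: "E \<subseteq> quadrant \<Longrightarrow> C2_on wait_value E"
  by (rule C2_on_partials[where a = wait_dx and b = wait_ds])
     (auto intro!: wait_value_has_derivative C1_on_subset[OF C1_on_wait_dx] C1_on_subset[OF C1_on_wait_ds])

lemma continuous_on_gap: "continuous_on quadrant (\<lambda>p. fst p - H (snd p))"
  by (intro continuous_intros continuous_on_compose2[OF continuous_on_H]) auto

lemma open_quadrant: "open quadrant"
  by (intro open_Collect_conj open_Collect_less continuous_intros)

lemma open_regions: "open {p \<in> quadrant. fst p < H (snd p)}" "open {p \<in> quadrant. H (snd p) < fst p}"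
proof -
  have "open ({p. 0 < fst p \<and> 0 < snd p} \<inter> (\<lambda>p. fst p - H (snd p)) -` {..<0})"
       "open ({p. 0 < fst p \<and> 0 < snd p} \<inter> (\<lambda>p. fst p - H (snd p)) -` {0<..})"
    by (intro continuous_open_preimage continuous_on_gap open_quadrant; simp)+
  then show "open {p \<in> quadrant. fst p < H (snd p)}" "open {p \<in> quadrant. H (snd p) < fst p}"
    by (simp_all add: vimage_def Int_def)
qed

lemma C2_on_w:
  "C2_on (\<lambda>(x, s). w_fun m n H x s) {(x, s). 0 < x \<and> x \<le> s \<and> x \<noteq> H s}" (is "C2_on ?w ?D")
proof (rule C2_on_glue_open[OF open_regions])
  let ?U = "{p \<in> quadrant. fst p < H (snd p)}" and ?V = "{p \<in> quadrant. H (snd p) < fst p}"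
  show "?U \<inter> ?V = {}" by auto
  show "?D \<subseteq> ?U \<union> ?V" by auto
  show "C2_on stop_value (?D \<inter> ?U)" "C2_on wait_value (?D \<inter> ?V)"
    by (rule C2_on_stop_value C2_on_wait_value, blast)+
  show "?w p = stop_value p" if "p \<in> ?D \<inter> ?U" for p
    using that by (cases p) (simp add: w_fun_eq)
  show "?w p = wait_value p" if "p \<in> ?D \<inter> ?V" for p
    using that by (cases p) (simp add: w_fun_eq)
qed

text \<open>The case distinction is put as \<open>fst p - H (snd p) \<le> 0\<close>, the form in
  which \<open>continuous_on_cases_le\<close> later gives continuity of the partial
  derivatives.\<close>

lemma w_has_derivative:
  assumes "p \<in> {(x, s). 0 < x \<and> x \<le> s}"
  shows "((\<lambda>(x, s). w_fun m n H x s) has_derivative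
    (\<lambda>v. (if fst p - H (snd p) \<le> 0 then stop_dx p else wait_dx p) * fst v
       + (if fst p - H (snd p) \<le> 0 then stop_ds p else wait_ds p) * snd v))
    (at p within {(x, s). 0 < x \<and> x \<le> s})" (is "(?w has_derivative ?w') (at p within ?D)")
proof -
  have p: "0 < fst p" "0 < snd p" using assms by auto
  consider "fst p < H (snd p)" | "H (snd p) < fst p" | "fst p = H (snd p)" by linarith
  then show ?thesis
  proof cases
    case 1
    show ?thesis
    proof (rule has_derivative_within_Int_open[OF open_regions(1)])
      show "(stop_value has_derivative ?w') (at p within ?D \<inter> {p \<in> quadrant. fst p < H (snd p)})"
        using stop_value_has_derivative[OF p(1)] 1 by simp
    qed (use 1 p assms in \<open>simp_all add: w_fun_eq split_beta\<close>)
  next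
    case 2
    show ?thesis
    proof (rule has_derivative_within_Int_open[OF open_regions(2)])
      show "(wait_value has_derivative ?w') (at p within ?D \<inter> {p \<in> quadrant. H (snd p) < fst p})"
        using wait_value_has_derivative[OF p] 2 by simp
    qed (use 2 p assms in \<open>simp_all add: w_fun_eq split_beta\<close>)
  next
    case 3
    then have pe: "p = (H (snd p), snd p)" by (simp add: prod_eq_iff)
    have fit: "wait_dx p = stop_dx p" "wait_ds p = stop_ds p"
      using dx_fit[OF p(2)] ds_fit[OF p(2)] pe by metis+
    \<comment> \<open>On the curve neither region is a neighbourhood of \<open>p\<close>. The domain
      is covered by \<open>S\<close> and \<open>T\<close>, both containing \<open>p\<close>;
      \<open>w\<close> is one branch on each, and by the fits both branches have the same derivative
      at \<open>p\<close>, which is then the derivative within the union.\<close>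
    define S T where "S = {p \<in> ?D. fst p \<le> H (snd p)}" and "T = {p \<in> ?D. H (snd p) \<le> fst p}"
    have ST: "S \<union> T = ?D" "p \<in> S" "p \<in> T" using assms 3 by (auto simp: S_def T_def)
    have S: "?w y = stop_value y" if "y \<in> S" for y
      using that by (simp add: S_def w_fun_eq split_beta)
    have T: "?w y = wait_value y" if "y \<in> T" for y
    proof (cases "fst y = H (snd y)")
      case True
      then have "y = (H (snd y), snd y)" "0 < snd y" using that by (auto simp: T_def prod_eq_iff)
      then have "wait_value y = stop_value y" using value_fit by metis
      then show ?thesis using True by (cases y) (simp add: w_fun_eq)
    qed (use that in \<open>simp add: T_def w_fun_eq split_beta\<close>)
    have "(stop_value has_derivative ?w') (at p within S)"
      using stop_value_has_derivative[OF p(1)] 3 by simp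
    then have "(?w has_derivative ?w') (at p within S)"
      by (intro has_derivative_transform[of p S ?w stop_value] ST(2) S)
    moreover have "(wait_value has_derivative ?w') (at p within T)"
      using wait_value_has_derivative[OF p] 3 fit by simp
    then have "(?w has_derivative ?w') (at p within T)"
      by (intro has_derivative_transform[of p T ?w wait_value] ST(3) T)
    ultimately show ?thesis
      unfolding ST(1)[symmetric] has_derivative_within by (blast intro: Lim_Un)
  qed
qed

lemma C1_on_w: "C1_on (\<lambda>(x, s). w_fun m n H x s) {(x, s). 0 < x \<and> x \<le> s}"
proof (rule C1_on_partials[OF w_has_derivative])
  let ?D = "{(x, s). 0 < x \<and> x \<le> (s::real)}"
  have gap: "continuous_on ?D (\<lambda>p. fst p - H (snd p))"
    by (rule continuous_on_subset[OF continuous_on_gap]) auto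
  note c = C1_on_imp_continuous_on[THEN continuous_on_subset]
  have fit: "stop_dx p = wait_dx p \<and> stop_ds p = wait_ds p" if "p \<in> ?D" "fst p - H (snd p) = 0" for p
  proof -
    have "p = (H (snd p), snd p)" "0 < snd p" using that by (auto simp: prod_eq_iff)
    then show ?thesis using dx_fit[of "snd p"] ds_fit[of "snd p"] by metis
  qed
  have sub: "{p \<in> ?D. P p} \<subseteq> quadrant" for P by auto
  show "continuous_on ?D (\<lambda>p. if fst p - H (snd p) \<le> 0 then stop_dx p else wait_dx p)"
    by (intro continuous_on_cases_le c[OF C1_on_stop_dx sub] c[OF C1_on_wait_dx sub] gap fit[THEN conjunct1])
  show "continuous_on ?D (\<lambda>p. if fst p - H (snd p) \<le> 0 then stop_ds p else wait_ds p)"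
    by (intro continuous_on_cases_le c[OF C1_on_stop_ds sub] c[OF C1_on_wait_ds sub] gap fit[THEN conjunct2])
qed

end

section \<open>Sign of \<open>w\<close> and the variational inequality\<close>

lemma power_dominates_linear:
  fixes a \<epsilon> :: real
  assumes "1 < a" "0 < \<epsilon>"
  obtains R where "0 < R" "\<And>y. 0 < y \<Longrightarrow> y \<le> R + \<epsilon> * y powr a"
proof -
  \<comment> \<open>The point at which \<open>\<epsilon> * y powr a\<close> overtakes
    \<open>y\<close>.\<close>
  define R where "R = (1 / \<epsilon>) powr (1 / (a - 1))"
  have R: "0 < R" using assms by (simp add: R_def)
  have "y \<le> R + \<epsilon> * y powr a" if "0 < y" for y
  proof (cases "y \<le> R")
    case True
    then show ?thesis using assms that by (smt (verit) mult_nonneg_nonneg powr_ge_zero)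
  next
    case False
    have "1 = \<epsilon> * R powr (a - 1)"
      using assms unfolding R_def by (simp add: powr_powr)
    also have "\<dots> \<le> \<epsilon> * y powr (a - 1)"
      using False assms R by (intro mult_left_mono powr_mono2) auto
    finally have "y * 1 \<le> y * (\<epsilon> * y powr (a - 1))"
      using that by (intro mult_left_mono) auto
    also have "\<dots> = \<epsilon> * y powr a"
      using that powr_add[of y 1 "a - 1"] by simp
    finally show ?thesis using R by simp
  qed
  then show ?thesis using R that by blast
qed

context free_boundary
begin

text \<open>Along \<open>x = s / 2\<close> the term \<open>A s * x powr n\<close> tends to minus
  infinity while \<open>B s * x powr m\<close> stays bounded. The midpoint satisfies the strict
  inequality \<open>x < s\<close> that (VI) demands, and the level \<open>- 1\<close> lies below
  every value of the payoff \<open>F s / x - 1\<close>.\<close>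

lemma exists_w_less_minus_1:
  assumes "A_inf < 0"
  obtains s where "0 < s" "H s < s / 2" "w_fun m n H (s / 2) s < - 1"
proof -
  define K where "K = (n + 1) / (n - m) * H_inf powr (- m - 1)"
  have half: "filterlim (\<lambda>s::real. s / 2) at_top at_top"
    using filterlim_tendsto_pos_mult_at_top[OF tendsto_const[of "1/2::real"] _ filterlim_ident] by simp
  have "filterlim (\<lambda>s. A m n H s * (s / 2) powr n) at_bot at_top"
    by (rule filterlim_tendsto_neg_mult_at_bot[OF A_tendsto assms filterlim_compose[OF _ half]])
       (use n in real_asymp)
  then have "\<forall>\<^sub>F s in at_top. A m n H s * (s / 2) powr n < - 1 - K"
    by (simp add: filterlim_at_bot_dense)
  \<comment> \<open>This ensures both \<open>1 \<le> s / 2\<close>, so that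
    \<open>(s / 2) powr m \<le> 1\<close>, and \<open>H s \<le> H_inf < s / 2\<close>.\<close>
  moreover have "\<forall>\<^sub>F s in at_top. 2 + 2 * H_inf < s"
    by (rule eventually_gt_at_top)
  ultimately have "\<forall>\<^sub>F s in at_top. A m n H s * (s / 2) powr n < - 1 - K \<and> 2 + 2 * H_inf < s"
    by (rule eventually_conj)
  then obtain s where s: "A m n H s * (s / 2) powr n < - 1 - K" "2 + 2 * H_inf < s"
    using eventually_happens'[OF trivial_limit_at_top_linorder] by blast
  then have s0: "0 < s" "1 \<le> s / 2" "H s < s / 2" using H_inf H_le_H_inf[of s] by auto
  have "B m n H s * (s / 2) powr m \<le> K * 1"
    unfolding K_def
    using B_le[OF s0(1)] B_pos[OF s0(1)] powr_mono2'[of m 1 "s / 2"] s0 m n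
    by (intro mult_mono) auto
  then have "w_fun m n H (s / 2) s < - 1"
    using s s0 by (simp add: w_fun_def)
  then show ?thesis using s0 that by blast
qed

text \<open>\<open>A\<close> stays strictly above its limit, so it is positive even in the critical
  case \<open>A_inf = 0\<close>. In the stopping region positivity is
  \<open>x \<le> H s < F s\<close>.\<close>

lemma w_pos:
  assumes "0 \<le> A_inf" "0 < x" "x \<le> s"
  shows "0 < w_fun m n H x s"
proof (cases "x \<le> H s")
  case True
  then have "x < F s" using H_less_F[of s] assms by auto
  then show ?thesis using True assms by (simp add: w_fun_def)
next
  case False
  have "0 < A m n H s" "0 < B m n H s" using A_gt_A_inf[of s] B_pos[of s] assms by auto
  then show ?thesis using False assms by (simp add: w_fun_def add_pos_pos)
qed

lemma wait_value_ge_stop_value: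
  assumes "0 \<le> A_inf" "0 < s" "H s < x"
  shows "stop_value (x, s) \<le> wait_value (x, s)"
proof -
  define a b where "a = A m n H s" and "b = B m n H s"
  have ab: "0 < a" "0 < b" using A_gt_A_inf[of s] B_pos[of s] assms by (auto simp: a_def b_def)
  have h: "0 < H s" using H_bounds assms by auto
  define g where "g y = a * y powr (n + 1) + b * y powr (m + 1) + y - F s" for y
  define g' where "g' y = a * ((n + 1) * y powr n) + b * ((m + 1) * y powr m) + 1" for y
  have g_eq: "g y = y * (wait_value (y, s) - stop_value (y, s))" if "0 < y" for y
    using that by (simp add: g_def wait_value_def stop_value_def a_def b_def powr_add algebra_simps)
  have "\<exists>z. (g has_real_derivative z) (at y) \<and> 0 \<le> z" if y: "H s \<le> y" "y \<le> x" for y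
  proof -
    have "(g has_real_derivative g' y) (at y)"
      unfolding g_def[abs_def] g'_def using y h by (auto intro!: derivative_eq_intros)
    moreover have "0 \<le> g' y"
    proof -
      have "(n + 1) * (a * H s powr n) + (m + 1) * (b * H s powr m) + 1
          = ((n + 1) * (m * H s - (m + 1) * F s) + (m + 1) * ((n + 1) * F s - n * H s)) / ((n - m) * H s) + 1"
        unfolding a_def b_def A_powr[OF assms(2)] B_powr[OF assms(2)] times_divide_eq_right add_divide_distrib ..
      also have "(n + 1) * (m * H s - (m + 1) * F s) + (m + 1) * ((n + 1) * F s - n * H s) = - ((n - m) * H s)"
        by (simp add: algebra_simps)
      also have "- ((n - m) * H s) / ((n - m) * H s) + 1 = 0"
        using h m n by simp
      finally have "0 = g' (H s)" by (simp add: g'_def algebra_simps)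
      also have "\<dots> \<le> g' y"
      \<comment> \<open>Both powers contribute nondecreasing terms: \<open>a\<close> and
        \<open>b\<close> are positive, \<open>y powr n\<close> increases, and the negative factor
        \<open>m + 1\<close> reverses the decrease of \<open>y powr m\<close>.\<close>
      proof -
        have "H s powr n \<le> y powr n" using y h n by (intro powr_mono2) auto
        then have "a * ((n + 1) * H s powr n) \<le> a * ((n + 1) * y powr n)"
          using ab n by (intro mult_left_mono) auto
        moreover have "y powr m \<le> H s powr m" using y h m by (intro powr_mono2') auto
        then have "b * ((m + 1) * H s powr m) \<le> b * ((m + 1) * y powr m)"
          using ab m by (intro mult_left_mono mult_left_mono_neg) auto
        ultimately show ?thesis unfolding g'_def by linarith
      qed
      finally show ?thesis .
    qed
    ultimately show ?thesis by blast
  qed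
  then have "g (H s) \<le> g x"
    using DERIV_nonneg_imp_nondecreasing[of "H s" x g] assms by simp
  moreover have "g (H s) = 0" using g_eq[OF h] value_fit[OF assms(2)] by simp
  ultimately have "0 \<le> x * (wait_value (x, s) - stop_value (x, s))"
    using g_eq[of x] h assms by simp
  then show ?thesis using h assms by (simp add: zero_le_mult_iff)
qed

text \<open>\<open>generator\<close> is built from \<open>deriv\<close>, so a branch may replace the
  piecewise function only where they agree on a neighbourhood; the first derivative is also needed
  on a neighbourhood because it is differentiated again.\<close>

lemma generator_eq:
  assumes "open U" "x \<in> U" "\<And>y. y \<in> U \<Longrightarrow> v y s = f y"
    and "\<And>y. y \<in> U \<Longrightarrow> (f has_real_derivative f' y) (at y)"
    and "(f' has_real_derivative f'') (at x)"
  shows "generator r \<mu> \<sigma> v x s = 1/2 * \<sigma>\<^sup>2 * x\<^sup>2 * f'' + \<mu> * x * f' x - r * f x"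
proof -
  have U: "eventually (\<lambda>y. y \<in> U) (nhds x)" using assms eventually_nhds_in_open by blast
  have d: "deriv (\<lambda>y. v y s) y = f' y" if "y \<in> U" for y
  proof -
    have "eventually (\<lambda>y. v y s = f y) (nhds y)"
      using eventually_nhds_in_open[OF assms(1) that] assms(3) by (auto elim: eventually_mono)
    then have "deriv (\<lambda>y. v y s) y = deriv f y" by (intro deriv_cong_ev) auto
    then show ?thesis using assms(4)[OF that] DERIV_imp_deriv by metis
  qed
  have "deriv (deriv (\<lambda>y. v y s)) x = deriv f' x"
    using U d by (intro deriv_cong_ev) (auto elim: eventually_mono)
  then have "deriv (deriv (\<lambda>y. v y s)) x = f''" using assms(5) DERIV_imp_deriv by metis
  then show ?thesis unfolding generator_def using d[OF assms(2)] assms(3)[OF assms(2)] by simp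
qed

text \<open>In the stopping region the generator of \<open>w\<close> equals
  \<open>r - r * G m n s / x\<close>, which is nonpositive for \<open>x \<le> G m n s\<close>. In
  the waiting region the powers \<open>x powr n\<close> and \<open>x powr m\<close> are annihilated
  by the generator because \<open>n\<close> and \<open>m\<close> are the roots of its characteristic
  equation.\<close>

lemma variational_inequality_w:
  assumes "0 \<le> A_inf" "0 < r" "\<sigma> \<noteq> 0"
    and m_root: "1/2 * \<sigma>\<^sup>2 * m\<^sup>2 + (\<mu> - 1/2 * \<sigma>\<^sup>2) * m - r = 0"
    and n_root: "1/2 * \<sigma>\<^sup>2 * n\<^sup>2 + (\<mu> - 1/2 * \<sigma>\<^sup>2) * n - r = 0"
  shows "variational_inequality r \<mu> \<sigma> H (w_fun m n H)"
  unfolding variational_inequality_def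
proof (intro allI impI)
  fix x s :: real
  assume "0 < x \<and> x < s \<and> x \<noteq> H s"
  then have x: "0 < x" "x < s" "x \<noteq> H s" "0 < s" by auto
  show "max (generator r \<mu> \<sigma> (w_fun m n H) x s) (F s / x - 1 - w_fun m n H x s) = 0"
  proof (cases "x < H s")
    case True
    have "generator r \<mu> \<sigma> (w_fun m n H) x s
       = 1/2 * \<sigma>\<^sup>2 * x\<^sup>2 * (2 * F s / x ^ 3) + \<mu> * x * (- F s / x\<^sup>2) - r * (F s / x - 1)"
      by (rule generator_eq[where U = "{0<..<H s}" and f' = "\<lambda>y. - F s / y\<^sup>2"])
         (use True x in \<open>auto simp: w_fun_def power2_eq_square power3_eq_cube field_simps
            intro!: derivative_eq_intros\<close>)
    also have "\<dots> = (\<sigma>\<^sup>2 - \<mu> - r) * F s / x + r"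
      using x by (simp add: power2_eq_square power3_eq_cube field_simps)
    also have "\<dots> \<le> 0"
    proof -
      \<comment> \<open>Vieta's formulas for the sum and the product of the roots. They turn the
        definition of \<open>G_lim\<close> into
        \<open>r * G_lim m n = r + \<mu> - \<sigma>\<^sup>2\<close>.\<close>
      have "(m - n) * (1/2 * \<sigma>\<^sup>2 * (m + n) + \<mu> - 1/2 * \<sigma>\<^sup>2)
          = (1/2 * \<sigma>\<^sup>2 * m\<^sup>2 + (\<mu> - 1/2 * \<sigma>\<^sup>2) * m - r) - (1/2 * \<sigma>\<^sup>2 * n\<^sup>2 + (\<mu> - 1/2 * \<sigma>\<^sup>2) * n - r)"
        by (simp add: field_simps power2_eq_square)
      then have "(m - n) * (1/2 * \<sigma>\<^sup>2 * (m + n) + \<mu> - 1/2 * \<sigma>\<^sup>2) = 0"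
        unfolding m_root n_root by simp
      then have sum: "1/2 * \<sigma>\<^sup>2 * (m + n) = 1/2 * \<sigma>\<^sup>2 - \<mu>" using m n by simp
      have "1/2 * \<sigma>\<^sup>2 * (m * n) = m * (1/2 * \<sigma>\<^sup>2 * (m + n)) - 1/2 * \<sigma>\<^sup>2 * m\<^sup>2"
        by (simp add: algebra_simps power2_eq_square)
      also have "\<dots> = - r" unfolding sum using m_root by (simp add: algebra_simps)
      finally have prod: "1/2 * \<sigma>\<^sup>2 * (m * n) = - r" .
      have "G_lim m n * (m * n) = m * n + (m + n) + 1"
        unfolding G_lim_def using m n by (simp add: field_simps)
      then have "G_lim m n * (1/2 * \<sigma>\<^sup>2 * (m * n)) = 1/2 * \<sigma>\<^sup>2 * (m * n) + 1/2 * \<sigma>\<^sup>2 * (m + n) + 1/2 * \<sigma>\<^sup>2"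
        by (metis (no_types, lifting) distrib_left mult.left_commute mult.right_neutral)
      then have "r * G_lim m n = r + \<mu> - \<sigma>\<^sup>2"
        unfolding prod sum by (simp add: mult.commute)
      then have "\<sigma>\<^sup>2 - \<mu> - r = - (r * G_lim m n)" by simp
      then have "(\<sigma>\<^sup>2 - \<mu> - r) * F s = - (r * G m n s)" unfolding G_def by simp
      moreover have "x \<le> G m n s" using True H_bounds[OF x(4)] by linarith
      then have "r * x \<le> r * G m n s" using assms by simp
      ultimately show ?thesis using x by (simp add: field_simps)
    qed
    finally show ?thesis using True by (simp add: w_fun_def)
  next
    case False
    then have xh: "H s < x" using x by simp
    have h: "0 < H s" using H_bounds x by auto
    let ?f' = "\<lambda>y. A m n H s * (n * y powr (n - 1)) + B m n H s * (m * y powr (m - 1))"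
    have "generator r \<mu> \<sigma> (w_fun m n H) x s
       = 1/2 * \<sigma>\<^sup>2 * x\<^sup>2 * (A m n H s * (n * ((n - 1) * x powr (n - 1 - 1))) + B m n H s * (m * ((m - 1) * x powr (m - 1 - 1))))
         + \<mu> * x * ?f' x - r * (A m n H s * x powr n + B m n H s * x powr m)"
    proof (rule generator_eq[where U = "{H s<..}" and f' = ?f'])
      show "((\<lambda>x. A m n H s * x powr n + B m n H s * x powr m) has_real_derivative ?f' y) (at y)"
        if "y \<in> {H s<..}" for y
        using that h by (auto intro!: derivative_eq_intros)
      show "(?f' has_real_derivative A m n H s * (n * ((n - 1) * x powr (n - 1 - 1))) + B m n H s * (m * ((m - 1) * x powr (m - 1 - 1)))) (at x)"
        using x by (auto intro!: derivative_eq_intros)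
    qed (use xh in \<open>auto simp: w_fun_def\<close>)
    also have "\<dots> = A m n H s * (x powr n * (1/2 * \<sigma>\<^sup>2 * n\<^sup>2 + (\<mu> - 1/2 * \<sigma>\<^sup>2) * n - r))
       + B m n H s * (x powr m * (1/2 * \<sigma>\<^sup>2 * m\<^sup>2 + (\<mu> - 1/2 * \<sigma>\<^sup>2) * m - r))"
    proof -
      have "x\<^sup>2 * x powr (k - 1 - 1) = x powr k" "x * x powr (k - 1) = x powr k" for k
        using x by (simp_all add: powr_diff power2_eq_square)
      note p = this[symmetric]
      have "1/2 * \<sigma>\<^sup>2 * x\<^sup>2 * (c * (k * ((k - 1) * x powr (k - 1 - 1)))) + \<mu> * x * (c * (k * x powr (k - 1))) - r * (c * x powr k)
        = c * (x powr k * (1/2 * \<sigma>\<^sup>2 * k\<^sup>2 + (\<mu> - 1/2 * \<sigma>\<^sup>2) * k - r))" for c k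
      proof -
        have "1/2 * \<sigma>\<^sup>2 * x\<^sup>2 * (c * (k * ((k - 1) * x powr (k - 1 - 1)))) + \<mu> * x * (c * (k * x powr (k - 1))) - r * (c * x powr k)
          = 1/2 * \<sigma>\<^sup>2 * (c * (k * (k - 1))) * (x\<^sup>2 * x powr (k - 1 - 1)) + \<mu> * c * k * (x * x powr (k - 1)) - r * (c * x powr k)"
          by (simp add: mult_ac)
        also have "\<dots> = 1/2 * \<sigma>\<^sup>2 * (c * (k * (k - 1))) * x powr k + \<mu> * c * k * x powr k - r * (c * x powr k)"
          unfolding p[symmetric] ..
        also have "\<dots> = c * (x powr k * (1/2 * \<sigma>\<^sup>2 * k\<^sup>2 + (\<mu> - 1/2 * \<sigma>\<^sup>2) * k - r))"
          by (simp add: algebra_simps power2_eq_square)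
        finally show ?thesis .
      qed
      from this[of "A m n H s" n] this[of "B m n H s" m] show ?thesis by (simp only: distrib_left)
    qed
    also have "\<dots> = 0" unfolding m_root n_root by simp
    finally have "generator r \<mu> \<sigma> (w_fun m n H) x s = 0" .
    moreover have "F s / x - 1 - w_fun m n H x s \<le> 0"
      using wait_value_ge_stop_value[OF assms(1) x(4) xh] xh by (simp add: w_fun_eq stop_value_def)
    ultimately show ?thesis by simp
  qed
qed

text \<open>The derivative is one-sided because \<open>w s u\<close> has a meaning only for
  \<open>s \<le> u\<close>. By continuity \<open>H u < s\<close> for \<open>u\<close> near
  \<open>s\<close>, so the waiting formula holds on a full neighbourhood and
  \<open>wait_ds_diagonal\<close> applies.\<close>

lemma w_diagonal_derivative:
  assumes "0 < s"
  shows "((\<lambda>u. w_fun m n H s u) has_real_derivative 0) (at s within {s..})"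
proof -
  have "eventually (\<lambda>u. H u < s) (nhds s)"
    using DERIV_isCont[OF ode[OF assms]] H_less_self[OF assms]
    unfolding isCont_def tendsto_at_iff_tendsto_nhds by (rule order_tendstoD)
  then have ev: "eventually (\<lambda>u. w_fun m n H s u = A m n H u * s powr n + B m n H u * s powr m) (nhds s)"
    by (rule eventually_mono) (simp add: w_fun_def)
  have "((\<lambda>u. A m n H u * s powr n + B m n H u * s powr m) has_real_derivative dA s * s powr n + dB s * s powr m) (at s)"
    by (intro DERIV_add DERIV_cmult_right A_has_real_derivative B_has_real_derivative assms)
  moreover have "dA s * s powr n + dB s * s powr m = 0"
    using wait_ds_diagonal[OF assms] by (simp add: wait_ds_def)
  ultimately have "((\<lambda>u. w_fun m n H s u) has_real_derivative 0) (at s)"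
    using DERIV_cong_ev[OF refl ev refl] by simp
  then show ?thesis by (rule has_field_derivative_at_within)
qed

section \<open>Growth of \<open>w\<close> relative to \<open>A_inf * x powr n\<close>\<close>

lemma w_growth:
  assumes "0 < s0" "0 < \<epsilon>"
  obtains C where "0 \<le> C"
    "\<And>x s. 0 < x \<Longrightarrow> x \<le> s \<Longrightarrow> s0 \<le> s \<Longrightarrow>
       \<bar>w_fun m n H x s - A_inf * x powr n\<bar> \<le> C + \<epsilon> * x powr n + \<epsilon> * x powr m"
proof -
  \<comment> \<open>Used at \<open>y = 1 / x\<close>, where \<open>y powr (- m)\<close> is
    \<open>x powr m\<close>; the exponent \<open>- m\<close> exceeds 1.\<close>
  obtain R where R: "0 < R" "\<And>y. 0 < y \<Longrightarrow> y \<le> R + \<epsilon> * y powr (- m)"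
    using power_dominates_linear[of "- m" \<epsilon>] m assms by auto
  define K where "K = (n + 1) / (n - m) * H_inf powr (- m - 1)"
  have K: "0 \<le> K" using m n by (simp add: K_def)
  have "eventually (\<lambda>s. A m n H s < A_inf + \<epsilon>) at_top"
    using order_tendstoD(2)[OF A_tendsto] assms by simp
  then obtain S0 where S0: "\<And>s. S0 \<le> s \<Longrightarrow> A m n H s < A_inf + \<epsilon>"
    by (auto simp: eventually_at_top_linorder)
  define S1 where "S1 = max S0 1"
  \<comment> \<open>\<open>C1\<close> serves the stopping region, where
    \<open>x \<le> H_inf\<close>. \<open>C2\<close> serves the waiting region: there
    \<open>x\<close> exceeds \<open>H s0\<close>, which bounds \<open>x powr m\<close>, and the
    second summand covers \<open>s < S1\<close>, where
    \<open>x powr n \<le> S1 powr n\<close>.\<close>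
  define C1 where "C1 = R + 1 + \<bar>A_inf\<bar> * H_inf powr n"
  define C2 where "C2 = K * H s0 powr m + (A m n H s0 - A_inf) * S1 powr n"
  have C1: "0 \<le> C1" using R by (simp add: C1_def)
  have C2: "0 \<le> C2" using K A_gt_A_inf[OF assms(1)] by (simp add: C2_def)
  have "\<bar>w_fun m n H x s - A_inf * x powr n\<bar> \<le> C1 + C2 + \<epsilon> * x powr n + \<epsilon> * x powr m"
    if x: "0 < x" "x \<le> s" "s0 \<le> s" for x s
  proof (cases "x \<le> H s")
    case True
    have s: "0 < s" using x by simp
    have "\<bar>F s / x - 1\<bar> \<le> 1 / x + 1"
    proof -
      have "0 \<le> F s / x" "F s / x \<le> 1 / x"
        using F_pos[OF s] F_less_1[of s] x by (auto intro!: divide_right_mono)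
      then show ?thesis by linarith
    qed
    also have "1 / x \<le> R + \<epsilon> * (1 / x) powr (- m)" using R(2)[of "1 / x"] x by simp
    also have "(1 / x) powr (- m) = x powr m" using x by (simp add: powr_minus_divide powr_divide)
    finally have "\<bar>F s / x - 1\<bar> \<le> R + 1 + \<epsilon> * x powr m" by simp
    moreover have "\<bar>A_inf * x powr n\<bar> \<le> \<bar>A_inf\<bar> * H_inf powr n"
      using True x H_le_H_inf[OF s] n by (auto simp: abs_mult intro!: mult_left_mono powr_mono2)
    moreover have "0 \<le> \<epsilon> * x powr n" using assms by simp
    ultimately show ?thesis using True C2 unfolding C1_def w_fun_def by (simp add: abs_le_iff)
  next
    case False
    have s: "0 < s" using x by simp
    have h: "0 < H s0" "H s0 \<le> x" using H_bounds[OF assms(1)] H_mono[OF assms(1) x(3)] False by auto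
    have "\<bar>B m n H s * x powr m\<bar> \<le> K * H s0 powr m"
      using B_le[OF s, folded K_def] B_pos[OF s] K h m
      by (simp add: abs_mult) (intro mult_mono powr_mono2', auto)
    moreover have "\<bar>(A m n H s - A_inf) * x powr n\<bar> \<le> (A m n H s0 - A_inf) * S1 powr n + \<epsilon> * x powr n"
    proof (cases "S1 \<le> s")
      case True
      then have "A m n H s - A_inf \<le> \<epsilon>" using S0[of s] by (simp add: S1_def)
      then have "\<bar>(A m n H s - A_inf) * x powr n\<bar> \<le> \<epsilon> * x powr n"
        using A_gt_A_inf[OF s] by (simp add: abs_mult mult_right_mono)
      moreover have "0 \<le> (A m n H s0 - A_inf) * S1 powr n" using A_gt_A_inf[OF assms(1)] by simp
      ultimately show ?thesis by linarith
    next
      case False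
      have "A m n H s \<le> A m n H s0" using A_strict_antimono[OF assms(1), of s] x by (cases "s = s0") auto
      then have "\<bar>(A m n H s - A_inf) * x powr n\<bar> \<le> (A m n H s0 - A_inf) * S1 powr n"
        using A_gt_A_inf[OF s] x False n by (simp add: abs_mult) (intro mult_mono powr_mono2, auto)
      moreover have "0 \<le> \<epsilon> * x powr n" using assms by simp
      ultimately show ?thesis by linarith
    qed
    moreover have "w_fun m n H x s - A_inf * x powr n = (A m n H s - A_inf) * x powr n + B m n H s * x powr m"
      using False by (simp add: w_fun_def algebra_simps)
    moreover have "0 \<le> \<epsilon> * x powr m" using assms by simp
    ultimately show ?thesis using C1 unfolding C2_def by linarith
  qed
  then show ?thesis using that[of "C1 + C2"] C1 C2 by simp
qed

end

section \<open>Brownian increments\<close>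

text \<open>Completing the square: an exponential factor only shifts the mean of a normal density,
  up to a constant. Integrals of polynomials times exponentials thus reduce to moments of a shifted
  normal law.\<close>

lemma normal_density_exp_tilt:
  assumes "0 < s"
  shows "normal_density 0 s z * exp (\<theta> * z) = exp (\<theta>\<^sup>2 * s\<^sup>2 / 2) * normal_density (\<theta> * s\<^sup>2) s z"
proof -
  have "- z\<^sup>2 / (2 * s\<^sup>2) + \<theta> * z = \<theta>\<^sup>2 * s\<^sup>2 / 2 - (z - \<theta> * s\<^sup>2)\<^sup>2 / (2 * s\<^sup>2)"
    using assms by (simp add: field_simps power2_eq_square)
  then have "exp (- z\<^sup>2 / (2 * s\<^sup>2)) * exp (\<theta> * z) = exp (\<theta>\<^sup>2 * s\<^sup>2 / 2) * exp (- (z - \<theta> * s\<^sup>2)\<^sup>2 / (2 * s\<^sup>2))"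
    by (simp add: exp_add[symmetric])
  then show ?thesis by (simp add: normal_density_def)
qed

lemma has_bochner_integral_normal_quadratic:
  assumes "0 < s"
  shows "has_bochner_integral lborel (\<lambda>z. normal_density \<nu> s z * (c0 + c1 * z + c2 * z\<^sup>2))
    (c0 + c1 * \<nu> + c2 * (\<nu>\<^sup>2 + s\<^sup>2))"
proof -
  have 0: "has_bochner_integral lborel (\<lambda>z. normal_density \<nu> s z) 1"
    using normal_moment_even[OF assms, of \<nu> 0] by simp
  have 1: "has_bochner_integral lborel (\<lambda>z. normal_density \<nu> s z * (z - \<nu>)) 0"
    using normal_moment_odd[OF assms, of \<nu> 0] by simp
  have 2: "has_bochner_integral lborel (\<lambda>z. normal_density \<nu> s z * (z - \<nu>)\<^sup>2) (s\<^sup>2)"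
    using normal_moment_even[OF assms, of \<nu> 1] assms by (simp add: fact_2)
  have "has_bochner_integral lborel
     (\<lambda>z. (c0 + c1 * \<nu> + c2 * \<nu>\<^sup>2) * normal_density \<nu> s z
        + (c1 + 2 * c2 * \<nu>) * (normal_density \<nu> s z * (z - \<nu>)) + c2 * (normal_density \<nu> s z * (z - \<nu>)\<^sup>2))
     ((c0 + c1 * \<nu> + c2 * \<nu>\<^sup>2) * 1 + (c1 + 2 * c2 * \<nu>) * 0 + c2 * s\<^sup>2)"
    by (intro has_bochner_integral_add has_bochner_integral_mult_right 0 1 2)
  moreover have "(\<lambda>z. (c0 + c1 * \<nu> + c2 * \<nu>\<^sup>2) * normal_density \<nu> s z
        + (c1 + 2 * c2 * \<nu>) * (normal_density \<nu> s z * (z - \<nu>)) + c2 * (normal_density \<nu> s z * (z - \<nu>)\<^sup>2))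
      = (\<lambda>z. normal_density \<nu> s z * (c0 + c1 * z + c2 * z\<^sup>2))"
    by (simp add: fun_eq_iff algebra_simps power2_eq_square)
  ultimately show ?thesis by (simp add: algebra_simps)
qed

lemma integrable_product_of_squares:
  fixes f g :: "'a \<Rightarrow> real"
  assumes [measurable]: "f \<in> borel_measurable M" "g \<in> borel_measurable M"
    and "integrable M (\<lambda>\<omega>. (f \<omega>)\<^sup>2)" "integrable M (\<lambda>\<omega>. (g \<omega>)\<^sup>2)"
  shows "integrable M (\<lambda>\<omega>. f \<omega> * g \<omega>)"
proof (rule Bochner_Integration.integrable_bound)
  show "integrable M (\<lambda>\<omega>. (f \<omega>)\<^sup>2 + (g \<omega>)\<^sup>2)" using assms by simp
  have "\<bar>a * b\<bar> \<le> a\<^sup>2 + b\<^sup>2" for a b :: real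
  proof -
    have "2 * (\<bar>a\<bar> * \<bar>b\<bar>) \<le> a\<^sup>2 + b\<^sup>2" using sum_squares_bound[of "\<bar>a\<bar>" "\<bar>b\<bar>"] by (simp add: mult.assoc)
    moreover have "0 \<le> \<bar>a\<bar> * \<bar>b\<bar>" by simp
    ultimately show ?thesis unfolding abs_mult by linarith
  qed
  then show "AE \<omega> in M. norm (f \<omega> * g \<omega>) \<le> norm ((f \<omega>)\<^sup>2 + (g \<omega>)\<^sup>2)" by simp
qed simp

lemma integrable_sum_squared:
  fixes f g :: "'a \<Rightarrow> real"
  assumes [measurable]: "f \<in> borel_measurable M" "g \<in> borel_measurable M"
    and "integrable M (\<lambda>\<omega>. (f \<omega>)\<^sup>2)" "integrable M (\<lambda>\<omega>. (g \<omega>)\<^sup>2)"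
  shows "integrable M (\<lambda>\<omega>. (f \<omega> + g \<omega>)\<^sup>2)"
  using integrable_product_of_squares[OF assms] assms(3,4) by (simp add: power2_sum mult.assoc)

lemma sum_squared_le: "(a + b)\<^sup>2 \<le> 2 * a\<^sup>2 + 2 * (b::real)\<^sup>2"
  using sum_squares_bound[of a b] by (simp add: power2_sum)

text \<open>Cauchy-Schwarz, without any orthogonality and hence of order \<open>n\<close> squared.
  It is used for the mean parts of the increments only, which are small enough for this.\<close>

lemma integral_square_sum_le:
  fixes a :: "nat \<Rightarrow> 'a \<Rightarrow> real"
  assumes [measurable]: "\<And>i. i < n \<Longrightarrow> a i \<in> borel_measurable M"
    and "\<And>i. i < n \<Longrightarrow> integrable M (\<lambda>\<omega>. (a i \<omega>)\<^sup>2)" and "\<And>i. i < n \<Longrightarrow> (\<integral>\<omega>. (a i \<omega>)\<^sup>2 \<partial>M) \<le> \<alpha>"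
  shows "integrable M (\<lambda>\<omega>. (\<Sum>i<n. a i \<omega>)\<^sup>2) \<and> (\<integral>\<omega>. (\<Sum>i<n. a i \<omega>)\<^sup>2 \<partial>M) \<le> (real n)\<^sup>2 * \<alpha>"
proof -
  have le: "(\<Sum>i<n. a i \<omega>)\<^sup>2 \<le> real n * (\<Sum>i<n. (a i \<omega>)\<^sup>2)" for \<omega>
    using Cauchy_Schwarz_ineq_sum[of "\<lambda>_. 1" "\<lambda>i. a i \<omega>" "{..<n}"] by simp
  have I: "integrable M (\<lambda>\<omega>. real n * (\<Sum>i<n. (a i \<omega>)\<^sup>2))"
    using assms by (intro integrable_mult_right Bochner_Integration.integrable_sum) auto
  have J: "integrable M (\<lambda>\<omega>. (\<Sum>i<n. a i \<omega>)\<^sup>2)"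
    by (rule Bochner_Integration.integrable_bound[OF I]) (use le in \<open>auto intro!: AE_I2 order_trans[OF le]\<close>)
  have "(\<integral>\<omega>. (\<Sum>i<n. a i \<omega>)\<^sup>2 \<partial>M) \<le> (\<integral>\<omega>. real n * (\<Sum>i<n. (a i \<omega>)\<^sup>2) \<partial>M)"
    by (intro integral_mono I J le)
  also have "\<dots> = real n * (\<Sum>i<n. \<integral>\<omega>. (a i \<omega>)\<^sup>2 \<partial>M)" using assms by simp
  also have "\<dots> \<le> real n * (\<Sum>i<n. \<alpha>)" by (intro mult_left_mono sum_mono assms) auto
  finally show ?thesis using J by (simp add: power2_eq_square)
qed

locale filtered_brownian_motion = prob_space M
  for M :: "'a measure" +
  fixes Filt :: "real \<Rightarrow> 'a measure" and W :: "real \<Rightarrow> 'a \<Rightarrow> real"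
  assumes usual: "usual_conditions M Filt" and bm: "brownian_motion M Filt W"
begin

lemma complete: "complete_measure M"
  using usual by (simp add: usual_conditions_def)

lemma subalgebra_Filt: "0 \<le> t \<Longrightarrow> subalgebra M (Filt t)"
  using usual by (simp add: usual_conditions_def)

lemma space_Filt: "space (Filt t) = space M"
  using usual by (simp add: usual_conditions_def filtration_def)

lemma Filt_mono: "s \<le> t \<Longrightarrow> sets (Filt s) \<subseteq> sets (Filt t)"
  using usual by (simp add: usual_conditions_def filtration_def)

lemma measurable_Filt_mono: "f \<in> borel_measurable (Filt s) \<Longrightarrow> s \<le> t \<Longrightarrow> f \<in> borel_measurable (Filt t)"
  using measurable_mono[of borel borel "Filt s" "Filt t"] Filt_mono[of s t] by (auto simp: space_Filt)

lemma measurable_Filt_M: "f \<in> borel_measurable (Filt t) \<Longrightarrow> 0 \<le> t \<Longrightarrow> f \<in> borel_measurable M"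
  using measurable_from_subalg subalgebra_Filt by blast

lemma W_measurable_Filt: "0 \<le> t \<Longrightarrow> W t \<in> borel_measurable (Filt t)"
  using bm by (simp add: brownian_motion_def adapted_continuous_def)

lemma W_measurable: "0 \<le> t \<Longrightarrow> W t \<in> borel_measurable M"
  using W_measurable_Filt measurable_Filt_M by blast

lemma W_continuous: "AE \<omega> in M. continuous_on {0..} (\<lambda>t. W t \<omega>)"
  using bm by (simp add: brownian_motion_def adapted_continuous_def)

lemma W_0: "AE \<omega> in M. W 0 \<omega> = 0"
  using bm by (simp add: brownian_motion_def)

lemma increment_distributed:
  "0 \<le> u \<Longrightarrow> u < t \<Longrightarrow> distributed M lborel (\<lambda>\<omega>. W t \<omega> - W u \<omega>) (normal_density 0 (sqrt (t - u)))"
  using bm by (simp add: brownian_motion_def)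

text \<open>\<open>brownian_motion\<close> speaks of independent sigma-algebras. The one generated
  by \<open>f\<close> is contained in that of \<open>Filt u\<close>, so independence passes to the
  variables, and \<open>g\<close> is composed at the end.\<close>

lemma increment_indep_var:
  fixes f :: "'a \<Rightarrow> real" and g :: "real \<Rightarrow> real"
  assumes "0 \<le> u" "u < t" "f \<in> borel_measurable (Filt u)" "g \<in> borel_measurable borel"
  shows "indep_var borel f borel (\<lambda>\<omega>. g (W t \<omega> - W u \<omega>))"
proof -
  let ?d = "\<lambda>\<omega>. W t \<omega> - W u \<omega>"
  have ind: "indep_set (sets (Filt u)) (sets (vimage_algebra (space M) ?d borel))"
    using bm assms by (simp add: brownian_motion_def)
  have f: "f \<in> borel_measurable M" using assms measurable_Filt_M by blast
  have d: "?d \<in> borel_measurable M"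
    using W_measurable[of t] W_measurable[of u] assms by simp
  have "indep_var borel f borel ?d"
    unfolding indep_var_eq
  proof (intro conjI f d)
    have s1: "sigma_sets (space M) {f -` C \<inter> space M |C. C \<in> sets borel} \<subseteq> sets (Filt u)"
    proof -
      have "{f -` C \<inter> space M |C. C \<in> sets borel} \<subseteq> sets (Filt u)"
        using measurable_sets[OF assms(3)] by (auto simp: space_Filt)
      then show ?thesis using sets.sigma_sets_subset[of _ "Filt u"] by (simp add: space_Filt)
    qed
    have s2: "sigma_sets (space M) {?d -` C \<inter> space M |C. C \<in> sets borel} = sets (vimage_algebra (space M) ?d borel)"
      by (subst sets_vimage_algebra) (rule arg_cong[where f = "sigma_sets (space M)"], auto)
    show "indep_set (sigma_sets (space M) {f -` C \<inter> space M |C. C \<in> sets borel})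
       (sigma_sets (space M) {?d -` C \<inter> space M |C. C \<in> sets borel})"
    proof (rule indep_setI)
      show "sigma_sets (space M) {f -` C \<inter> space M |C. C \<in> sets borel} \<subseteq> events"
        using s1 indep_setD_ev1[OF ind] by blast
      show "sigma_sets (space M) {?d -` C \<inter> space M |C. C \<in> sets borel} \<subseteq> events"
        using s2 indep_setD_ev2[OF ind] by simp
      show "prob (a \<inter> b) = prob a * prob b"
        if "a \<in> sigma_sets (space M) {f -` C \<inter> space M |C. C \<in> sets borel}"
          "b \<in> sigma_sets (space M) {?d -` C \<inter> space M |C. C \<in> sets borel}" for a b
        using indep_setD[OF ind] that s1 s2 by blast
    qed
  qed
  from indep_var_compose[OF this measurable_ident assms(4)] show ?thesis by (simp add: comp_def)
qed

lemma
  fixes f :: "'a \<Rightarrow> real" and g :: "real \<Rightarrow> real"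
  assumes "0 \<le> u" "u < t" "f \<in> borel_measurable (Filt u)" "g \<in> borel_measurable borel"
    and "integrable M f" "integrable M (\<lambda>\<omega>. g (W t \<omega> - W u \<omega>))"
  shows integrable_mult_increment: "integrable M (\<lambda>\<omega>. f \<omega> * g (W t \<omega> - W u \<omega>))"
    and integral_mult_increment:
      "(\<integral>\<omega>. f \<omega> * g (W t \<omega> - W u \<omega>) \<partial>M) = (\<integral>\<omega>. f \<omega> \<partial>M) * (\<integral>\<omega>. g (W t \<omega> - W u \<omega>) \<partial>M)"
  using indep_var_integrable[OF increment_indep_var] indep_var_lebesgue_integral[OF increment_indep_var] assms
  by blast+

text \<open>A quadratic polynomial times an exponential covers every moment used later: the first
  two moments of the Euler step, of the ratio of successive values of \<open>Z\<close>, and of their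
  product. Under the tilt the increment has mean \<open>\<theta> * (t - u)\<close> and unchanged
  variance.\<close>

lemma increment_moment:
  assumes "0 \<le> u" "u < t"
  shows "has_bochner_integral M
     (\<lambda>\<omega>. (c0 + c1 * (W t \<omega> - W u \<omega>) + c2 * (W t \<omega> - W u \<omega>)\<^sup>2) * exp (\<theta> * (W t \<omega> - W u \<omega>)))
     (exp (\<theta>\<^sup>2 * (t - u) / 2) * (c0 + c1 * (\<theta> * (t - u)) + c2 * ((\<theta> * (t - u))\<^sup>2 + (t - u))))"
proof -
  define g where "g z = (c0 + c1 * z + c2 * z\<^sup>2) * exp (\<theta> * z)" for z
  define s where "s = sqrt (t - u)"
  have s: "0 < s" "s\<^sup>2 = t - u" using assms by (auto simp: s_def)
  have [measurable]: "g \<in> borel_measurable lborel" unfolding g_def by measurable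
  have "has_bochner_integral lborel (\<lambda>z. exp (\<theta>\<^sup>2 * s\<^sup>2 / 2) * (normal_density (\<theta> * s\<^sup>2) s z * (c0 + c1 * z + c2 * z\<^sup>2)))
      (exp (\<theta>\<^sup>2 * s\<^sup>2 / 2) * (c0 + c1 * (\<theta> * s\<^sup>2) + c2 * ((\<theta> * s\<^sup>2)\<^sup>2 + s\<^sup>2)))"
    by (intro has_bochner_integral_mult_right has_bochner_integral_normal_quadratic s)
  also have "(\<lambda>z. exp (\<theta>\<^sup>2 * s\<^sup>2 / 2) * (normal_density (\<theta> * s\<^sup>2) s z * (c0 + c1 * z + c2 * z\<^sup>2)))
     = (\<lambda>z. normal_density 0 s z * g z)"
    using normal_density_exp_tilt[OF s(1), of _ \<theta>] by (simp add: g_def fun_eq_iff mult_ac)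
  finally have I: "has_bochner_integral lborel (\<lambda>z. normal_density 0 s z * g z)
      (exp (\<theta>\<^sup>2 * (t - u) / 2) * (c0 + c1 * (\<theta> * (t - u)) + c2 * ((\<theta> * (t - u))\<^sup>2 + (t - u))))"
    unfolding s(2) .
  have D: "distributed M lborel (\<lambda>\<omega>. W t \<omega> - W u \<omega>) (normal_density 0 s)"
    unfolding s_def by (rule increment_distributed[OF assms])
  have "integrable M (\<lambda>\<omega>. g (W t \<omega> - W u \<omega>))"
    using distributed_integrable[OF D, of g] I by (auto simp: has_bochner_integral_iff)
  moreover have "(\<integral>\<omega>. g (W t \<omega> - W u \<omega>) \<partial>M) = (\<integral>z. normal_density 0 s z * g z \<partial>lborel)"
    using distributed_integral[OF D, of g] by simp
  ultimately show ?thesis using I unfolding has_bochner_integral_iff g_def by simp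
qed

text \<open>Stationarity of the increments: moments computed on \<open>[0, h]\<close> hold on every
  grid cell.\<close>

lemma increment_moments_eq:
  assumes "0 \<le> u" "u < t" "0 \<le> u'" "t' = u' + (t - u)" "g \<in> borel_measurable borel"
  shows "integrable M (\<lambda>\<omega>. g (W t' \<omega> - W u' \<omega>)) \<longleftrightarrow> integrable M (\<lambda>\<omega>. g (W t \<omega> - W u \<omega>))"
    and "(\<integral>\<omega>. g (W t' \<omega> - W u' \<omega>) \<partial>M) = (\<integral>\<omega>. (g (W t \<omega> - W u \<omega>) :: real) \<partial>M)"
proof -
  have g: "g \<in> borel_measurable lborel" using assms by simp
  have D: "distributed M lborel (\<lambda>\<omega>. W t \<omega> - W u \<omega>) (normal_density 0 (sqrt (t - u)))"
    by (rule increment_distributed) (use assms in auto)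
  have D': "distributed M lborel (\<lambda>\<omega>. W t' \<omega> - W u' \<omega>) (normal_density 0 (sqrt (t - u)))"
    using increment_distributed[of u' t'] assms by simp
  show "integrable M (\<lambda>\<omega>. g (W t' \<omega> - W u' \<omega>)) \<longleftrightarrow> integrable M (\<lambda>\<omega>. g (W t \<omega> - W u \<omega>))"
    using distributed_integrable[OF D g] distributed_integrable[OF D' g] by simp
  show "(\<integral>\<omega>. g (W t' \<omega> - W u' \<omega>) \<partial>M) = (\<integral>\<omega>. g (W t \<omega> - W u \<omega>) \<partial>M)"
    using distributed_integral[OF D g] distributed_integral[OF D' g] by simp
qed

text \<open>Splitting \<open>g\<close> into its mean and a centred part makes the centred sum orthogonal.\<close>

lemma weighted_increment_sum_L2:
  assumes "0 \<le> v" "0 < h" and [measurable]: "g \<in> borel_measurable borel"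
    and a: "\<And>i. i < n \<Longrightarrow> a i \<in> borel_measurable (Filt (v + real i * h))"
    and a2: "\<And>i. i < n \<Longrightarrow> integrable M (\<lambda>\<omega>. (a i \<omega>)\<^sup>2)"
    and a_le: "\<And>i. i < n \<Longrightarrow> (\<integral>\<omega>. (a i \<omega>)\<^sup>2 \<partial>M) \<le> \<alpha>" and "0 \<le> \<alpha>"
    and m1: "has_bochner_integral M (\<lambda>\<omega>. g (W h \<omega> - W 0 \<omega>)) m1"
    and m2: "has_bochner_integral M (\<lambda>\<omega>. (g (W h \<omega> - W 0 \<omega>))\<^sup>2) m2"
  defines "d \<equiv> \<lambda>i \<omega>. W (v + real (Suc i) * h) \<omega> - W (v + real i * h) \<omega>"
  shows "integrable M (\<lambda>\<omega>. (\<Sum>i<n. a i \<omega> * g (d i \<omega>))\<^sup>2) \<and>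
     (\<integral>\<omega>. (\<Sum>i<n. a i \<omega> * g (d i \<omega>))\<^sup>2 \<partial>M) \<le> 2 * \<alpha> * (real n * m2 + (real n * m1)\<^sup>2)"
proof -
  define p where "p i = v + real i * h" for i
  have p: "0 \<le> p i" "p i < p (Suc i)" "p (Suc i) - p i = h" "i \<le> j \<Longrightarrow> p i \<le> p j" for i j
    using assms(1,2) by (auto simp: p_def algebra_simps)
  have d: "d i = (\<lambda>\<omega>. W (p (Suc i)) \<omega> - W (p i) \<omega>)" for i by (simp add: d_def p_def)
  have dM: "d i \<in> borel_measurable (Filt (p (Suc i)))" for i
    using W_measurable_Filt[OF p(1)] measurable_Filt_mono[OF W_measurable_Filt[OF p(1)], of i "p (Suc i)"] p(2)[of i]
    unfolding d by (intro borel_measurable_diff) auto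
  define c where "c z = g z - m1" for z
  have [measurable]: "c \<in> borel_measurable borel" unfolding c_def by measurable
  have c1h: "has_bochner_integral M (\<lambda>\<omega>. c (W h \<omega> - W 0 \<omega>)) 0"
    using m1 unfolding c_def has_bochner_integral_iff by (simp add: prob_space)
  have c2h: "has_bochner_integral M (\<lambda>\<omega>. (c (W h \<omega> - W 0 \<omega>))\<^sup>2) (m2 - m1\<^sup>2)"
  proof -
    have "has_bochner_integral M (\<lambda>\<omega>. (g (W h \<omega> - W 0 \<omega>))\<^sup>2 - 2 * m1 * g (W h \<omega> - W 0 \<omega>) + m1\<^sup>2) (m2 - 2 * m1 * m1 + m1\<^sup>2)"
      using m1 m2 unfolding has_bochner_integral_iff by (simp add: prob_space)
    moreover have "(g z)\<^sup>2 - 2 * m1 * g z + m1\<^sup>2 = (c z)\<^sup>2" for z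
      by (simp add: c_def power2_eq_square algebra_simps)
    ultimately show ?thesis by (simp add: power2_eq_square)
  qed
  have cd: "integrable M (\<lambda>\<omega>. c (d i \<omega>))" "(\<integral>\<omega>. c (d i \<omega>) \<partial>M) = 0"
     "integrable M (\<lambda>\<omega>. (c (d i \<omega>))\<^sup>2)" "(\<integral>\<omega>. (c (d i \<omega>))\<^sup>2 \<partial>M) = m2 - m1\<^sup>2" for i
    using increment_moments_eq[of 0 h "p i" "p (Suc i)" c] increment_moments_eq[of 0 h "p i" "p (Suc i)" "\<lambda>z. (c z)\<^sup>2"]
      c1h c2h assms(2) p(1)[of i] p(3)[of i] unfolding d has_bochner_integral_iff
    by (auto simp: algebra_simps)
  have m2_ge: "0 \<le> m2 - m1\<^sup>2" using cd(4)[of 0] integral_nonneg_AE[of "\<lambda>\<omega>. (c (d 0 \<omega>))\<^sup>2" M] by simp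
  define V where "V k \<omega> = (\<Sum>i<k. a i \<omega> * c (d i \<omega>))" for k \<omega>
  have V: "V k \<in> borel_measurable (Filt (p k)) \<and> integrable M (\<lambda>\<omega>. (V k \<omega>)\<^sup>2) \<and> (\<integral>\<omega>. (V k \<omega>)\<^sup>2 \<partial>M) \<le> real k * (\<alpha> * (m2 - m1\<^sup>2))"
    if "k \<le> n" for k
    using that
  proof (induction k)
    case 0
    then show ?case by (simp add: V_def)
  next
    case (Suc k)
    then have IH: "V k \<in> borel_measurable (Filt (p k))" "integrable M (\<lambda>\<omega>. (V k \<omega>)\<^sup>2)"
      "(\<integral>\<omega>. (V k \<omega>)\<^sup>2 \<partial>M) \<le> real k * (\<alpha> * (m2 - m1\<^sup>2))" by auto
    have k: "k < n" using Suc by simp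
    have ak: "a k \<in> borel_measurable (Filt (p k))" using a[OF k] by (simp add: p_def)
    have VS: "V (Suc k) = (\<lambda>\<omega>. V k \<omega> + a k \<omega> * c (d k \<omega>))" by (simp add: V_def fun_eq_iff)
    have meas: "V (Suc k) \<in> borel_measurable (Filt (p (Suc k)))"
    proof -
      have [measurable]: "V k \<in> borel_measurable (Filt (p (Suc k)))" "a k \<in> borel_measurable (Filt (p (Suc k)))"
          "d k \<in> borel_measurable (Filt (p (Suc k)))"
        using IH(1) ak dM measurable_Filt_mono p(2) less_imp_le by blast+
      show ?thesis unfolding VS by measurable
    qed
    have Vm: "V k \<in> borel_measurable M" and am: "a k \<in> borel_measurable M"
      using measurable_Filt_M[OF _ p(1)] IH ak by blast+
    \<comment> \<open>\<open>V k * a k\<close> is known at time \<open>p k\<close> and the centred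
      factor of the next increment has mean zero, so the cross term vanishes and second moments add
      up.\<close>
    have cross: "integrable M (\<lambda>\<omega>. (V k \<omega> * a k \<omega>) * c (d k \<omega>))" "(\<integral>\<omega>. (V k \<omega> * a k \<omega>) * c (d k \<omega>) \<partial>M) = 0"
      using integrable_mult_increment[OF p(1) p(2), of "\<lambda>\<omega>. V k \<omega> * a k \<omega>" k c]
        integral_mult_increment[OF p(1) p(2), of "\<lambda>\<omega>. V k \<omega> * a k \<omega>" k c]
        integrable_product_of_squares[OF Vm am IH(2) a2[OF k]] cd[of k] IH(1) ak
      unfolding d by auto
    have sq: "integrable M (\<lambda>\<omega>. (a k \<omega>)\<^sup>2 * (c (d k \<omega>))\<^sup>2)"
        "(\<integral>\<omega>. (a k \<omega>)\<^sup>2 * (c (d k \<omega>))\<^sup>2 \<partial>M) = (\<integral>\<omega>. (a k \<omega>)\<^sup>2 \<partial>M) * (m2 - m1\<^sup>2)"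
      using integrable_mult_increment[OF p(1) p(2), of "\<lambda>\<omega>. (a k \<omega>)\<^sup>2" k "\<lambda>z. (c z)\<^sup>2"]
        integral_mult_increment[OF p(1) p(2), of "\<lambda>\<omega>. (a k \<omega>)\<^sup>2" k "\<lambda>z. (c z)\<^sup>2"]
        a2[OF k] cd[of k] ak unfolding d by auto
    have e: "(V (Suc k) \<omega>)\<^sup>2 = (V k \<omega>)\<^sup>2 + 2 * ((V k \<omega> * a k \<omega>) * c (d k \<omega>)) + (a k \<omega>)\<^sup>2 * (c (d k \<omega>))\<^sup>2" for \<omega>
      unfolding VS by (simp add: power2_eq_square algebra_simps)
    have int: "integrable M (\<lambda>\<omega>. (V (Suc k) \<omega>)\<^sup>2)" unfolding e using IH(2) cross(1) sq(1) by simp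
    have "(\<integral>\<omega>. (V (Suc k) \<omega>)\<^sup>2 \<partial>M) = (\<integral>\<omega>. (V k \<omega>)\<^sup>2 \<partial>M) + (\<integral>\<omega>. (a k \<omega>)\<^sup>2 \<partial>M) * (m2 - m1\<^sup>2)"
      unfolding e using IH(2) cross sq by simp
    also have "\<dots> \<le> real k * (\<alpha> * (m2 - m1\<^sup>2)) + \<alpha> * (m2 - m1\<^sup>2)"
      by (intro add_mono IH(3) mult_right_mono a_le k m2_ge)
    finally show ?case using meas int by (simp add: algebra_simps)
  qed
  have Vn: "V n \<in> borel_measurable M" "integrable M (\<lambda>\<omega>. (V n \<omega>)\<^sup>2)" "(\<integral>\<omega>. (V n \<omega>)\<^sup>2 \<partial>M) \<le> real n * (\<alpha> * (m2 - m1\<^sup>2))"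
    using V[OF order_refl] measurable_Filt_M[OF _ p(1)] by blast+
  \<comment> \<open>The mean part is not orthogonal, so it is estimated by Cauchy-Schwarz; this is
    the source of the term \<open>(real n * m1)\<^sup>2\<close>.\<close>
  define U where "U \<omega> = (\<Sum>i<n. m1 * a i \<omega>)" for \<omega>
  have am: "a i \<in> borel_measurable M" if "i < n" for i
    using a[OF that] measurable_Filt_M[OF _ p(1)] unfolding p_def by blast
  have U: "integrable M (\<lambda>\<omega>. (U \<omega>)\<^sup>2) \<and> (\<integral>\<omega>. (U \<omega>)\<^sup>2 \<partial>M) \<le> (real n)\<^sup>2 * (m1\<^sup>2 * \<alpha>)"
    unfolding U_def
    by (rule integral_square_sum_le) (use am a2 a_le in \<open>auto simp: power_mult_distrib intro!: mult_left_mono\<close>)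
  have Um: "U \<in> borel_measurable M" unfolding U_def using am by measurable
  have e: "(\<Sum>i<n. a i \<omega> * g (d i \<omega>)) = V n \<omega> + U \<omega>" for \<omega>
    unfolding V_def U_def c_def by (simp add: sum.distrib[symmetric] algebra_simps)
  have int: "integrable M (\<lambda>\<omega>. (V n \<omega> + U \<omega>)\<^sup>2)"
    using integrable_sum_squared Vn(1,2) U Um by blast
  have "(\<integral>\<omega>. (V n \<omega> + U \<omega>)\<^sup>2 \<partial>M) \<le> (\<integral>\<omega>. 2 * (V n \<omega>)\<^sup>2 + 2 * (U \<omega>)\<^sup>2 \<partial>M)"
    by (intro integral_mono int) (use U Vn sum_squared_le in auto)
  also have "\<dots> = 2 * (\<integral>\<omega>. (V n \<omega>)\<^sup>2 \<partial>M) + 2 * (\<integral>\<omega>. (U \<omega>)\<^sup>2 \<partial>M)" using U Vn by simp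
  also have "\<dots> \<le> 2 * (real n * (\<alpha> * (m2 - m1\<^sup>2))) + 2 * ((real n)\<^sup>2 * (m1\<^sup>2 * \<alpha>))"
    using U Vn by (intro add_mono mult_left_mono) auto
  also have "\<dots> \<le> 2 * \<alpha> * (real n * m2 + (real n * m1)\<^sup>2)"
    using \<open>0 \<le> \<alpha>\<close> by (simp add: algebra_simps power_mult_distrib)
  finally show ?thesis using int unfolding e by blast
qed

end

section \<open>Geometric Brownian motion\<close>

text \<open>Density and continuity. Rational multiples of \<open>t\<close>, instead of rational
  times, are used because they contain all points of a uniform grid on
  \<open>[0, t]\<close>.\<close>

lemma closed_rational_multiples:
  fixes f :: "real \<Rightarrow> real"
  assumes f: "continuous_on {a..b} f" and "a < b" "0 < t" "closed S"
    and S: "\<And>q. q \<in> \<rat> \<Longrightarrow> a \<le> q * t \<Longrightarrow> q * t \<le> b \<Longrightarrow> f (q * t) \<in> S" and u: "u \<in> {a..b}"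
  shows "f u \<in> S"
proof (rule ccontr)
  assume "f u \<notin> S"
  have "(f \<longlongrightarrow> f u) (at u within {a..b})" using f u by (simp add: continuous_on_def)
  then have "eventually (\<lambda>v. f v \<in> - S) (at u within {a..b})"
    by (rule topological_tendstoD) (use \<open>closed S\<close> \<open>f u \<notin> S\<close> in auto)
  then obtain d where d: "0 < d" "\<And>v. v \<in> {a..b} \<Longrightarrow> v \<noteq> u \<Longrightarrow> dist v u < d \<Longrightarrow> f v \<notin> S"
    by (auto simp: eventually_at)
  have d': "f v \<notin> S" if "v \<in> {a..b}" "\<bar>v - u\<bar> < d" for v
    using d(2)[of v] that \<open>f u \<notin> S\<close> by (cases "v = u") (auto simp: dist_real_def)
  have "max a (u - d) < min b (u + d)" using u d(1) \<open>a < b\<close> by auto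
  then have "max a (u - d) / t < min b (u + d) / t" using \<open>0 < t\<close> by (simp add: divide_strict_right_mono)
  then obtain q where q: "q \<in> \<rat>" "max a (u - d) / t < q" "q < min b (u + d) / t"
    using Rats_dense_in_real by blast
  then have "max a (u - d) < q * t" "q * t < min b (u + d)"
    using \<open>0 < t\<close> by (simp_all add: field_simps)
  then have "q * t \<in> {a..b}" "\<bar>q * t - u\<bar> < d" by (auto simp: abs_less_iff)
  then show False using d'[of "q * t"] S[OF q(1)] by simp
qed

text \<open>Applied with \<open>f\<close> a moment of one step: the sum over \<open>n\<close> steps
  of length \<open>t / n\<close> has the limit \<open>t * D\<close>.\<close>

lemma tendsto_scaled_difference_quotient:
  fixes f :: "real \<Rightarrow> real"
  assumes "(f has_real_derivative D) (at 0)" "f 0 = 0" "0 < t"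
  shows "(\<lambda>n. real n * f (t / real n)) \<longlonglongrightarrow> t * D"
proof -
  have "((\<lambda>h. f h / h) \<longlongrightarrow> D) (at 0)"
    using assms by (simp add: DERIV_def)
  moreover have "filterlim (\<lambda>n. t / real n) (at 0) sequentially"
    unfolding filterlim_at
  proof
    show "\<forall>\<^sub>F n in sequentially. t / real n \<in> UNIV \<and> t / real n \<noteq> 0"
      using eventually_gt_at_top[of 0] by eventually_elim (use assms in auto)
    show "(\<lambda>n. t / real n) \<longlonglongrightarrow> 0" by (rule lim_const_over_n)
  qed
  ultimately have "(\<lambda>n. t * (f (t / real n) / (t / real n))) \<longlonglongrightarrow> t * D"
    by (intro tendsto_mult tendsto_const) (rule filterlim_compose)
  moreover have "t * (f (t / real n) / (t / real n)) = real n * f (t / real n)" for n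
    using assms(2,3) by (cases "n = 0") auto
  ultimately show ?thesis by simp
qed

lemma pred_countable_Ball:
  assumes "countable I" "\<And>i. i \<in> I \<Longrightarrow> Measurable.pred M (P i)"
  shows "Measurable.pred M (\<lambda>\<omega>. \<forall>i\<in>I. P i \<omega>)"
proof (cases "I = {}")
  case False
  have "{\<omega> \<in> space M. \<forall>i\<in>I. P i \<omega>} = (\<Inter>i\<in>I. {\<omega> \<in> space M. P i \<omega>})"
    using False by auto
  also have "\<dots> \<in> sets M"
    by (intro sets.countable_INT' assms(1) False) (use assms(2) in \<open>auto simp: pred_def\<close>)
  finally show ?thesis by (simp add: pred_def)
qed simp

definition clip :: "real \<Rightarrow> real \<Rightarrow> real" where
  "clip c y = max (- c) (min c y)"

lemma clip_id: "\<bar>y\<bar> \<le> c \<Longrightarrow> clip c y = y"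
  by (auto simp: clip_def)

lemma abs_clip_le: "0 \<le> c \<Longrightarrow> \<bar>clip c y\<bar> \<le> c"
  by (auto simp: clip_def)

lemma clip_measurable [measurable (raw)]:
  "f \<in> borel_measurable M \<Longrightarrow> (\<lambda>\<omega>. clip c (f \<omega>)) \<in> borel_measurable M"
  unfolding clip_def by (intro borel_measurable_max borel_measurable_min borel_measurable_const)

section \<open>The solution at one fixed time and the exceptional events\<close>

locale gbm_at_time = filtered_brownian_motion M Filt W
  for M :: "'a measure" and Filt W +
  fixes \<mu> \<sigma> x t :: real and X :: "real \<Rightarrow> 'a \<Rightarrow> real"
  assumes t: "0 < t" and gbm: "geometric_brownian_motion M Filt W \<mu> \<sigma> x X"
begin

lemma X_measurable_Filt: "0 \<le> u \<Longrightarrow> X u \<in> borel_measurable (Filt u)"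
  using gbm by (simp add: geometric_brownian_motion_def adapted_continuous_def)

lemma X_measurable: "0 \<le> u \<Longrightarrow> X u \<in> borel_measurable M"
  using X_measurable_Filt measurable_Filt_M by blast

lemma X_continuous: "AE \<omega> in M. continuous_on {0..} (\<lambda>t. X t \<omega>)"
  using gbm by (simp add: geometric_brownian_motion_def adapted_continuous_def)

lemma X_0: "AE \<omega> in M. X 0 \<omega> = x"
  using gbm by (simp add: geometric_brownian_motion_def)

definition \<kappa> :: real where "\<kappa> = \<sigma>\<^sup>2 / 2 - \<mu>"

text \<open>The reciprocal of the solution expected for initial value 1.\<close>

definition Z :: "real \<Rightarrow> 'a \<Rightarrow> real" where
  "Z u \<omega> = exp (- \<sigma> * W u \<omega> + \<kappa> * u)"

lemma Z_measurable_Filt: "0 \<le> u \<Longrightarrow> Z u \<in> borel_measurable (Filt u)"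
  unfolding Z_def using W_measurable_Filt[of u] by measurable

lemma Z_measurable: "0 \<le> u \<Longrightarrow> Z u \<in> borel_measurable M"
  using Z_measurable_Filt measurable_Filt_M by blast

text \<open>The equation for \<open>X\<close> provides an Ito integral for each time separately; the
  choice makes one function of time out of them.\<close>

definition J :: "real \<Rightarrow> 'a \<Rightarrow> real" where
  "J u = (SOME J. has_ito_integral M W (\<lambda>u \<omega>. \<sigma> * X u \<omega>) u J \<and>
        (AE \<omega> in M. X u \<omega> = x + integral {0..u} (\<lambda>u. \<mu> * X u \<omega>) + J \<omega>))"

lemma J:
  assumes "0 \<le> u"
  shows "has_ito_integral M W (\<lambda>u \<omega>. \<sigma> * X u \<omega>) u (J u)"
    and "AE \<omega> in M. X u \<omega> = x + integral {0..u} (\<lambda>u. \<mu> * X u \<omega>) + J u \<omega>"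
proof -
  have "\<exists>J. has_ito_integral M W (\<lambda>u \<omega>. \<sigma> * X u \<omega>) u J \<and>
        (AE \<omega> in M. X u \<omega> = x + integral {0..u} (\<lambda>u. \<mu> * X u \<omega>) + J \<omega>)"
    using gbm assms by (simp add: geometric_brownian_motion_def)
  from someI_ex[OF this] show "has_ito_integral M W (\<lambda>u \<omega>. \<sigma> * X u \<omega>) u (J u)"
    "AE \<omega> in M. X u \<omega> = x + integral {0..u} (\<lambda>u. \<mu> * X u \<omega>) + J u \<omega>"
    unfolding J_def by blast+
qed

lemma J_measurable: "0 \<le> u \<Longrightarrow> J u \<in> borel_measurable M"
  using J(1) by (simp add: has_ito_integral_def)

text \<open>Only countably many times occur here and in \<open>modulus_event\<close>, which makes
  the events measurable. They include all grid points, and path continuity recovers the other times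
  where these matter.\<close>

definition bounded_event :: "real \<Rightarrow> 'a set" where
  "bounded_event K = {\<omega> \<in> space M. \<forall>q\<in>\<rat> \<inter> {0..1}. \<bar>X (q * t) \<omega>\<bar> \<le> K \<and> Z (q * t) \<omega> \<le> K}"

definition modulus_event :: "real \<Rightarrow> nat \<Rightarrow> 'a set" where
  "modulus_event e N = {\<omega> \<in> space M. \<forall>q\<in>\<rat> \<inter> {0..1}. \<forall>q'\<in>\<rat> \<inter> {0..1}.
     \<bar>q - q'\<bar> \<le> 1 / real N \<longrightarrow> \<bar>X (q * t) \<omega> - X (q' * t) \<omega>\<bar> \<le> e}"

abbreviation ito_error :: "nat \<Rightarrow> nat \<Rightarrow> nat \<Rightarrow> 'a \<Rightarrow> real" where
  "ito_error N L j \<omega> \<equiv> \<bar>(\<Sum>i<j * L. \<sigma> * X (real i * (t / (real N * real L))) \<omega> *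
        (W (real (Suc i) * (t / (real N * real L))) \<omega> - W (real i * (t / (real N * real L))) \<omega>))
      - J (real j * (t / real N)) \<omega>\<bar>"

definition bad_event :: "real \<Rightarrow> nat \<Rightarrow> nat \<Rightarrow> 'a set" where
  "bad_event e N L = {\<omega> \<in> space M. \<exists>j\<in>{..N}. e < ito_error N L j \<omega>}"

lemma countable_rationals: "countable (\<rat> \<inter> {0..1} :: real set)"
  by (rule countable_subset[OF _ countable_rat]) auto

lemma bounded_event_sets: "bounded_event K \<in> events"
proof -
  have [measurable]: "X (q * t) \<in> borel_measurable M" "Z (q * t) \<in> borel_measurable M" if "q \<in> \<rat> \<inter> {0..1}" for q
    using X_measurable Z_measurable that t by auto
  show ?thesis unfolding bounded_event_def pred_def[symmetric]
    by (intro pred_countable_Ball countable_rationals) measurable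
qed

lemma modulus_event_sets: "modulus_event e N \<in> events"
proof -
  have [measurable]: "X (q * t) \<in> borel_measurable M" if "q \<in> \<rat> \<inter> {0..1}" for q
    using X_measurable that t by auto
  show ?thesis unfolding modulus_event_def pred_def[symmetric]
    by (intro pred_countable_Ball countable_rationals) measurable
qed

lemma ito_sum_measurable:
  "(\<lambda>\<omega>. ito_error N L j \<omega>) \<in> borel_measurable M"
proof -
  have [measurable]: "X (real i * (t / (real N * real L))) \<in> borel_measurable M" 
    "W (real i * (t / (real N * real L))) \<in> borel_measurable M" "J (real j * (t / real N)) \<in> borel_measurable M" for i
    using X_measurable W_measurable J_measurable t by simp_all
  show ?thesis by measurable
qed

lemma bad_event_sets: "bad_event e N L \<in> events"
  unfolding bad_event_def
  by (intro sets.sets_Collect_countable_Bex borel_measurable_less borel_measurable_const ito_sum_measurable)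

text \<open>Continuous paths are bounded on \<open>[0, t]\<close>, so the events increase to a set
  of full measure.\<close>

lemma prob_bounded_event: "(\<lambda>K. prob (space M - bounded_event (real K))) \<longlonglongrightarrow> 0"
proof -
  have inc: "incseq (\<lambda>K. bounded_event (real K))"
  proof (rule incseq_SucI)
    fix K
    have "y \<le> real (Suc K)" if "y \<le> real K" for y using that by simp
    then show "bounded_event (real K) \<subseteq> bounded_event (real (Suc K))"
      unfolding bounded_event_def by blast
  qed
  have "AE \<omega> in M. \<omega> \<in> (\<Union>K. bounded_event (real K))"
    using X_continuous W_continuous AE_space
  proof eventually_elim
    case (elim \<omega>)
    have "continuous_on {0..t} (\<lambda>u. X u \<omega>)" "continuous_on {0..t} (\<lambda>u. Z u \<omega>)"
      using continuous_on_subset[OF elim(1), of "{0..t}"] continuous_on_subset[OF elim(2), of "{0..t}"]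
      unfolding Z_def by (auto intro!: continuous_intros)
    then have "bounded ((\<lambda>u. X u \<omega>) ` {0..t})" "bounded ((\<lambda>u. Z u \<omega>) ` {0..t})"
      by (auto intro!: compact_imp_bounded compact_continuous_image)
    then obtain c d where c: "\<And>u. u \<in> {0..t} \<Longrightarrow> \<bar>X u \<omega>\<bar> \<le> c" and d: "\<And>u. u \<in> {0..t} \<Longrightarrow> \<bar>Z u \<omega>\<bar> \<le> d"
      unfolding bounded_iff ball_simps real_norm_def by blast
    obtain K where K: "max c d \<le> real K" using real_arch_simple by blast
    have "q * t \<in> {0..t}" if "q \<in> \<rat> \<inter> {0..1}" for q
      using that t by (auto simp: mult_le_cancel_right1)
    then have "\<omega> \<in> bounded_event (real K)"
      using elim(3) order_trans[OF c] order_trans[OF order_trans[OF abs_ge_self d]] K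
      unfolding bounded_event_def max.bounded_iff by blast
    then show ?case by blast
  qed
  then have "prob (\<Union>K. bounded_event (real K)) = 1"
    using prob_eq_1[of "\<Union>K. bounded_event (real K)"] bounded_event_sets by auto
  then have "(\<lambda>K. 1 - prob (bounded_event (real K))) \<longlonglongrightarrow> 1 - 1"
    using finite_Lim_measure_incseq[OF _ inc] bounded_event_sets by (intro tendsto_intros) auto
  then show ?thesis using prob_compl[OF bounded_event_sets] by simp
qed

text \<open>Paths are uniformly continuous on \<open>[0, t]\<close>. The index \<open>Suc N\<close>
  matters: \<open>1 / real 0\<close> is 0, so at \<open>N = 0\<close> the event would be the whole
  space and the sequence would not be increasing.\<close>

lemma prob_modulus_event:
  assumes "0 < e"
  shows "(\<lambda>N. prob (space M - modulus_event e (Suc N))) \<longlonglongrightarrow> 0"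
proof -
  have inc: "incseq (\<lambda>N. modulus_event e (Suc N))"
  proof (rule incseq_SucI)
    fix N
    have "1 / real (Suc (Suc N)) \<le> 1 / real (Suc N)" by (simp add: field_simps)
    then show "modulus_event e (Suc N) \<subseteq> modulus_event e (Suc (Suc N))"
      unfolding modulus_event_def using order_trans by blast
  qed
  have "AE \<omega> in M. \<omega> \<in> (\<Union>N. modulus_event e (Suc N))"
    using X_continuous AE_space
  proof eventually_elim
    case (elim \<omega>)
    have "continuous_on {0..t} (\<lambda>u. X u \<omega>)" 
      using continuous_on_subset[OF elim(1), of "{0..t}"] by auto
    then have "uniformly_continuous_on {0..t} (\<lambda>u. X u \<omega>)"
      by (intro compact_uniformly_continuous) auto
    then obtain d where d: "0 < d" "\<And>u v. u \<in> {0..t} \<Longrightarrow> v \<in> {0..t} \<Longrightarrow> dist v u < d \<Longrightarrow> dist (X v \<omega>) (X u \<omega>) < e"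
      unfolding uniformly_continuous_on_def using assms by metis
    obtain N where N: "t / d < real N" using reals_Archimedean2 by blast
    have "t / d < real (Suc N)" using N by simp
    then have N': "t / real (Suc N) < d" using d(1) by (simp add: field_simps del: of_nat_Suc)
    have q: "q * t \<in> {0..t}" if "q \<in> \<rat> \<inter> {0..1}" for q
      using that t by (auto simp: mult_le_cancel_right1)
    have "\<bar>X (q * t) \<omega> - X (q' * t) \<omega>\<bar> \<le> e"
      if "q \<in> \<rat> \<inter> {0..1}" "q' \<in> \<rat> \<inter> {0..1}" "\<bar>q - q'\<bar> \<le> 1 / real (Suc N)" for q q'
    proof -
      have "\<bar>q * t - q' * t\<bar> = \<bar>q - q'\<bar> * t" using t by (simp add: left_diff_distrib[symmetric] abs_mult)
      also have "\<dots> \<le> 1 / real (Suc N) * t" using that(3) t by (intro mult_right_mono) auto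
      also have "\<dots> < d" using N' by simp
      finally have "dist (q * t) (q' * t) < d" by (simp add: dist_real_def)
      from d(2)[OF q[OF that(2)] q[OF that(1)] this] show ?thesis by (simp add: dist_real_def)
    qed
    then have "\<omega> \<in> modulus_event e (Suc N)"
      using elim(2) unfolding modulus_event_def by blast
    then show ?case by blast
  qed
  then have "prob (\<Union>N. modulus_event e (Suc N)) = 1"
    using prob_eq_1[of "\<Union>N. modulus_event e (Suc N)"] modulus_event_sets by auto
  then have "(\<lambda>N. 1 - prob (modulus_event e (Suc N))) \<longlonglongrightarrow> 1 - 1"
    using finite_Lim_measure_incseq[OF _ inc] modulus_event_sets by (intro tendsto_intros) auto
  then show ?thesis using prob_compl[OF modulus_event_sets] by simp
qed

lemma prob_bad_event:
  assumes "0 < e" "0 < N"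
  shows "(\<lambda>L. prob (bad_event e N L)) \<longlonglongrightarrow> 0"
proof -
  define E where "E j L = {\<omega> \<in> space M. e < ito_error N L j \<omega>}" for j L
  have E: "E j L \<in> events" for j L
    unfolding E_def by (intro borel_measurable_less borel_measurable_const ito_sum_measurable)
  have "(\<lambda>L. prob (E j L)) \<longlonglongrightarrow> 0" for j
  proof (rule LIMSEQ_I)
    fix d :: real assume "0 < d"
    \<comment> \<open>In \<open>has_ito_integral\<close> one number is both the tolerance and the
      bound on the probability; the minimum meets both demands.\<close>
    define d' where "d' = min d e"
    have "0 < d'" using \<open>0 < d\<close> assms by (simp add: d'_def)
    have "0 \<le> real j * (t / real N)" using t by simp
    from J(1)[OF this] \<open>0 < d'\<close> obtain \<delta> where \<delta>: "0 < \<delta>"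
      "\<And>n p. p 0 = 0 \<Longrightarrow> p n = real j * (t / real N) \<Longrightarrow> \<forall>i<n. p i \<le> p (Suc i) \<and> p (Suc i) - p i < \<delta> \<Longrightarrow>
        measure M {\<omega> \<in> space M. d' < \<bar>(\<Sum>i<n. \<sigma> * X (p i) \<omega> * (W (p (Suc i)) \<omega> - W (p i) \<omega>)) - J (real j * (t / real N)) \<omega>\<bar>} < d'"
      unfolding has_ito_integral_def by blast
    obtain L0 where L0: "t / (real N * \<delta>) < real L0" using reals_Archimedean2 by blast
    show "\<exists>L0. \<forall>L\<ge>L0. norm (prob (E j L) - 0) < d"
    proof (intro exI allI impI)
      fix L assume "Suc L0 \<le> L"
      then have L: "0 < L" "t / (real N * \<delta>) < real L" using L0 by auto
      let ?err = "\<lambda>p \<omega>. \<bar>(\<Sum>i<j * L. \<sigma> * X (p i) \<omega> * (W (p (Suc i)) \<omega> - W (p i) \<omega>)) - J (real j * (t / real N)) \<omega>\<bar>"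
      define p where "p i = real i * (t / (real N * real L))" for i
      have h: "t / (real N * real L) < \<delta>" using L assms \<delta>(1) by (simp add: field_simps)
      have pn: "p (j * L) = real j * (t / real N)" using L by (simp add: p_def)
      have step1: "p (Suc i) - p i = t / (real N * real L)" for i by (simp add: p_def distrib_right diff_divide_distrib[symmetric])
      have step: "\<forall>i<j * L. p i \<le> p (Suc i) \<and> p (Suc i) - p i < \<delta>"
      proof (intro allI impI conjI)
        fix i
        have "0 \<le> t / (real N * real L)" using t by simp
        then show "p i \<le> p (Suc i)" using step1[of i] by linarith
        show "p (Suc i) - p i < \<delta>" using step1[of i] h by simp
      qed
      have "E j L \<subseteq> {\<omega> \<in> space M. d' < ?err p \<omega>}"
        unfolding E_def p_def d'_def by auto
      moreover have "{\<omega> \<in> space M. d' < ?err p \<omega>} \<in> events"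
        unfolding p_def by (intro borel_measurable_less borel_measurable_const ito_sum_measurable)
      ultimately have "prob (E j L) \<le> prob {\<omega> \<in> space M. d' < ?err p \<omega>}"
        by (rule finite_measure_mono)
      also have "\<dots> < d'" by (rule \<delta>(2)[OF _ pn step]) (simp add: p_def)
      finally have "prob (E j L) < d'" .
      then show "norm (prob (E j L) - 0) < d" by (simp add: d'_def)
    qed
  qed
  then have "(\<lambda>L. \<Sum>j\<in>{..N}. prob (E j L)) \<longlonglongrightarrow> (\<Sum>j\<in>{..N}. 0)"
    by (intro tendsto_sum)
  then have lim: "(\<lambda>L. \<Sum>j\<in>{..N}. prob (E j L)) \<longlonglongrightarrow> 0" by simp
  have "bad_event e N L = (\<Union>j\<in>{..N}. E j L)" for L
    unfolding bad_event_def E_def by auto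
  then have "prob (bad_event e N L) \<le> (\<Sum>j\<in>{..N}. prob (E j L))" for L
    using finite_measure_subadditive_finite[of "{..N}" "\<lambda>j. E j L"] E by (simp add: image_subset_iff)
  then show ?thesis
    by (intro tendsto_sandwich[OF _ _ tendsto_const lim]) auto
qed

end

section \<open>Moments of the one-step factors\<close>

context gbm_at_time
begin

text \<open>For a step of length \<open>h\<close> with Brownian increment \<open>z\<close>,
  \<open>xi\<close> is the relative Euler increment of the solution and \<open>rho\<close> the ratio
  of successive values of \<open>Z\<close>. \<open>eta\<close> is the relative change of X Z over an
  Euler step, and \<open>zeta\<close> that of \<open>Z\<close>.\<close>

definition xi :: "real \<Rightarrow> real \<Rightarrow> real" where "xi h z = \<mu> * h + \<sigma> * z"
definition rho :: "real \<Rightarrow> real \<Rightarrow> real" where "rho h z = exp (- \<sigma> * z + \<kappa> * h)"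
definition eta :: "real \<Rightarrow> real \<Rightarrow> real" where "eta h z = rho h z * (1 + xi h z) - 1"
definition zeta :: "real \<Rightarrow> real \<Rightarrow> real" where "zeta h z = rho h z - 1"

lemma increment_functions_measurable [measurable]:
  "xi h \<in> borel_measurable borel" "rho h \<in> borel_measurable borel"
  "eta h \<in> borel_measurable borel" "zeta h \<in> borel_measurable borel"
  unfolding eta_def zeta_def xi_def rho_def by measurable

text \<open>These are the first and second moments of \<open>zeta\<close> and \<open>eta\<close>, as
  explicit functions of the step length so that their order at 0 can be found by
  differentiation.\<close>

definition zeta1 :: "real \<Rightarrow> real" where "zeta1 h = exp ((\<kappa> + \<sigma>\<^sup>2 / 2) * h) - 1"
definition zeta2 :: "real \<Rightarrow> real" where
  "zeta2 h = exp ((2 * \<kappa> + 2 * \<sigma>\<^sup>2) * h) - 2 * exp ((\<kappa> + \<sigma>\<^sup>2 / 2) * h) + 1"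
definition eta1 :: "real \<Rightarrow> real" where
  "eta1 h = exp ((\<kappa> + \<sigma>\<^sup>2 / 2) * h) * (1 + \<mu> * h - \<sigma>\<^sup>2 * h) - 1"
definition eta2 :: "real \<Rightarrow> real" where
  "eta2 h = exp ((2 * \<kappa> + 2 * \<sigma>\<^sup>2) * h)
       * ((1 + \<mu> * h)\<^sup>2 + 2 * (1 + \<mu> * h) * \<sigma> * (- 2 * \<sigma> * h) + \<sigma>\<^sup>2 * ((- 2 * \<sigma> * h)\<^sup>2 + h))
     - 2 * (exp ((\<kappa> + \<sigma>\<^sup>2 / 2) * h) * (1 + \<mu> * h - \<sigma>\<^sup>2 * h)) + 1"

lemma increment_moment_0:
  assumes "0 < h"
  shows "has_bochner_integral M
     (\<lambda>\<omega>. (c0 + c1 * (W h \<omega> - W 0 \<omega>) + c2 * (W h \<omega> - W 0 \<omega>)\<^sup>2) * exp (\<theta> * (W h \<omega> - W 0 \<omega>)))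
     (exp (\<theta>\<^sup>2 * h / 2) * (c0 + c1 * (\<theta> * h) + c2 * ((\<theta> * h)\<^sup>2 + h)))"
  using increment_moment[of 0 h c0 c1 c2 \<theta>] assms by simp

lemma xi_moments:
  assumes "0 < h"
  shows "has_bochner_integral M (\<lambda>\<omega>. xi h (W h \<omega> - W 0 \<omega>)) (\<mu> * h)"
    and "has_bochner_integral M (\<lambda>\<omega>. (xi h (W h \<omega> - W 0 \<omega>))\<^sup>2) ((\<mu> * h)\<^sup>2 + \<sigma>\<^sup>2 * h)"
proof -
  show "has_bochner_integral M (\<lambda>\<omega>. xi h (W h \<omega> - W 0 \<omega>)) (\<mu> * h)"
    using increment_moment_0[OF assms, of "\<mu> * h" \<sigma> 0 0] by (simp add: xi_def)
  have "(xi h z)\<^sup>2 = ((\<mu> * h)\<^sup>2 + 2 * (\<mu> * h) * \<sigma> * z + \<sigma>\<^sup>2 * z\<^sup>2) * exp (0 * z)" for z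
    by (simp add: xi_def power2_eq_square algebra_simps)
  then show "has_bochner_integral M (\<lambda>\<omega>. (xi h (W h \<omega> - W 0 \<omega>))\<^sup>2) ((\<mu> * h)\<^sup>2 + \<sigma>\<^sup>2 * h)"
    using increment_moment_0[OF assms, of "(\<mu> * h)\<^sup>2" "2 * (\<mu> * h) * \<sigma>" "\<sigma>\<^sup>2" 0] by simp
qed

text \<open>The linear factor equal to 1 gives the moments for \<open>zeta\<close>, and equal to
  \<open>1 + xi h z\<close> those for \<open>eta\<close>.\<close>

lemma rho_moments:
  assumes "0 < h"
  shows "has_bochner_integral M (\<lambda>\<omega>. rho h (W h \<omega> - W 0 \<omega>) * (c0 + c1 * (W h \<omega> - W 0 \<omega>)))
      (exp ((\<kappa> + \<sigma>\<^sup>2 / 2) * h) * (c0 - c1 * \<sigma> * h))"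
    and "has_bochner_integral M (\<lambda>\<omega>. (rho h (W h \<omega> - W 0 \<omega>) * (c0 + c1 * (W h \<omega> - W 0 \<omega>)))\<^sup>2)
      (exp ((2 * \<kappa> + 2 * \<sigma>\<^sup>2) * h) * (c0\<^sup>2 + 2 * c0 * c1 * (- 2 * \<sigma> * h) + c1\<^sup>2 * ((- 2 * \<sigma> * h)\<^sup>2 + h)))"
proof -
  have e: "exp ((\<kappa> + \<sigma>\<^sup>2 / 2) * h) = exp (\<kappa> * h) * exp ((- \<sigma>)\<^sup>2 * h / 2)"
    "exp ((2 * \<kappa> + 2 * \<sigma>\<^sup>2) * h) = exp (2 * \<kappa> * h) * exp ((- 2 * \<sigma>)\<^sup>2 * h / 2)"
    by (simp_all add: exp_add[symmetric] algebra_simps)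
  have r1: "rho h z * (c0 + c1 * z) = exp (\<kappa> * h) * ((c0 + c1 * z + 0 * z\<^sup>2) * exp (- \<sigma> * z))" for z
    by (simp add: rho_def exp_add[symmetric])
  have "(rho h z)\<^sup>2 = exp (2 * \<kappa> * h) * exp (- 2 * \<sigma> * z)" for z
    by (simp add: rho_def exp_add[symmetric] power2_eq_square)
  then have r2: "(rho h z * (c0 + c1 * z))\<^sup>2
      = exp (2 * \<kappa> * h) * ((c0\<^sup>2 + 2 * c0 * c1 * z + c1\<^sup>2 * z\<^sup>2) * exp (- 2 * \<sigma> * z))" for z
    by (simp add: power_mult_distrib) (simp add: power2_eq_square algebra_simps)
  show "has_bochner_integral M (\<lambda>\<omega>. rho h (W h \<omega> - W 0 \<omega>) * (c0 + c1 * (W h \<omega> - W 0 \<omega>)))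
      (exp ((\<kappa> + \<sigma>\<^sup>2 / 2) * h) * (c0 - c1 * \<sigma> * h))"
    using has_bochner_integral_mult_right[OF increment_moment_0[OF assms, of c0 c1 0 "- \<sigma>"], of "exp (\<kappa> * h)"]
    unfolding r1 e by (simp add: mult_ac)
  show "has_bochner_integral M (\<lambda>\<omega>. (rho h (W h \<omega> - W 0 \<omega>) * (c0 + c1 * (W h \<omega> - W 0 \<omega>)))\<^sup>2)
      (exp ((2 * \<kappa> + 2 * \<sigma>\<^sup>2) * h) * (c0\<^sup>2 + 2 * c0 * c1 * (- 2 * \<sigma> * h) + c1\<^sup>2 * ((- 2 * \<sigma> * h)\<^sup>2 + h)))"
    using has_bochner_integral_mult_right[OF increment_moment_0[OF assms, of "c0\<^sup>2" "2 * c0 * c1" "c1\<^sup>2" "- 2 * \<sigma>"], of "exp (2 * \<kappa> * h)"]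
    unfolding r2 e by (simp only: mult.assoc)
qed

lemma minus_1_moments:
  assumes "has_bochner_integral M f a" "has_bochner_integral M (\<lambda>\<omega>. (f \<omega>)\<^sup>2) (b::real)"
  shows "has_bochner_integral M (\<lambda>\<omega>. f \<omega> - 1) (a - 1)"
    and "has_bochner_integral M (\<lambda>\<omega>. (f \<omega> - 1)\<^sup>2) (b - 2 * a + 1)"
proof -
  show "has_bochner_integral M (\<lambda>\<omega>. f \<omega> - 1) (a - 1)"
    using assms unfolding has_bochner_integral_iff by (simp add: prob_space)
  have "(f \<omega> - 1)\<^sup>2 = (f \<omega>)\<^sup>2 - 2 * f \<omega> + 1" for \<omega> by (simp add: power2_eq_square algebra_simps)
  then show "has_bochner_integral M (\<lambda>\<omega>. (f \<omega> - 1)\<^sup>2) (b - 2 * a + 1)"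
    using assms unfolding has_bochner_integral_iff by (simp add: prob_space)
qed

lemma zeta_moments:
  assumes "0 < h"
  shows "has_bochner_integral M (\<lambda>\<omega>. zeta h (W h \<omega> - W 0 \<omega>)) (zeta1 h)"
    and "has_bochner_integral M (\<lambda>\<omega>. (zeta h (W h \<omega> - W 0 \<omega>))\<^sup>2) (zeta2 h)"
  using minus_1_moments[OF rho_moments[OF assms, of 1 0]]
  unfolding zeta_def zeta1_def zeta2_def by simp_all

lemma eta_moments:
  assumes "0 < h"
  shows "has_bochner_integral M (\<lambda>\<omega>. eta h (W h \<omega> - W 0 \<omega>)) (eta1 h)"
    and "has_bochner_integral M (\<lambda>\<omega>. (eta h (W h \<omega> - W 0 \<omega>))\<^sup>2) (eta2 h)"
proof -
  have e: "c0 - \<sigma> * \<sigma> * h = c0 - \<sigma>\<^sup>2 * h" for c0 by (simp add: power2_eq_square)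
  show "has_bochner_integral M (\<lambda>\<omega>. eta h (W h \<omega> - W 0 \<omega>)) (eta1 h)"
    "has_bochner_integral M (\<lambda>\<omega>. (eta h (W h \<omega> - W 0 \<omega>))\<^sup>2) (eta2 h)"
    using minus_1_moments[OF rho_moments[OF assms, of "1 + \<mu> * h" \<sigma>]]
    unfolding eta_def xi_def eta1_def eta2_def e by (simp_all add: add.assoc)
qed

text \<open>The factor from \<open>weighted_increment_sum_L2\<close> for \<open>n\<close> steps of
  length \<open>t / n\<close>.\<close>

definition L2_rate :: "(real \<Rightarrow> real) \<Rightarrow> (real \<Rightarrow> real) \<Rightarrow> nat \<Rightarrow> real" where
  "L2_rate m2 m1 n = real n * m2 (t / real n) + (real n * m1 (t / real n))\<^sup>2"

text \<open>The correction \<open>\<sigma>\<^sup>2 / 2\<close> in \<open>\<kappa>\<close> is what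
  makes the derivatives of both \<open>eta1\<close> and \<open>eta2\<close> vanish at 0. It is the
  discrete trace of the fact that the differential of X Z is zero.\<close>

lemma L2_rate_eta: "L2_rate eta2 eta1 \<longlonglongrightarrow> 0"
proof -
  have "(eta1 has_real_derivative 0) (at 0)"
    unfolding eta1_def[abs_def] \<kappa>_def by (auto intro!: derivative_eq_intros)
  moreover have "(eta2 has_real_derivative 0) (at 0)"
    unfolding eta2_def[abs_def] \<kappa>_def by (auto intro!: derivative_eq_intros simp: power2_eq_square algebra_simps)
  ultimately have "(\<lambda>n. real n * eta2 (t / real n)) \<longlonglongrightarrow> t * 0" "(\<lambda>n. real n * eta1 (t / real n)) \<longlonglongrightarrow> t * 0"
    using eta1_def[of 0] eta2_def[of 0] tendsto_scaled_difference_quotient[of _ _ t] t by force+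
  then have "(\<lambda>n. real n * eta2 (t / real n) + (real n * eta1 (t / real n))\<^sup>2) \<longlonglongrightarrow> t * 0 + (t * 0)\<^sup>2"
    by (intro tendsto_add tendsto_power)
  then show ?thesis by (simp add: L2_rate_def[abs_def])
qed

text \<open>Here the moments are of the order of the step, so the rate merely converges. This
  suffices since \<open>zeta\<close> is multiplied by the small error \<open>Y - X\<close>.\<close>

lemma L2_rate_zeta: "\<exists>C. L2_rate zeta2 zeta1 \<longlonglongrightarrow> C"
proof -
  have "(zeta1 has_real_derivative \<kappa> + \<sigma>\<^sup>2 / 2) (at 0)"
    unfolding zeta1_def[abs_def] by (auto intro!: derivative_eq_intros)
  moreover have "(zeta2 has_real_derivative \<sigma>\<^sup>2) (at 0)"
    unfolding zeta2_def[abs_def] by (auto intro!: derivative_eq_intros simp: algebra_simps)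
  ultimately have "(\<lambda>n. real n * zeta2 (t / real n)) \<longlonglongrightarrow> t * \<sigma>\<^sup>2" "(\<lambda>n. real n * zeta1 (t / real n)) \<longlonglongrightarrow> t * (\<kappa> + \<sigma>\<^sup>2 / 2)"
    using zeta1_def[of 0] zeta2_def[of 0] by (auto intro!: tendsto_scaled_difference_quotient t)
  then have "(\<lambda>n. real n * zeta2 (t / real n) + (real n * zeta1 (t / real n))\<^sup>2) \<longlonglongrightarrow> t * \<sigma>\<^sup>2 + (t * (\<kappa> + \<sigma>\<^sup>2 / 2))\<^sup>2"
    by (intro tendsto_add tendsto_power)
  then show ?thesis unfolding L2_rate_def[abs_def] by blast
qed

end

text \<open>\<open>Y\<close> is the process of Riemann sums for \<open>X\<close> on the fine grid. Along this grid
  \<open>Y\<^sub>i\<^sub>+\<^sub>1 Z\<^sub>i\<^sub>+\<^sub>1 - Y\<^sub>i Z\<^sub>i = X\<^sub>i Z\<^sub>i \<eta>\<^sub>i + (Y\<^sub>i - X\<^sub>i) Z\<^sub>i \<zeta>\<^sub>i\<close>, where \<open>\<eta>\<^sub>i\<close>, \<open>\<zeta>\<^sub>i\<close> are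
  functions of the increment of \<open>W\<close> and \<open>E \<eta>\<^sub>i\<close>, \<open>E \<eta>\<^sub>i\<^sup>2\<close> are of smaller order than the step. The
  definition of the Ito integral controls \<open>Y - X\<close> at finitely many fixed times only, the \<open>N\<close>
  points of a coarse grid; between them \<open>Y\<close> moves little in \<open>L\<^sup>2\<close>. All processes are clipped, so
  that no integrability of \<open>X\<close> is needed; on an event of large probability the clipping has no
  effect.\<close>

locale gbm_grid = gbm_at_time M Filt W \<mu> \<sigma> x t X
  for M :: "'a measure" and Filt W \<mu> \<sigma> x t X +
  fixes N L :: nat and K e :: real
  assumes N: "0 < N" and L: "0 < L" and K: "0 < K" and e: "0 < e"
begin

definition h :: real where "h = t / (real N * real L)"

definition d :: "nat \<Rightarrow> 'a \<Rightarrow> real" where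
  "d i \<omega> = W (real (Suc i) * h) \<omega> - W (real i * h) \<omega>"

text \<open>The factor in the bound \<open>c1 * e\<close> for \<open>Y - X\<close> at coarse times:
  1 from the Ito sum and \<open>\<bar>\<mu>\<bar> * t\<close> from the drift sum.\<close>

definition c1 :: real where "c1 = 1 + \<bar>\<mu>\<bar> * t"

definition Y :: "nat \<Rightarrow> 'a \<Rightarrow> real" where
  "Y i \<omega> = x + (\<Sum>k<i. clip K (X (real k * h) \<omega>) * xi h (d k \<omega>))"

definition coarse :: "nat \<Rightarrow> nat" where "coarse i = (i div L) * L"

text \<open>Without the clipping the bracket telescopes to \<open>Y i - X\<close>, so that
  \<open>b\<close> is the error \<open>(Y - X) Z\<close>. The first two differences are small on the
  good event and can be clipped at that size; the third, the movement of \<open>Y\<close> since the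
  last coarse time, is small only in mean square and stays as it is.\<close>

definition b :: "nat \<Rightarrow> 'a \<Rightarrow> real" where
  "b i \<omega> = clip K (Z (real i * h) \<omega>) *
     (clip e (X (real (coarse i) * h) \<omega> - X (real i * h) \<omega>)
      + clip (c1 * e) (Y (coarse i) \<omega> - X (real (coarse i) * h) \<omega>) + (Y i \<omega> - Y (coarse i) \<omega>))"

definition S1 :: "'a \<Rightarrow> real" where
  "S1 \<omega> = (\<Sum>i<N * L. (clip K (X (real i * h) \<omega>) * clip K (Z (real i * h) \<omega>)) * eta h (d i \<omega>))"

definition S2 :: "'a \<Rightarrow> real" where
  "S2 \<omega> = (\<Sum>i<N * L. b i \<omega> * zeta h (d i \<omega>))"

lemma h: "0 < h" "real (N * L) * h = t" "real L * h = t / real N"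
  using t N L by (simp_all add: h_def)

lemma c1: "1 \<le> c1" using t by (simp add: c1_def)

lemma grid_measurable:
  assumes "i \<le> j"
  shows "X (real i * h) \<in> borel_measurable (Filt (real j * h))"
    "Z (real i * h) \<in> borel_measurable (Filt (real j * h))"
    "i < j \<Longrightarrow> d i \<in> borel_measurable (Filt (real j * h))"
proof -
  have le: "real i * h \<le> real j * h" if "i \<le> j" for i j using h(1) that by simp
  have pos: "0 \<le> real i * h" for i using h(1) by simp
  show "X (real i * h) \<in> borel_measurable (Filt (real j * h))"
    "Z (real i * h) \<in> borel_measurable (Filt (real j * h))"
    using measurable_Filt_mono[OF X_measurable_Filt le] measurable_Filt_mono[OF Z_measurable_Filt le] assms pos by auto
  show "d i \<in> borel_measurable (Filt (real j * h))" if "i < j"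
    unfolding d_def
    using measurable_Filt_mono[OF W_measurable_Filt[OF pos] le, of "Suc i" j]
      measurable_Filt_mono[OF W_measurable_Filt[OF pos] le, of i j] that
    by (intro borel_measurable_diff) auto
qed

lemma coarse_le: "coarse i \<le> i"
  unfolding coarse_def by (metis div_times_less_eq_dividend)

lemma less_coarse: "i < coarse i + L"
  unfolding coarse_def using L by (metis dividend_less_div_times add.commute)

lemma Y_measurable: "i \<le> j \<Longrightarrow> Y i \<in> borel_measurable (Filt (real j * h))"
  unfolding Y_def
  by (intro borel_measurable_add borel_measurable_sum borel_measurable_times borel_measurable_const clip_measurable
      grid_measurable measurable_compose[OF grid_measurable(3) increment_functions_measurable(1)]) auto

lemma b_measurable: "b i \<in> borel_measurable (Filt (real i * h))"
  unfolding b_def using coarse_le[of i]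
  by (intro borel_measurable_add borel_measurable_diff borel_measurable_times clip_measurable
      grid_measurable Y_measurable) auto

text \<open>The mean-square bound for the movement of \<open>Y\<close> over \<open>L\<close> fine
  steps, that is over one coarse cell. As \<open>real L * h\<close> is \<open>t / real N\<close>, it
  becomes small for large \<open>N\<close>.\<close>

definition Y_rate :: real where
  "Y_rate = 2 * K\<^sup>2 * (real L * ((\<mu> * h)\<^sup>2 + \<sigma>\<^sup>2 * h) + (real L * (\<mu> * h))\<^sup>2)"

lemma square_le_iff: "\<bar>y\<bar> \<le> c \<Longrightarrow> y\<^sup>2 \<le> (c::real)\<^sup>2"
  by (metis abs_ge_zero order_trans power2_abs power_mono)

lemma Y_increment_L2:
  "integrable M (\<lambda>\<omega>. (Y i \<omega> - Y (coarse i) \<omega>)\<^sup>2) \<and> (\<integral>\<omega>. (Y i \<omega> - Y (coarse i) \<omega>)\<^sup>2 \<partial>M) \<le> Y_rate"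
proof -
  define c where "c = coarse i"
  define l where "l = i - c"
  have i: "i = c + l" "l \<le> L" using coarse_le[of i] less_coarse[of i] by (auto simp: c_def l_def)
  have Yd: "Y i \<omega> - Y c \<omega> = (\<Sum>k<l. clip K (X (real (c + k) * h) \<omega>) * xi h (d (c + k) \<omega>))" for \<omega>
  proof -
    have "(\<Sum>k<c + l. f k) = (\<Sum>k<c. f k) + (\<Sum>k<l. f (c + k))" for f :: "nat \<Rightarrow> real"
      by (induction l) auto
    then show ?thesis unfolding Y_def i(1) by simp
  qed
  have t1: "real (c + k) * h = real c * h + real k * h" for k by (simp add: algebra_simps)
  have t2: "real (Suc (c + k)) * h = real c * h + real (Suc k) * h" for k by (simp add: algebra_simps)
  have int: "integrable M (\<lambda>\<omega>. (clip K (X (real c * h + real k * h) \<omega>))\<^sup>2)" 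
    and le: "(\<integral>\<omega>. (clip K (X (real c * h + real k * h) \<omega>))\<^sup>2 \<partial>M) \<le> K\<^sup>2" for k
  proof -
    have [measurable]: "X (real c * h + real k * h) \<in> borel_measurable M" using h(1) by (intro X_measurable) simp
    have bd: "(clip K y)\<^sup>2 \<le> K\<^sup>2" for y using abs_clip_le[of K y] K by (intro square_le_iff) simp
    show I: "integrable M (\<lambda>\<omega>. (clip K (X (real c * h + real k * h) \<omega>))\<^sup>2)"
      by (rule integrable_const_bound[where B = "K\<^sup>2"]) (use bd in auto)
    show "(\<integral>\<omega>. (clip K (X (real c * h + real k * h) \<omega>))\<^sup>2 \<partial>M) \<le> K\<^sup>2"
      using integral_mono[OF I integrable_const[of "K\<^sup>2"]] bd by (simp add: prob_space)
  qed
  have "integrable M (\<lambda>\<omega>. (Y i \<omega> - Y c \<omega>)\<^sup>2) \<and>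
     (\<integral>\<omega>. (Y i \<omega> - Y c \<omega>)\<^sup>2 \<partial>M) \<le> 2 * K\<^sup>2 * (real l * ((\<mu> * h)\<^sup>2 + \<sigma>\<^sup>2 * h) + (real l * (\<mu> * h))\<^sup>2)"
    unfolding Yd d_def t1 t2
  proof (rule weighted_increment_sum_L2)
    show "(\<lambda>\<omega>. clip K (X (real c * h + real k * h) \<omega>)) \<in> borel_measurable (Filt (real c * h + real k * h))" for k
      using h(1) by (intro clip_measurable X_measurable_Filt) simp
  qed (use h(1) int le xi_moments[OF h(1)] in auto)
  moreover have "2 * K\<^sup>2 * (real l * ((\<mu> * h)\<^sup>2 + \<sigma>\<^sup>2 * h) + (real l * (\<mu> * h))\<^sup>2) \<le> Y_rate"
    unfolding Y_rate_def power_mult_distrib[of "real _"] using i(2) h(1)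
    by (intro mult_left_mono add_mono mult_right_mono power_mono) auto
  ultimately show ?thesis unfolding c_def by linarith
qed

definition b_rate :: real where
  "b_rate = K\<^sup>2 * (3 * e\<^sup>2 + 3 * (c1 * e)\<^sup>2 + 3 * Y_rate)"

lemma sum3_squared_le: "(u + v + w)\<^sup>2 \<le> 3 * u\<^sup>2 + 3 * v\<^sup>2 + 3 * (w::real)\<^sup>2"
proof -
  have "0 \<le> (u - v)\<^sup>2 + (v - w)\<^sup>2 + (u - w)\<^sup>2" by simp
  then show ?thesis by (simp add: power2_eq_square algebra_simps)
qed

lemma b_L2: "integrable M (\<lambda>\<omega>. (b i \<omega>)\<^sup>2) \<and> (\<integral>\<omega>. (b i \<omega>)\<^sup>2 \<partial>M) \<le> b_rate"
proof -
  have [measurable]: "b i \<in> borel_measurable M" using measurable_Filt_M[OF b_measurable] h(1) by simp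
  have le: "(b i \<omega>)\<^sup>2 \<le> K\<^sup>2 * (3 * e\<^sup>2 + 3 * (c1 * e)\<^sup>2 + 3 * (Y i \<omega> - Y (coarse i) \<omega>)\<^sup>2)" for \<omega>
  proof -
    have "(clip e u + clip (c1 * e) v + w)\<^sup>2 \<le> 3 * e\<^sup>2 + 3 * (c1 * e)\<^sup>2 + 3 * w\<^sup>2" for u v w
      using sum3_squared_le[of "clip e u" "clip (c1 * e) v" w] e c1
        square_le_iff[OF abs_clip_le, of e u] square_le_iff[OF abs_clip_le, of "c1 * e" v] by simp
    then show ?thesis
      unfolding b_def power_mult_distrib[of "clip K _"]
      using K by (intro mult_mono square_le_iff[OF abs_clip_le]) auto
  qed
  have I: "integrable M (\<lambda>\<omega>. K\<^sup>2 * (3 * e\<^sup>2 + 3 * (c1 * e)\<^sup>2 + 3 * (Y i \<omega> - Y (coarse i) \<omega>)\<^sup>2))"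
    using Y_increment_L2[of i] by simp
  have J: "integrable M (\<lambda>\<omega>. (b i \<omega>)\<^sup>2)"
    by (rule Bochner_Integration.integrable_bound[OF I]) (use le in \<open>auto intro!: AE_I2 order_trans[OF le]\<close>)
  have "(\<integral>\<omega>. (b i \<omega>)\<^sup>2 \<partial>M) \<le> (\<integral>\<omega>. K\<^sup>2 * (3 * e\<^sup>2 + 3 * (c1 * e)\<^sup>2 + 3 * (Y i \<omega> - Y (coarse i) \<omega>)\<^sup>2) \<partial>M)"
    by (intro integral_mono I J le)
  also have "\<dots> = K\<^sup>2 * (3 * e\<^sup>2 + 3 * (c1 * e)\<^sup>2 + 3 * (\<integral>\<omega>. (Y i \<omega> - Y (coarse i) \<omega>)\<^sup>2 \<partial>M))"
    using Y_increment_L2[of i] by (simp add: prob_space)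
  also have "\<dots> \<le> b_rate"
    unfolding b_rate_def using Y_increment_L2[of i] by (intro mult_left_mono add_mono) auto
  finally show ?thesis using J by blast
qed

lemma h_eq: "h = t / real (N * L)"
  by (simp add: h_def)

lemma S1_L2: "integrable M (\<lambda>\<omega>. (S1 \<omega>)\<^sup>2)" "(\<integral>\<omega>. (S1 \<omega>)\<^sup>2 \<partial>M) \<le> 2 * (K\<^sup>2 * K\<^sup>2) * L2_rate eta2 eta1 (N * L)"
proof -
  have "integrable M (\<lambda>\<omega>. (S1 \<omega>)\<^sup>2) \<and>
     (\<integral>\<omega>. (S1 \<omega>)\<^sup>2 \<partial>M) \<le> 2 * (K\<^sup>2 * K\<^sup>2) * (real (N * L) * eta2 h + (real (N * L) * eta1 h)\<^sup>2)"
  proof -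
    define a where "a i \<omega> = clip K (X (real i * h) \<omega>) * clip K (Z (real i * h) \<omega>)" for i \<omega>
    have am: "a i \<in> borel_measurable (Filt (real i * h))" for i
      unfolding a_def using grid_measurable[of i i] by (intro borel_measurable_times clip_measurable) auto
    then have [measurable]: "a i \<in> borel_measurable M" for i using measurable_Filt_M h(1) by (metis less_imp_le mult_nonneg_nonneg of_nat_0_le_iff)
    have bd: "(a i \<omega>)\<^sup>2 \<le> K\<^sup>2 * K\<^sup>2" for i \<omega>
      unfolding a_def power_mult_distrib using K by (intro mult_mono square_le_iff abs_clip_le) auto
    have I: "integrable M (\<lambda>\<omega>. (a i \<omega>)\<^sup>2)" for i
      by (rule integrable_const_bound[where B = "K\<^sup>2 * K\<^sup>2"]) (use bd in auto)
    have le: "(\<integral>\<omega>. (a i \<omega>)\<^sup>2 \<partial>M) \<le> K\<^sup>2 * K\<^sup>2" for i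
      using integral_mono[OF I integrable_const[of "K\<^sup>2 * K\<^sup>2"]] bd by (simp add: prob_space)
    show ?thesis
      using weighted_increment_sum_L2[of 0 h "eta h" "N * L" a "K\<^sup>2 * K\<^sup>2" "eta1 h" "eta2 h"]
        h(1) am I le eta_moments[OF h(1)] unfolding S1_def a_def d_def by simp
  qed
  then show "integrable M (\<lambda>\<omega>. (S1 \<omega>)\<^sup>2)" "(\<integral>\<omega>. (S1 \<omega>)\<^sup>2 \<partial>M) \<le> 2 * (K\<^sup>2 * K\<^sup>2) * L2_rate eta2 eta1 (N * L)"
    unfolding L2_rate_def h_eq by auto
qed

lemma b_rate_nonneg: "0 \<le> b_rate"
  unfolding b_rate_def Y_rate_def using h(1) by (intro mult_nonneg_nonneg add_nonneg_nonneg) auto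

lemma S2_L2: "integrable M (\<lambda>\<omega>. (S2 \<omega>)\<^sup>2)" "(\<integral>\<omega>. (S2 \<omega>)\<^sup>2 \<partial>M) \<le> 2 * b_rate * L2_rate zeta2 zeta1 (N * L)"
  using weighted_increment_sum_L2[of 0 h "zeta h" "N * L" b b_rate "zeta1 h" "zeta2 h"]
        h(1) b_measurable b_L2 zeta_moments[OF h(1)] b_rate_nonneg unfolding S2_def d_def L2_rate_def h_eq by simp_all

lemma S_measurable: "S1 \<in> borel_measurable M" "S2 \<in> borel_measurable M"
proof -
  have pos: "0 \<le> real i * h" for i using h(1) by simp
  have [measurable]: "X (real i * h) \<in> borel_measurable M" "Z (real i * h) \<in> borel_measurable M" "d i \<in> borel_measurable M" "b i \<in> borel_measurable M" for i
    using X_measurable[OF pos] Z_measurable[OF pos] measurable_Filt_M[OF b_measurable pos] measurable_Filt_M[OF grid_measurable(3) pos, of i "Suc i"]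
    by auto
  show "S1 \<in> borel_measurable M" unfolding S1_def by measurable
  show "S2 \<in> borel_measurable M" unfolding S2_def by measurable
qed

lemma prob_ge_le_L2:
  assumes [measurable]: "f \<in> borel_measurable M" and "integrable M (\<lambda>\<omega>. (f \<omega>)\<^sup>2)"
    and "(\<integral>\<omega>. (f \<omega>)\<^sup>2 \<partial>M) \<le> C" "0 < \<delta>"
  shows "prob {\<omega> \<in> space M. \<delta> \<le> \<bar>f \<omega>\<bar>} \<le> C / \<delta>\<^sup>2"
proof -
  have "{\<omega> \<in> space M. \<delta> \<le> \<bar>f \<omega>\<bar>} = {\<omega> \<in> space M. \<delta>\<^sup>2 \<le> (f \<omega>)\<^sup>2}"
    using assms(4) by (auto simp: abs_le_square_iff[symmetric])
  also have "prob \<dots> \<le> (\<integral>\<omega>. (f \<omega>)\<^sup>2 \<partial>M) / \<delta>\<^sup>2"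
    by (rule integral_Markov_inequality_measure[where A = "space M"]) (use assms in auto)
  also have "\<dots> \<le> C / \<delta>\<^sup>2" using assms by (intro divide_right_mono) auto
  finally show ?thesis .
qed

end

section \<open>Pathwise estimate on the good event\<close>

context gbm_grid
begin

lemma grid_rational:
  assumes "i \<le> N * L"
  shows "real i / real (N * L) \<in> \<rat> \<inter> {0..1}" "real i * h = real i / real (N * L) * t"
proof -
  have "real i \<le> real (N * L)" using assms of_nat_le_iff by blast
  then show "real i / real (N * L) \<in> \<rat> \<inter> {0..1}" using N L by (auto simp: divide_le_eq)
  show "real i * h = real i / real (N * L) * t" by (simp add: h_def)
qed

lemma bounded_on_grid:
  assumes "\<omega> \<in> bounded_event K" "i \<le> N * L"
  shows "\<bar>X (real i * h) \<omega>\<bar> \<le> K" "\<bar>Z (real i * h) \<omega>\<bar> \<le> K"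
proof -
  have "0 \<le> Z (real i * h) \<omega>" by (simp add: Z_def)
  then show "\<bar>X (real i * h) \<omega>\<bar> \<le> K" "\<bar>Z (real i * h) \<omega>\<bar> \<le> K"
    using assms(1) grid_rational(1)[OF assms(2)] unfolding grid_rational(2)[OF assms(2)] bounded_event_def
    by (simp_all only: abs_of_nonneg) blast+
qed

lemma modulus_on_grid:
  assumes "\<omega> \<in> modulus_event e N" "i \<le> N * L"
  shows "\<bar>X (real (coarse i) * h) \<omega> - X (real i * h) \<omega>\<bar> \<le> e"
proof -
  have c: "coarse i \<le> N * L" using coarse_le[of i] assms(2) by simp
  have "real i - real (coarse i) \<le> real L" using less_coarse[of i] by linarith
  moreover have "0 \<le> real i - real (coarse i)" using coarse_le[of i] by simp
  ultimately have "\<bar>real (coarse i) - real i\<bar> / real (N * L) \<le> real L / real (N * L)"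
    by (intro divide_right_mono) auto
  then have "\<bar>real (coarse i) / real (N * L) - real i / real (N * L)\<bar> \<le> real L / real (N * L)"
    unfolding diff_divide_distrib[symmetric] abs_divide abs_of_nat .
  also have "\<dots> = 1 / real N" using L by simp
  finally have "\<bar>real (coarse i) / real (N * L) - real i / real (N * L)\<bar> \<le> 1 / real N" .
  then show ?thesis
    using assms(1) grid_rational(1)[OF c] grid_rational(1)[OF assms(2)]
    unfolding modulus_event_def grid_rational(2)[OF c] grid_rational(2)[OF assms(2)] by blast
qed

text \<open>The drift integral involves all times of a cell while \<open>modulus_event\<close>
  constrains only rational multiples of \<open>t\<close>; continuity closes this gap.\<close>

lemma modulus_on_cell:
  assumes "\<omega> \<in> modulus_event e N" "continuous_on {0..} (\<lambda>u. X u \<omega>)" "i < N * L"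
    and "u \<in> {real i * h..real (Suc i) * h}"
  shows "\<bar>X u \<omega> - X (real i * h) \<omega>\<bar> \<le> e"
proof -
  have lt: "real i * h < real (Suc i) * h" using h(1) by simp
  have pos: "0 \<le> real i * h" using h(1) by simp
  have "(\<lambda>u. X u \<omega>) u \<in> cball (X (real i * h) \<omega>) e"
  proof (rule closed_rational_multiples[OF _ lt t closed_cball _ assms(4)])
    show "continuous_on {real i * h..real (Suc i) * h} (\<lambda>u. X u \<omega>)"
      by (rule continuous_on_subset[OF assms(2)]) (use pos in auto)
    fix q :: real assume q: "q \<in> \<rat>" "real i * h \<le> q * t" "q * t \<le> real (Suc i) * h"
    have eqs: "real i * h = real i / real (N * L) * t" "real (Suc i) * h = real (Suc i) / real (N * L) * t"
      using grid_rational(2)[of i] grid_rational(2)[of "Suc i"] assms(3) by auto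
    have q': "real i / real (N * L) \<le> q" "q \<le> real (Suc i) / real (N * L)"
      using q(2,3) mult_right_le_imp_le[OF _ t] unfolding eqs by blast+
    have r: "real i / real (N * L) \<in> \<rat> \<inter> {0..1}" "real (Suc i) / real (N * L) \<in> \<rat> \<inter> {0..1}"
      using grid_rational(1)[OF less_imp_le[OF assms(3)]] grid_rational(1)[OF Suc_leI[OF assms(3)]] by blast+
    then have "0 \<le> q" "q \<le> 1" 
      using order_trans[of 0 "real i / real (N * L)" q] order_trans[of q "real (Suc i) / real (N * L)" 1] q'
      by (simp_all only: Int_iff atLeastAtMost_iff)
    then have "q \<in> \<rat> \<inter> {0..1}" using q(1) by simp
    moreover have "\<bar>real i / real (N * L) - q\<bar> \<le> 1 / real N"
    proof -
      have "\<bar>real i / real (N * L) - q\<bar> \<le> real (Suc i) / real (N * L) - real i / real (N * L)" using q' by simp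
      also have "\<dots> = 1 / real (N * L)" by (simp add: diff_divide_distrib[symmetric])
      also have "\<dots> \<le> 1 / real N" using N L by (simp add: field_simps)
      finally show ?thesis .
    qed
    ultimately have "\<bar>X (real i / real (N * L) * t) \<omega> - X (q * t) \<omega>\<bar> \<le> e"
      using assms(1) r(1) unfolding modulus_event_def by blast
    then show "X (q * t) \<omega> \<in> cball (X (real i * h) \<omega>) e" by (simp add: dist_real_def eqs(1))
  qed
  then show ?thesis by (simp add: dist_real_def abs_minus_commute)
qed

lemma drift_sum_error:
  assumes "\<omega> \<in> modulus_event e N" "continuous_on {0..} (\<lambda>u. X u \<omega>)" "i \<le> N * L"
  shows "\<bar>(\<Sum>k<i. X (real k * h) \<omega> * h) - integral {0..real i * h} (\<lambda>u. X u \<omega>)\<bar> \<le> real i * (e * h)"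
  using assms(3)
proof (induction i)
  case (Suc i)
  have pos: "0 \<le> real i * h" "real i * h \<le> real (Suc i) * h" using h(1) by auto
  have int: "(\<lambda>u. X u \<omega>) integrable_on {a..b'}" if "0 \<le> a" for a b'
    by (rule integrable_continuous_interval, rule continuous_on_subset[OF assms(2)]) (use that in auto)
  have split: "integral {0..real (Suc i) * h} (\<lambda>u. X u \<omega>) = integral {0..real i * h} (\<lambda>u. X u \<omega>)
      + integral {real i * h..real (Suc i) * h} (\<lambda>u. X u \<omega>)"
    using Henstock_Kurzweil_Integration.integral_combine[OF pos int[OF order_refl]] by simp
  have "X (real i * h) \<omega> * h - integral {real i * h..real (Suc i) * h} (\<lambda>u. X u \<omega>)
      = integral {real i * h..real (Suc i) * h} (\<lambda>u. X (real i * h) \<omega> - X u \<omega>)"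
  proof -
    have "integral {real i * h..real (Suc i) * h} (\<lambda>u. X (real i * h) \<omega> - X u \<omega>)
      = integral {real i * h..real (Suc i) * h} (\<lambda>u. X (real i * h) \<omega>) - integral {real i * h..real (Suc i) * h} (\<lambda>u. X u \<omega>)"
      by (intro Henstock_Kurzweil_Integration.integral_diff integrable_const_ivl int pos(1))
    moreover have "integral {real i * h..real (Suc i) * h} (\<lambda>u. X (real i * h) \<omega>) = X (real i * h) \<omega> * h"
      using pos(2) by (simp add: algebra_simps)
    ultimately show ?thesis by (simp only:)
  qed
  also have "\<bar>\<dots>\<bar> \<le> integral {real i * h..real (Suc i) * h} (\<lambda>u. e)"
  proof (subst real_norm_def[symmetric], rule integral_norm_bound_integral)
    show "(\<lambda>u. X (real i * h) \<omega> - X u \<omega>) integrable_on {real i * h..real (Suc i) * h}"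
      by (intro Henstock_Kurzweil_Integration.integrable_diff integrable_const_ivl int pos(1))
    show "norm (X (real i * h) \<omega> - X u \<omega>) \<le> e" if "u \<in> {real i * h..real (Suc i) * h}" for u
      using modulus_on_cell[OF assms(1,2) _ that] Suc.prems by (simp add: abs_minus_commute)
  qed (rule integrable_const_ivl)
  also have "\<dots> = e * h" using pos by (simp add: algebra_simps)
  finally show ?case using Suc unfolding split by (simp add: algebra_simps) 
qed simp

lemma rho_Z:
  "Z (real (Suc i) * h) \<omega> = Z (real i * h) \<omega> * rho h (d i \<omega>)"
  unfolding Z_def rho_def d_def by (simp add: exp_add[symmetric] algebra_simps)

text \<open>Off the exceptional events all truncations are inactive, and the discrete product rule
  for \<open>Y\<close> and \<open>Z\<close> telescopes to \<open>S1 + S2\<close>. The first summand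
  of the bound is the cost of replacing \<open>Y\<close> by \<open>X\<close> at the final
  time.\<close>

lemma good_event:
  assumes \<omega>: "\<omega> \<in> bounded_event K" "\<omega> \<in> modulus_event e N" "\<omega> \<notin> bad_event e N L"
    and cont: "continuous_on {0..} (\<lambda>u. X u \<omega>)" and X0: "X 0 \<omega> = x" and W0: "W 0 \<omega> = 0"
    and sol: "\<And>j. j \<le> N \<Longrightarrow> X (real j * (t / real N)) \<omega> = x + integral {0..real j * (t / real N)} (\<lambda>u. \<mu> * X u \<omega>)
         + J (real j * (t / real N)) \<omega>"
  shows "\<bar>X t \<omega> * Z t \<omega> - x\<bar> \<le> K * (c1 * e) + \<bar>S1 \<omega>\<bar> + \<bar>S2 \<omega>\<bar>"
proof -
  define Xd where "Xd i = X (real i * h) \<omega>" for i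
  define Zd where "Zd i = Z (real i * h) \<omega>" for i
  have clipX: "clip K (Xd i) = Xd i" and clipZ: "clip K (Zd i) = Zd i" if "i \<le> N * L" for i
    using bounded_on_grid[OF \<omega>(1) that] by (simp_all add: Xd_def Zd_def clip_id)
  have Y_eq: "Y i \<omega> = x + (\<Sum>k<i. Xd k * xi h (d k \<omega>))" if "i \<le> N * L" for i
    unfolding Y_def using clipX that by (simp add: Xd_def)
  \<comment> \<open>Two sources of error: the Ito sum, within \<open>e\<close> off the bad event,
    and the drift sum, within \<open>t * e\<close> by the modulus of continuity and weighted by
    \<open>\<mu>\<close>.\<close>
  have coarse_error: "\<bar>Y (j * L) \<omega> - Xd (j * L)\<bar> \<le> c1 * e" if j: "j \<le> N" for j
  proof -
    have jL: "j * L \<le> N * L" using j by (rule mult_le_mono1)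
    have tj: "real (j * L) * h = real j * (t / real N)" using h(3) by (simp add: mult.assoc)
    have "real (j * L) * h \<le> real (N * L) * h" 
      by (intro mult_right_mono) (use jL h(1) in \<open>simp_all only: of_nat_le_iff less_imp_le\<close>)
    then have tj_le: "real (j * L) * h \<le> t" using h(2) by simp
    have sp: "\<omega> \<in> space M" using \<omega>(1) by (simp add: bounded_event_def)
    have ito: "\<bar>(\<Sum>k<j * L. \<sigma> * Xd k * d k \<omega>) - J (real j * (t / real N)) \<omega>\<bar> \<le> e"
    proof (rule ccontr)
      assume "\<not> \<bar>(\<Sum>k<j * L. \<sigma> * Xd k * d k \<omega>) - J (real j * (t / real N)) \<omega>\<bar> \<le> e"
      then have "e < \<bar>(\<Sum>k<j * L. \<sigma> * Xd k * d k \<omega>) - J (real j * (t / real N)) \<omega>\<bar>"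
        by (simp only: not_le)
      with sp j have "\<omega> \<in> bad_event e N L"
        unfolding bad_event_def Xd_def d_def h_def by (intro CollectI conjI bexI[of _ j]) (simp_all only: atMost_iff)
      then show False using \<omega>(3) by contradiction
    qed
    have drift: "\<bar>(\<Sum>k<j * L. Xd k * h) - integral {0..real j * (t / real N)} (\<lambda>u. X u \<omega>)\<bar> \<le> t * e"
    proof -
      have "real (j * L) * (e * h) \<le> t * e" using tj_le e by (simp add: mult_ac)
      then show ?thesis using drift_sum_error[OF \<omega>(2) cont jL] unfolding tj Xd_def by linarith
    qed
    have "Y (j * L) \<omega> - Xd (j * L) = \<mu> * ((\<Sum>k<j * L. Xd k * h) - integral {0..real j * (t / real N)} (\<lambda>u. X u \<omega>))
        + ((\<Sum>k<j * L. \<sigma> * Xd k * d k \<omega>) - J (real j * (t / real N)) \<omega>)"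
    proof -
      have "(\<Sum>k<j * L. Xd k * xi h (d k \<omega>)) = \<mu> * (\<Sum>k<j * L. Xd k * h) + (\<Sum>k<j * L. \<sigma> * Xd k * d k \<omega>)"
        unfolding xi_def sum_distrib_left sum.distrib[symmetric] by (rule sum.cong) (auto simp: algebra_simps)
      moreover have "Xd (j * L) = x + \<mu> * integral {0..real j * (t / real N)} (\<lambda>u. X u \<omega>) + J (real j * (t / real N)) \<omega>"
        using sol[OF j] unfolding Xd_def tj by simp
      ultimately show ?thesis unfolding Y_eq[OF jL] by (simp add: algebra_simps)
    qed
    also have "\<bar>\<dots>\<bar> \<le> \<bar>\<mu>\<bar> * (t * e) + e"
      by (intro order_trans[OF abs_triangle_ineq] add_mono ito, unfold abs_mult)
         (intro mult_left_mono drift abs_ge_zero)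
    also have "\<dots> = c1 * e" by (simp add: c1_def algebra_simps)
    finally show ?thesis .
  qed
  \<comment> \<open>Each of the three clipped quantities in \<open>b\<close> is below its clipping
    level, so the bracket telescopes to \<open>Y i - X\<close>.\<close>
  have b_eq: "b i \<omega> = Zd i * (Y i \<omega> - Xd i)" if i: "i < N * L" for i
  proof -
    have "i div L \<le> N" using i L by (simp add: less_mult_imp_div_less less_imp_le)
    then have "\<bar>Y (coarse i) \<omega> - Xd (coarse i)\<bar> \<le> c1 * e" unfolding coarse_def by (rule coarse_error)
    moreover have "\<bar>Xd (coarse i) - Xd i\<bar> \<le> e" using modulus_on_grid[OF \<omega>(2), of i] i by (simp add: Xd_def)
    moreover have "clip K (Zd i) = Zd i" using clipZ i by simp
    ultimately show ?thesis unfolding b_def Xd_def[symmetric] Zd_def[symmetric] by (simp add: clip_id)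
  qed
  have Z_Suc: "Zd (Suc i) = Zd i * rho h (d i \<omega>)" for i
    unfolding Zd_def by (rule rho_Z)
  \<comment> \<open>Discrete product rule: \<open>eta\<close> collects the change that would occur
    if \<open>Y\<close> were \<open>X\<close>, and \<open>zeta\<close> multiplies the
    discrepancy.\<close>
  have step: "Y (Suc i) \<omega> * Zd (Suc i) - Y i \<omega> * Zd i = Xd i * Zd i * eta h (d i \<omega>) + b i \<omega> * zeta h (d i \<omega>)"
    if i: "i < N * L" for i
  proof -
    have Ys: "Y (Suc i) \<omega> = Y i \<omega> + Xd i * xi h (d i \<omega>)" using Y_eq[of i] Y_eq[of "Suc i"] i by simp
    show ?thesis unfolding Ys b_eq[OF i] Z_Suc eta_def zeta_def by (simp add: algebra_simps)
  qed
  have "Y (N * L) \<omega> * Zd (N * L) - Y 0 \<omega> * Zd 0 = (\<Sum>i<N * L. Y (Suc i) \<omega> * Zd (Suc i) - Y i \<omega> * Zd i)"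
    by (rule sum_lessThan_telescope[symmetric, where f = "\<lambda>i. Y i \<omega> * Zd i"])
  also have "\<dots> = (\<Sum>i<N * L. Xd i * Zd i * eta h (d i \<omega>) + b i \<omega> * zeta h (d i \<omega>))"
    by (intro sum.cong) (auto simp: step)
  also have "\<dots> = S1 \<omega> + S2 \<omega>"
    unfolding S1_def S2_def sum.distrib using clipX clipZ by (simp add: Xd_def Zd_def)
  finally have tel: "Y (N * L) \<omega> * Zd (N * L) - x = S1 \<omega> + S2 \<omega>"
    by (simp add: Y_def Zd_def Z_def W0)
  have t_eq: "Xd (N * L) = X t \<omega>" "Zd (N * L) = Z t \<omega>" unfolding Xd_def Zd_def h(2) by simp_all
  have "\<bar>(X t \<omega> - Y (N * L) \<omega>) * Z t \<omega>\<bar> \<le> (c1 * e) * K"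
    using coarse_error[of N] bounded_on_grid(2)[OF \<omega>(1), of "N * L"] unfolding t_eq h(2) abs_mult
    by (intro mult_mono) (auto simp: abs_minus_commute)
  moreover have "X t \<omega> * Z t \<omega> - x = (X t \<omega> - Y (N * L) \<omega>) * Z t \<omega> + (S1 \<omega> + S2 \<omega>)"
    using tel unfolding t_eq by (simp add: algebra_simps)
  ultimately show ?thesis by (simp add: mult.commute)
qed

text \<open>The bound of \<open>good_event\<close> has three summands and the first is at most
  \<open>\<delta>\<close>; a deviation above \<open>3 * \<delta>\<close> therefore needs an
  exceptional event or \<open>\<delta>\<close> to be reached by \<open>S1\<close> or
  \<open>S2\<close>, and the latter is controlled by Chebyshev's inequality.\<close>

lemma prob_deviation_le:
  assumes "K * (c1 * e) \<le> \<delta>" "0 < \<delta>"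
  shows "prob {\<omega> \<in> space M. 3 * \<delta> < \<bar>X t \<omega> * Z t \<omega> - x\<bar>} \<le>
    prob (space M - bounded_event K) + prob (space M - modulus_event e N) + prob (bad_event e N L)
    + 2 * (K\<^sup>2 * K\<^sup>2) * L2_rate eta2 eta1 (N * L) / \<delta>\<^sup>2 + 2 * b_rate * L2_rate zeta2 zeta1 (N * L) / \<delta>\<^sup>2"
proof -
  define E1 where "E1 = space M - bounded_event K"
  define E2 where "E2 = space M - modulus_event e N"
  define E4 where "E4 = {\<omega> \<in> space M. \<delta> \<le> \<bar>S1 \<omega>\<bar>}"
  define E5 where "E5 = {\<omega> \<in> space M. \<delta> \<le> \<bar>S2 \<omega>\<bar>}"
  note [measurable] = S_measurable
  have ev: "E1 \<in> events" "E2 \<in> events" "bad_event e N L \<in> events" "E4 \<in> events" "E5 \<in> events"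
    unfolding E1_def E2_def E4_def E5_def
    using bounded_event_sets modulus_event_sets bad_event_sets by auto
  have "AE \<omega> in M. \<forall>j\<in>{..N}. X (real j * (t / real N)) \<omega> = x + integral {0..real j * (t / real N)} (\<lambda>u. \<mu> * X u \<omega>)
         + J (real j * (t / real N)) \<omega>"
    by (intro AE_finite_allI J(2)) (use t in auto)
  then have "AE \<omega> in M. \<omega> \<in> {\<omega> \<in> space M. 3 * \<delta> < \<bar>X t \<omega> * Z t \<omega> - x\<bar>} \<longrightarrow> \<omega> \<in> E1 \<union> E2 \<union> bad_event e N L \<union> E4 \<union> E5"
    using X_continuous X_0 W_0
  proof eventually_elim
    case (elim \<omega>)
    show ?case
    proof (rule impI, rule ccontr)
      assume a: "\<omega> \<in> {\<omega> \<in> space M. 3 * \<delta> < \<bar>X t \<omega> * Z t \<omega> - x\<bar>}" "\<omega> \<notin> E1 \<union> E2 \<union> bad_event e N L \<union> E4 \<union> E5"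
      then have "\<bar>X t \<omega> * Z t \<omega> - x\<bar> \<le> K * (c1 * e) + \<bar>S1 \<omega>\<bar> + \<bar>S2 \<omega>\<bar>"
        using elim by (intro good_event) (auto simp: E1_def E2_def)
      then show False using a assms(1) by (auto simp: E4_def E5_def)
    qed
  qed
  then have "prob {\<omega> \<in> space M. 3 * \<delta> < \<bar>X t \<omega> * Z t \<omega> - x\<bar>} \<le> prob (E1 \<union> E2 \<union> bad_event e N L \<union> E4 \<union> E5)"
    by (rule finite_measure_mono_AE) (use ev in auto)
  also have "\<dots> \<le> prob E1 + prob E2 + prob (bad_event e N L) + prob E4 + prob E5"
    by (intro order_trans[OF measure_Un_le] add_mono order_refl) (use ev in auto)
  also have "prob E4 \<le> 2 * (K\<^sup>2 * K\<^sup>2) * L2_rate eta2 eta1 (N * L) / \<delta>\<^sup>2"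
    unfolding E4_def by (rule prob_ge_le_L2[OF S_measurable(1) S1_L2 assms(2)])
  also have "prob E5 \<le> 2 * b_rate * L2_rate zeta2 zeta1 (N * L) / \<delta>\<^sup>2"
    unfolding E5_def by (rule prob_ge_le_L2[OF S_measurable(2) S2_L2 assms(2)])
  finally show ?thesis unfolding E1_def E2_def by simp
qed

end

section \<open>Removal of the grids and the explicit solution\<close>

context gbm_at_time
begin

text \<open>The probability does not depend on \<open>L\<close>, \<open>N\<close>, \<open>e\<close>
  and \<open>K\<close>, so the bound may be sent to its limit in these parameters one after the
  other. The order is forced: the bad event vanishes only for fixed \<open>N\<close>, the modulus
  event only for fixed \<open>e\<close>, and \<open>e\<close> has to be small relative to
  \<open>K\<close>.\<close>

lemma prob_deviation_eq_0:
  assumes "0 < \<delta>"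
  shows "prob {\<omega> \<in> space M. 3 * \<delta> < \<bar>X t \<omega> * Z t \<omega> - x\<bar>} = 0" (is "?v = 0")
proof -
  let ?B = "\<lambda>K. prob (space M - bounded_event K)" and ?D = "\<lambda>e N. prob (space M - modulus_event e N)"
  define c where "c = 1 + \<bar>\<mu>\<bar> * t"
  let ?R = "\<lambda>K e y. 2 * (K\<^sup>2 * (3 * e\<^sup>2 + 3 * (c * e)\<^sup>2 + 3 * y))"
  have c: "0 < c" using t by (simp add: c_def add_pos_nonneg)
  obtain Cz where Cz: "L2_rate zeta2 zeta1 \<longlonglongrightarrow> Cz" using L2_rate_zeta by blast
  \<comment> \<open>\<open>Y_rate\<close> with \<open>real L * h\<close> replaced by
    \<open>t / real N\<close>, so that the dependence on \<open>L\<close> and \<open>N\<close> is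
    visible outside the grid locale.\<close>
  define Yr where "Yr K N L = 2 * K\<^sup>2 * (\<mu>\<^sup>2 * (t / real N) * (t / (real N * real L)) + \<sigma>\<^sup>2 * (t / real N) + (\<mu> * (t / real N))\<^sup>2)"
    for K :: real and N L :: nat
  have ineq: "?v \<le> ?B K + ?D e N + prob (bad_event e N L)
    + 2 * (K\<^sup>2 * K\<^sup>2) * L2_rate eta2 eta1 (N * L) / \<delta>\<^sup>2
    + ?R K e (Yr K N L) * L2_rate zeta2 zeta1 (N * L) / \<delta>\<^sup>2"
    if "0 < N" "0 < L" "0 < K" "0 < e" "K * (c * e) \<le> \<delta>" for K e and N L :: nat
  proof -
    interpret gbm_grid M Filt W \<mu> \<sigma> x t X N L K e by unfold_locales (use that in auto)
    have "real L * ((\<mu> * h)\<^sup>2 + \<sigma>\<^sup>2 * h) + (real L * (\<mu> * h))\<^sup>2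
      = \<mu>\<^sup>2 * (real L * h) * h + \<sigma>\<^sup>2 * (real L * h) + (\<mu> * (real L * h))\<^sup>2"
      by (simp add: power2_eq_square algebra_simps)
    then have "Y_rate = Yr K N L" unfolding Y_rate_def Yr_def h(3) by (simp add: h_def)
    then show ?thesis
      using prob_deviation_le[OF _ assms] that(5) unfolding b_rate_def c1_def c_def by simp
  qed
  \<comment> \<open>Limit in \<open>L\<close>: the bad event and the \<open>eta\<close> part vanish.
    The zeros are kept so that the bound has the shape that the limit rules produce.\<close>
  have 1: "?v \<le> ?B K + ?D e N + 0 + 2 * (K\<^sup>2 * K\<^sup>2) * 0 / \<delta>\<^sup>2
    + ?R K e (2 * K\<^sup>2 * (\<mu>\<^sup>2 * (t / real N) * 0 + \<sigma>\<^sup>2 * (t / real N) + (\<mu> * (t / real N))\<^sup>2)) * Cz / \<delta>\<^sup>2"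
    if a: "0 < N" "0 < K" "0 < e" "K * (c * e) \<le> \<delta>" for K e and N :: nat
  proof (rule tendsto_lowerbound)
    have NL: "filterlim (\<lambda>L. N * L) at_top sequentially"
      using a(1) by (intro filterlim_at_top_mono[OF filterlim_ident]) auto
    have "(\<lambda>L. (t / real N) / real L) \<longlonglongrightarrow> 0" by (rule lim_const_over_n)
    then have T: "(\<lambda>L. t / (real N * real L)) \<longlonglongrightarrow> 0" by simp
    show "(\<lambda>L. ?B K + ?D e N + prob (bad_event e N L)
    + 2 * (K\<^sup>2 * K\<^sup>2) * L2_rate eta2 eta1 (N * L) / \<delta>\<^sup>2
    + ?R K e (Yr K N L) * L2_rate zeta2 zeta1 (N * L) / \<delta>\<^sup>2) \<longlonglongrightarrow>
      ?B K + ?D e N + 0 + 2 * (K\<^sup>2 * K\<^sup>2) * 0 / \<delta>\<^sup>2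
    + ?R K e (2 * K\<^sup>2 * (\<mu>\<^sup>2 * (t / real N) * 0 + \<sigma>\<^sup>2 * (t / real N) + (\<mu> * (t / real N))\<^sup>2)) * Cz / \<delta>\<^sup>2"
      unfolding Yr_def
      by (intro tendsto_add tendsto_mult tendsto_divide tendsto_const prob_bad_event a(1,3) T
          filterlim_compose[OF L2_rate_eta NL] filterlim_compose[OF Cz NL]) (use assms in auto)
    show "\<forall>\<^sub>F L in sequentially. ?v \<le> ?B K + ?D e N + prob (bad_event e N L)
    + 2 * (K\<^sup>2 * K\<^sup>2) * L2_rate eta2 eta1 (N * L) / \<delta>\<^sup>2
    + ?R K e (Yr K N L) * L2_rate zeta2 zeta1 (N * L) / \<delta>\<^sup>2"
      using eventually_gt_at_top[of 0] by eventually_elim (rule ineq[OF a(1) _ a(2-4)])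
  qed simp
  \<comment> \<open>Limit in \<open>N\<close>: the modulus event and the movement of
    \<open>Y\<close> within a coarse cell vanish.\<close>
  have 2: "?v \<le> ?B K + 0 + 0 + 2 * (K\<^sup>2 * K\<^sup>2) * 0 / \<delta>\<^sup>2
    + ?R K e (2 * K\<^sup>2 * (\<mu>\<^sup>2 * 0 * 0 + \<sigma>\<^sup>2 * 0 + (\<mu> * 0)\<^sup>2)) * Cz / \<delta>\<^sup>2"
    if a: "0 < K" "0 < e" "K * (c * e) \<le> \<delta>" for K e
  proof (rule tendsto_lowerbound)
    have T: "(\<lambda>N. t / real (Suc N)) \<longlonglongrightarrow> 0" using lim_const_over_n[of t] LIMSEQ_Suc by blast
    show "(\<lambda>N. ?B K + ?D e (Suc N) + 0 + 2 * (K\<^sup>2 * K\<^sup>2) * 0 / \<delta>\<^sup>2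
    + ?R K e (2 * K\<^sup>2 * (\<mu>\<^sup>2 * (t / real (Suc N)) * 0 + \<sigma>\<^sup>2 * (t / real (Suc N)) + (\<mu> * (t / real (Suc N)))\<^sup>2)) * Cz / \<delta>\<^sup>2)
      \<longlonglongrightarrow> ?B K + 0 + 0 + 2 * (K\<^sup>2 * K\<^sup>2) * 0 / \<delta>\<^sup>2
    + ?R K e (2 * K\<^sup>2 * (\<mu>\<^sup>2 * 0 * 0 + \<sigma>\<^sup>2 * 0 + (\<mu> * 0)\<^sup>2)) * Cz / \<delta>\<^sup>2"
      by (intro tendsto_add tendsto_mult tendsto_divide tendsto_power tendsto_const prob_modulus_event a(2) T) (use assms in auto)
  qed (rule always_eventually, rule allI, rule 1[OF zero_less_Suc a], simp)
  \<comment> \<open>Limit in \<open>e\<close> along \<open>1 / real (Suc j)\<close>, which satisfies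
    \<open>K * (c * e) \<le> \<delta>\<close> from some \<open>j\<close> on; only the truncation
    event remains.\<close>
  have 3: "?v \<le> ?B K" if K: "0 < K" for K
  proof (rule tendsto_lowerbound)
    have T: "(\<lambda>j. 1 / real (Suc j)) \<longlonglongrightarrow> 0" using lim_const_over_n[of 1] LIMSEQ_Suc by blast
    have "(\<lambda>j. ?B K + 2 * (K\<^sup>2 * (3 * (1 / real (Suc j))\<^sup>2 + 3 * (c * (1 / real (Suc j)))\<^sup>2)) * Cz / \<delta>\<^sup>2)
      \<longlonglongrightarrow> ?B K + 2 * (K\<^sup>2 * (3 * 0\<^sup>2 + 3 * (c * 0)\<^sup>2)) * Cz / \<delta>\<^sup>2"
      by (intro tendsto_add tendsto_mult tendsto_divide tendsto_power tendsto_const T) (use assms in auto)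
    then show "(\<lambda>j. ?B K + 2 * (K\<^sup>2 * (3 * (1 / real (Suc j))\<^sup>2 + 3 * (c * (1 / real (Suc j)))\<^sup>2)) * Cz / \<delta>\<^sup>2)
      \<longlonglongrightarrow> ?B K" by simp
    have "(\<lambda>j. K * (c * (1 / real (Suc j)))) \<longlonglongrightarrow> K * (c * 0)"
      by (intro tendsto_mult tendsto_const T)
    then have "\<forall>\<^sub>F j in sequentially. K * (c * (1 / real (Suc j))) < \<delta>"
      by (rule order_tendstoD) (use assms in simp)
    then show "\<forall>\<^sub>F j in sequentially. ?v \<le> ?B K + 2 * (K\<^sup>2 * (3 * (1 / real (Suc j))\<^sup>2 + 3 * (c * (1 / real (Suc j)))\<^sup>2)) * Cz / \<delta>\<^sup>2"
    proof eventually_elim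
      case (elim j)
      have "0 < 1 / real (Suc j)" by simp
      from 2[OF K this less_imp_le[OF elim]] show ?case by simp
    qed
  qed simp
  have "\<forall>\<^sub>F K in sequentially. ?v \<le> prob (space M - bounded_event (real K))"
    using eventually_gt_at_top[of 0] by eventually_elim (simp add: 3)
  then have "?v \<le> 0"
    by (rule tendsto_lowerbound[OF prob_bounded_event]) simp
  then show ?thesis using measure_nonneg[of M] by (metis order_antisym)
qed

theorem gbm_explicit_at_time: "AE \<omega> in M. X t \<omega> = x * exp (\<sigma> * W t \<omega> + (\<mu> - \<sigma>\<^sup>2 / 2) * t)"
proof -
  have [measurable]: "X t \<in> borel_measurable M" "Z t \<in> borel_measurable M"
    using X_measurable Z_measurable t by auto
  have "AE \<omega> in M. \<forall>k. \<not> 3 * (1 / real (Suc k)) < \<bar>X t \<omega> * Z t \<omega> - x\<bar>"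
    unfolding AE_all_countable
  proof
    fix k
    have "prob {\<omega> \<in> space M. 3 * (1 / real (Suc k)) < \<bar>X t \<omega> * Z t \<omega> - x\<bar>} = 0"
      by (rule prob_deviation_eq_0) simp
    then show "AE \<omega> in M. \<not> 3 * (1 / real (Suc k)) < \<bar>X t \<omega> * Z t \<omega> - x\<bar>"
      by (subst AE_iff_measurable[OF _ refl]) (auto simp: emeasure_eq_measure)
  qed
  then show ?thesis
  proof eventually_elim
    case (elim \<omega>)
    have "(\<lambda>k. 3 * (1 / real (Suc k))) \<longlonglongrightarrow> 3 * 0"
      using lim_const_over_n[of 1] LIMSEQ_Suc by (intro tendsto_mult tendsto_const) blast
    then have "\<bar>X t \<omega> * Z t \<omega> - x\<bar> \<le> 3 * 0"
      by (rule tendsto_lowerbound) (use elim in \<open>auto simp: not_less\<close>)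
    then have "X t \<omega> * Z t \<omega> = x" by simp
    moreover have "Z t \<omega> * exp (\<sigma> * W t \<omega> + (\<mu> - \<sigma>\<^sup>2 / 2) * t) = 1"
      unfolding Z_def \<kappa>_def exp_add[symmetric] by (simp add: algebra_simps)
    ultimately show ?case by (metis mult.assoc mult.right_neutral)
  qed
qed

end

section \<open>Stopping\<close>

text \<open>Needed because paths are continuous only almost surely: values at random times agree
  with limits of measurable functions only up to a null set.\<close>

lemma (in complete_measure) borel_measurable_AE_eq:
  fixes f g :: "'a \<Rightarrow> 'b::topological_space"
  assumes "f \<in> borel_measurable M" "AE \<omega> in M. g \<omega> = f \<omega>"
  shows "g \<in> borel_measurable M"
proof (rule measurableI)
  fix S :: "'b set" assume "S \<in> sets borel"
  then have "f -` S \<inter> space M \<in> sets M" by (rule measurable_sets[OF assms(1)])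
  moreover have "AE \<omega> in M. \<omega> \<in> f -` S \<inter> space M \<longleftrightarrow> \<omega> \<in> g -` S \<inter> space M"
    using assms(2) by eventually_elim simp
  ultimately show "g -` S \<inter> space M \<in> sets M"
    using in_sets_AE[of "f -` S \<inter> space M" "g -` S \<inter> space M"] by simp
qed simp

text \<open>Times are approximated from above, because rounding up preserves the stopping time
  property.\<close>

lemma nat_ceiling_scaled_tendsto:
  fixes y :: real
  assumes "0 \<le> y"
  shows "(\<lambda>j. real (nat \<lceil>real (Suc j) * y\<rceil>) / real (Suc j)) \<longlonglongrightarrow> y"
    and "y \<le> real (nat \<lceil>real (Suc j) * y\<rceil>) / real (Suc j)"
    and "real (nat \<lceil>real (Suc j) * y\<rceil>) / real (Suc j) \<le> y + 1 / real (Suc j)"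
proof -
  have pos: "0 \<le> real (Suc j) * y" for j using assms by simp
  have *: "real (Suc j) * y \<le> real (nat \<lceil>real (Suc j) * y\<rceil>)"
    "real (nat \<lceil>real (Suc j) * y\<rceil>) \<le> real (Suc j) * y + 1" for j
  proof -
    have "z \<le> real (nat \<lceil>z\<rceil>) \<and> real (nat \<lceil>z\<rceil>) \<le> z + 1" if "0 \<le> z" for z :: real
      using that of_int_ceiling_le_add_one[of z] by (simp add: real_nat_ceiling_ge)
    from this[OF pos[of j]] show "real (Suc j) * y \<le> real (nat \<lceil>real (Suc j) * y\<rceil>)"
      "real (nat \<lceil>real (Suc j) * y\<rceil>) \<le> real (Suc j) * y + 1" by blast+
  qed
  have b: "y \<le> real (nat \<lceil>real (Suc j) * y\<rceil>) / real (Suc j)"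
    "real (nat \<lceil>real (Suc j) * y\<rceil>) / real (Suc j) \<le> y + 1 / real (Suc j)" for j
  proof -
    have "(real (Suc j) * y + 1) / real (Suc j) = y + 1 / real (Suc j)"
      by (simp add: add_divide_distrib del: of_nat_Suc)
    moreover have "real (nat \<lceil>real (Suc j) * y\<rceil>) / real (Suc j) \<le> (real (Suc j) * y + 1) / real (Suc j)"
      by (intro divide_right_mono *(2)) simp
    ultimately show "real (nat \<lceil>real (Suc j) * y\<rceil>) / real (Suc j) \<le> y + 1 / real (Suc j)" by simp
    show "y \<le> real (nat \<lceil>real (Suc j) * y\<rceil>) / real (Suc j)"
      using *(1)[of j] by (simp add: le_divide_eq mult.commute del: of_nat_Suc)
  qed
  then show "y \<le> real (nat \<lceil>real (Suc j) * y\<rceil>) / real (Suc j)"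
    "real (nat \<lceil>real (Suc j) * y\<rceil>) / real (Suc j) \<le> y + 1 / real (Suc j)" by auto
  have "(\<lambda>j. y + 1 / real (Suc j)) \<longlonglongrightarrow> y + 0"
    using lim_const_over_n[of 1] LIMSEQ_Suc by (intro tendsto_add tendsto_const) blast
  then have up: "(\<lambda>j. y + 1 / real (Suc j)) \<longlonglongrightarrow> y" unfolding add_0_right .
  show "(\<lambda>j. real (nat \<lceil>real (Suc j) * y\<rceil>) / real (Suc j)) \<longlonglongrightarrow> y"
    by (rule tendsto_sandwich[OF always_eventually[OF allI] always_eventually[OF allI] tendsto_const up])
       (rule b(1), rule b(2))
qed

text \<open>By \<open>y - y\<^sup>2 / R \<le> min y R\<close>, truncation at \<open>R\<close> costs
  at most \<open>C / R\<close> in expectation, uniformly in \<open>j\<close>. Dominated convergence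
  carries the truncated bounds over to \<open>g\<close>, and monotone convergence removes the
  truncation.\<close>

lemma (in prob_space) has_bochner_integral_L2_bounded_limit:
  fixes f :: "nat \<Rightarrow> 'a \<Rightarrow> real"
  assumes f: "\<And>j. has_bochner_integral M (f j) c" and pos: "\<And>j \<omega>. 0 \<le> f j \<omega>"
    and sq: "\<And>j. integrable M (\<lambda>\<omega>. (f j \<omega>)\<^sup>2)" and B: "\<And>j. (\<integral>\<omega>. (f j \<omega>)\<^sup>2 \<partial>M) \<le> C"
    and lim: "AE \<omega> in M. (\<lambda>j. f j \<omega>) \<longlonglongrightarrow> g \<omega>" and g: "g \<in> borel_measurable M"
  shows "has_bochner_integral M g c"
proof -
  have fi: "integrable M (f j)" "(\<integral>\<omega>. f j \<omega> \<partial>M) = c" for j using f[of j] by (auto simp: has_bochner_integral_iff)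
  have [measurable]: "f j \<in> borel_measurable M" for j using fi(1) by auto
  note [measurable] = g
  have gpos: "AE \<omega> in M. 0 \<le> g \<omega>"
    using lim by eventually_elim (rule LIMSEQ_le_const, use pos in auto)
  have min_int: "integrable M (\<lambda>\<omega>. min (f j \<omega>) R)" if "0 < R" for j R
    by (rule integrable_const_bound[where B = R]) (use pos that in \<open>auto simp: abs_le_iff min_def intro: order_trans\<close>)
  have gmin_int: "integrable M (\<lambda>\<omega>. min (g \<omega>) R)" if "0 < R" for R
    by (rule integrable_const_bound[where B = R]) (use gpos that in \<open>auto simp: abs_le_iff min_def elim!: eventually_mono\<close>)
  have conv: "(\<lambda>j. \<integral>\<omega>. min (f j \<omega>) R \<partial>M) \<longlonglongrightarrow> (\<integral>\<omega>. min (g \<omega>) R \<partial>M)" if "0 < R" for R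
  proof (rule integral_dominated_convergence[where w = "\<lambda>_. R"])
    show "AE \<omega> in M. (\<lambda>j. min (f j \<omega>) R) \<longlonglongrightarrow> min (g \<omega>) R"
      using lim by eventually_elim (intro tendsto_min tendsto_const)
    show "AE \<omega> in M. norm (min (f j \<omega>) R) \<le> R" for j
      using pos[of j] that by (auto simp: abs_le_iff min_def intro: order_trans)
  qed auto
  have trunc: "c - C / R \<le> (\<integral>\<omega>. min (f j \<omega>) R \<partial>M)" if R: "0 < R" for j R
  proof -
    have le: "y - y\<^sup>2 / R \<le> min y R" if "0 \<le> y" for y
    proof (cases "y \<le> R")
      case False
      have "y * R \<le> y * y" using that False R by (intro mult_left_mono) auto
      then have "y \<le> y\<^sup>2 / R" using R by (simp add: le_divide_eq power2_eq_square)
      then show ?thesis using False R by simp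
    qed (use R in simp)
    have "c - C / R \<le> c - (\<integral>\<omega>. (f j \<omega>)\<^sup>2 \<partial>M) / R"
      using B[of j] R by (simp add: divide_right_mono)
    also have "\<dots> = (\<integral>\<omega>. f j \<omega> - (f j \<omega>)\<^sup>2 / R \<partial>M)" using fi sq by simp
    also have "\<dots> \<le> (\<integral>\<omega>. min (f j \<omega>) R \<partial>M)"
      by (intro integral_mono min_int R) (use fi sq le pos in auto)
    finally show ?thesis .
  qed
  have lower: "c - C / R \<le> (\<integral>\<omega>. min (g \<omega>) R \<partial>M)" if "0 < R" for R
    by (rule LIMSEQ_le_const[OF conv[OF that]]) (use trunc[OF that] in auto)
  have upper: "(\<integral>\<omega>. min (g \<omega>) R \<partial>M) \<le> c" if "0 < R" for R
  proof (rule LIMSEQ_le_const2[OF conv[OF that]])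
    have "(\<integral>\<omega>. min (f j \<omega>) R \<partial>M) \<le> (\<integral>\<omega>. f j \<omega> \<partial>M)" for j
      by (intro integral_mono min_int that fi) auto
    then show "\<exists>N. \<forall>j\<ge>N. (\<integral>\<omega>. min (f j \<omega>) R \<partial>M) \<le> c" using fi by auto
  qed
  have ilim: "(\<lambda>k. \<integral>\<omega>. min (g \<omega>) (real (Suc k)) \<partial>M) \<longlonglongrightarrow> c"
  proof (rule tendsto_sandwich[OF _ _ _ tendsto_const])
    have "(\<lambda>k. c - C / real (Suc k)) \<longlonglongrightarrow> c - 0"
      using lim_const_over_n[of C] LIMSEQ_Suc by (intro tendsto_diff tendsto_const) blast
    then show "(\<lambda>k. c - C / real (Suc k)) \<longlonglongrightarrow> c" by simp
  qed (use lower upper in \<open>auto simp del: of_nat_Suc\<close>)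
  have "AE \<omega> in M. (\<lambda>k. min (g \<omega>) (real (Suc k))) \<longlonglongrightarrow> g \<omega>"
  proof (intro AE_I2)
    fix \<omega>
    obtain K where K: "g \<omega> \<le> real K" using real_arch_simple by blast
    have "\<forall>\<^sub>F k in sequentially. min (g \<omega>) (real (Suc k)) = g \<omega>"
      using eventually_ge_at_top[of K] by eventually_elim (use K in auto)
    then show "(\<lambda>k. min (g \<omega>) (real (Suc k))) \<longlonglongrightarrow> g \<omega>" by (rule tendsto_eventually)
  qed
  note mc = integral_monotone_convergence_nonneg[of M "\<lambda>k \<omega>. min (g \<omega>) (real (Suc k))" g c, OF _ _ _ this ilim g]
  have mi: "integrable M (\<lambda>\<omega>. min (g \<omega>) (real (Suc i)))" for i by (rule gmin_int) simp
  have mono: "AE \<omega> in M. mono (\<lambda>k. min (g \<omega>) (real (Suc k)))"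
    by (intro AE_I2 monoI min.mono) auto
  have mp: "AE \<omega> in M. 0 \<le> min (g \<omega>) (real (Suc i))" for i
    using gpos by eventually_elim simp
  from mc[OF mi mono mp] have "integrable M g \<and> (\<integral>\<omega>. g \<omega> \<partial>M) = c" by blast
  then show ?thesis by (simp add: has_bochner_integral_iff)
qed

context filtered_brownian_motion
begin

text \<open>The fixed-time formula gives one null set per time; taking rational times only leaves
  countably many of them, and continuity of both sides covers the rest.\<close>

lemma gbm_explicit:
  assumes "geometric_brownian_motion M Filt W \<mu> \<sigma> x X"
  shows "AE \<omega> in M. \<forall>u\<ge>0. X u \<omega> = x * exp (\<sigma> * W u \<omega> + (\<mu> - \<sigma>\<^sup>2 / 2) * u)"
proof -
  define Y where "Y u \<omega> = X u \<omega> - x * exp (\<sigma> * W u \<omega> + (\<mu> - \<sigma>\<^sup>2 / 2) * u)" for u \<omega>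
  have X0: "AE \<omega> in M. X 0 \<omega> = x" and Xc: "AE \<omega> in M. continuous_on {0..} (\<lambda>t. X t \<omega>)"
    using assms by (auto simp: geometric_brownian_motion_def adapted_continuous_def)
  have "AE \<omega> in M. Y q \<omega> = 0" if "q \<in> \<rat> \<inter> {0..}" for q
  proof (cases "q = 0")
    case True
    show ?thesis using X0 W_0 by eventually_elim (simp add: Y_def True)
  next
    case False
    then interpret gbm_at_time M Filt W \<mu> \<sigma> x q X
      by unfold_locales (use that assms in auto)
    show ?thesis using gbm_explicit_at_time by eventually_elim (simp add: Y_def)
  qed
  moreover have "countable (\<rat> \<inter> {0..} :: real set)"
    by (rule countable_subset[OF _ countable_rat]) auto
  ultimately have "AE \<omega> in M. \<forall>q\<in>\<rat> \<inter> {0..}. Y q \<omega> = 0"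
    by (subst AE_ball_countable) auto
  then show ?thesis
    using Xc W_continuous
  proof eventually_elim
    case (elim \<omega>)
    show ?case
    proof (intro allI impI)
      fix u :: real assume u: "0 \<le> u"
      have "continuous_on {0..u + 1} (\<lambda>u. Y u \<omega>)"
        unfolding Y_def
        by (intro continuous_intros continuous_on_subset[OF elim(2)] continuous_on_subset[OF elim(3)]) auto
      from closed_rational_multiples[OF this _ zero_less_one closed_singleton[of 0], of u]
      have "Y u \<omega> \<in> {0}" using elim(1) u by auto
      then show "X u \<omega> = x * exp (\<sigma> * W u \<omega> + (\<mu> - \<sigma>\<^sup>2 / 2) * u)" by (simp add: Y_def)
    qed
  qed
qed

lemma stopping_time_measurable:
  assumes "stopping_time Filt \<tau>" "\<And>\<omega>. \<omega> \<in> space M \<Longrightarrow> 0 \<le> \<tau> \<omega>"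
  shows "\<tau> \<in> borel_measurable M"
proof (rule borel_measurableI_le)
  fix y
  show "{\<omega> \<in> space M. \<tau> \<omega> \<le> y} \<in> sets M"
  proof (cases "0 \<le> y")
    case True
    then show ?thesis
      using stopping_timeD[OF assms(1), of y] subalgebra_Filt[OF True]
      by (auto simp: pred_def space_Filt subalgebra_def)
  next
    case False
    then have "{\<omega> \<in> space M. \<tau> \<omega> \<le> y} = {}" using assms(2) by force
    then show ?thesis by (simp only: sets.empty_sets)
  qed
qed

text \<open>The rounded times take countably many values, so the process at these times is
  measurable; continuity of the paths gives convergence outside a null set.\<close>

lemma borel_measurable_at_random_time:
  fixes V :: "real \<Rightarrow> 'a \<Rightarrow> real"
  assumes V: "\<And>u. 0 \<le> u \<Longrightarrow> V u \<in> borel_measurable M" and cont: "AE \<omega> in M. continuous_on {0..} (\<lambda>u. V u \<omega>)"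
    and \<tau>: "\<tau> \<in> borel_measurable M" "\<And>\<omega>. \<omega> \<in> space M \<Longrightarrow> 0 \<le> \<tau> \<omega>"
  shows "(\<lambda>\<omega>. V (\<tau> \<omega>) \<omega>) \<in> borel_measurable M"
proof -
  define k where "k j \<omega> = nat \<lceil>real (Suc j) * \<tau> \<omega>\<rceil>" for j \<omega>
  note [measurable] = \<tau>(1)
  have [measurable]: "k j \<in> measurable M (count_space UNIV)" for j unfolding k_def by measurable
  have "(\<lambda>\<omega>. V (real (k j \<omega>) / real (Suc j)) \<omega>) \<in> borel_measurable M" for j
    by (rule measurable_compose_countable[where f = "\<lambda>i. V (real i / real (Suc j))"]) (auto intro: V)
  then have "(\<lambda>\<omega>. lim (\<lambda>j. V (real (k j \<omega>) / real (Suc j)) \<omega>)) \<in> borel_measurable M"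
    by (rule borel_measurable_lim_metric)
  moreover have "AE \<omega> in M. V (\<tau> \<omega>) \<omega> = lim (\<lambda>j. V (real (k j \<omega>) / real (Suc j)) \<omega>)"
    using cont AE_space
  proof eventually_elim
    case (elim \<omega>)
    have t0: "0 \<le> \<tau> \<omega>" using \<tau>(2)[OF elim(2)] .
    have "(\<lambda>j. V (real (k j \<omega>) / real (Suc j)) \<omega>) \<longlonglongrightarrow> V (\<tau> \<omega>) \<omega>"
      unfolding k_def
      by (rule continuous_on_tendsto_compose[OF elim(1) nat_ceiling_scaled_tendsto(1)[OF t0]])
         (use t0 in simp, rule always_eventually, simp)
    then show ?case by (simp add: limI)
  qed
  ultimately show ?thesis by (rule complete_measure.borel_measurable_AE_eq[OF complete])
qed

section \<open>Exponential martingales at bounded stopping times\<close>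

definition exp_mart :: "real \<Rightarrow> real \<Rightarrow> 'a \<Rightarrow> real" where
  "exp_mart \<theta> u \<omega> = exp (\<theta> * W u \<omega> - \<theta>\<^sup>2 * u / 2)"

lemma exp_mart_measurable_Filt: "0 \<le> u \<Longrightarrow> exp_mart \<theta> u \<in> borel_measurable (Filt u)"
  unfolding exp_mart_def using W_measurable_Filt[of u] by measurable

lemma exp_mart_measurable: "0 \<le> u \<Longrightarrow> exp_mart \<theta> u \<in> borel_measurable M"
  using exp_mart_measurable_Filt measurable_Filt_M by blast

lemma exp_mart_continuous: "AE \<omega> in M. continuous_on {0..} (\<lambda>u. exp_mart \<theta> u \<omega>)"
  using W_continuous by eventually_elim (unfold exp_mart_def, intro continuous_intros, auto)

text \<open>The martingale property tested against a function known at time \<open>u\<close>, in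
  place of a conditional expectation. Later \<open>f\<close> is the indicator that a stopping time
  takes a given value.\<close>

lemma exp_mart_step:
  assumes "0 \<le> u" "u \<le> v" "f \<in> borel_measurable (Filt u)"
    and "has_bochner_integral M (\<lambda>\<omega>. f \<omega> * exp_mart \<theta> u \<omega>) c"
  shows "has_bochner_integral M (\<lambda>\<omega>. f \<omega> * exp_mart \<theta> v \<omega>) c"
proof (cases "u = v")
  case False
  then have uv: "u < v" using assms by simp
  define g where "g z = exp (\<theta> * z - \<theta>\<^sup>2 * (v - u) / 2)" for z
  have [measurable]: "g \<in> borel_measurable borel" unfolding g_def by measurable
  have "has_bochner_integral M (\<lambda>\<omega>. exp (- (\<theta>\<^sup>2 * (v - u) / 2)) * exp (\<theta> * (W v \<omega> - W u \<omega>)))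
      (exp (- (\<theta>\<^sup>2 * (v - u) / 2)) * exp (\<theta>\<^sup>2 * (v - u) / 2))"
    using has_bochner_integral_mult_right[OF increment_moment[OF assms(1) uv, of 1 0 0 \<theta>], of "exp (- (\<theta>\<^sup>2 * (v - u) / 2))"] by simp
  then have g: "has_bochner_integral M (\<lambda>\<omega>. g (W v \<omega> - W u \<omega>)) 1"
    unfolding g_def exp_add[symmetric] by (simp add: algebra_simps)
  have fm: "(\<lambda>\<omega>. f \<omega> * exp_mart \<theta> u \<omega>) \<in> borel_measurable (Filt u)"
    using assms(3) exp_mart_measurable_Filt[OF assms(1)] by (rule borel_measurable_times)
  have e: "f \<omega> * exp_mart \<theta> v \<omega> = f \<omega> * exp_mart \<theta> u \<omega> * g (W v \<omega> - W u \<omega>)" for \<omega>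
    unfolding exp_mart_def g_def mult.assoc exp_add[symmetric] by (simp add: field_simps)
  show ?thesis
    using integrable_mult_increment[OF assms(1) uv fm, of g] integral_mult_increment[OF assms(1) uv fm, of g] g assms(4)
    unfolding e has_bochner_integral_iff by simp
qed (use assms in simp)

lemma exp_mart_integral:
  assumes "0 \<le> u"
  shows "has_bochner_integral M (exp_mart \<theta> u) 1"
proof -
  have "has_bochner_integral M (\<lambda>\<omega>. 1 * exp_mart \<theta> 0 \<omega>) 1"
  proof (rule has_bochner_integralI_AE)
    show "has_bochner_integral M (\<lambda>\<omega>. 1) (1::real)" by (simp add: has_bochner_integral_iff prob_space)
    show "(\<lambda>\<omega>. 1 * exp_mart \<theta> 0 \<omega>) \<in> borel_measurable M" using exp_mart_measurable[of 0] by simp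
    show "AE \<omega> in M. 1 = 1 * exp_mart \<theta> 0 \<omega>" using W_0 by eventually_elim (simp add: exp_mart_def)
  qed
  from exp_mart_step[OF order_refl assms _ this] show ?thesis by simp
qed

text \<open>The expectation is split according to the value of \<open>k\<close>. On each part
  \<open>exp_mart_step\<close> moves the time forward to \<open>real K * h\<close>, after which the
  parts recombine to the expectation at a fixed time.\<close>

lemma exp_mart_discrete_stopping:
  fixes k :: "'a \<Rightarrow> nat"
  assumes "0 < h" and k: "\<And>i. Measurable.pred (Filt (real i * h)) (\<lambda>\<omega>. k \<omega> \<le> i)"
    and K: "\<And>\<omega>. \<omega> \<in> space M \<Longrightarrow> k \<omega> \<le> K"
  shows "has_bochner_integral M (\<lambda>\<omega>. exp_mart \<theta> (real (k \<omega>) * h) \<omega>) 1"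
proof -
  have pos: "0 \<le> real i * h" for i using assms(1) by simp
  define I where "I i \<omega> = (if k \<omega> = i then 1 else 0 :: real)" for i \<omega>
  have Im: "I i \<in> borel_measurable (Filt (real i * h))" for i
  proof -
    \<comment> \<open>The guard \<open>i \<noteq> 0\<close> is due to truncated subtraction: for
      \<open>i = 0\<close> the second clause must be void.\<close>
    have "Measurable.pred (Filt (real i * h)) (\<lambda>\<omega>. k \<omega> \<le> i \<and> \<not> (i \<noteq> 0 \<and> k \<omega> \<le> i - 1))"
    proof (cases i)
      case (Suc i')
      have "real i' * h \<le> real i * h" using assms(1) Suc by simp
      from Filt_mono[OF this] have "Measurable.pred (Filt (real i * h)) (\<lambda>\<omega>. k \<omega> \<le> i')"
        using k[of i'] by (auto simp: pred_def space_Filt)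
      then show ?thesis using k[of i] Suc by (auto intro!: pred_intros_logic)
    qed (use k[of 0] in simp)
    moreover have "(\<lambda>\<omega>. k \<omega> \<le> i \<and> \<not> (i \<noteq> 0 \<and> k \<omega> \<le> i - 1)) = (\<lambda>\<omega>. k \<omega> = i)" by (auto simp: fun_eq_iff)
    ultimately show ?thesis unfolding I_def by simp
  qed
  have ImM: "I i \<in> borel_measurable M" for i using measurable_Filt_M[OF Im pos] .
  have int: "integrable M (\<lambda>\<omega>. I i \<omega> * exp_mart \<theta> (real j * h) \<omega>)" for i j
  proof (rule Bochner_Integration.integrable_bound)
    show "integrable M (exp_mart \<theta> (real j * h))" using exp_mart_integral[OF pos] by (auto simp: has_bochner_integral_iff)
    show "(\<lambda>\<omega>. I i \<omega> * exp_mart \<theta> (real j * h) \<omega>) \<in> borel_measurable M"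
      using ImM exp_mart_measurable[OF pos] by (rule borel_measurable_times)
  qed (simp add: I_def)
  have step: "(\<integral>\<omega>. I i \<omega> * exp_mart \<theta> (real K * h) \<omega> \<partial>M) = (\<integral>\<omega>. I i \<omega> * exp_mart \<theta> (real i * h) \<omega> \<partial>M)" if "i \<le> K" for i
    using exp_mart_step[OF pos _ Im has_bochner_integral_integrable[OF int], where v = "real K * h"] that assms(1)
    by (simp add: has_bochner_integral_iff)
  have sum_eq: "exp_mart \<theta> (real (k \<omega>) * h) \<omega> = (\<Sum>i\<le>K. I i \<omega> * exp_mart \<theta> (real i * h) \<omega>)"
    "exp_mart \<theta> (real K * h) \<omega> = (\<Sum>i\<le>K. I i \<omega> * exp_mart \<theta> (real K * h) \<omega>)" if "\<omega> \<in> space M" for \<omega>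
    using K[OF that] by (simp_all add: I_def if_distrib[of "\<lambda>y. y * _"] cong: if_cong)
  have "has_bochner_integral M (\<lambda>\<omega>. \<Sum>i\<le>K. I i \<omega> * exp_mart \<theta> (real i * h) \<omega>) (\<Sum>i\<le>K. \<integral>\<omega>. I i \<omega> * exp_mart \<theta> (real i * h) \<omega> \<partial>M)"
    by (intro has_bochner_integral_sum has_bochner_integral_integrable int)
  moreover have "(\<Sum>i\<le>K. \<integral>\<omega>. I i \<omega> * exp_mart \<theta> (real i * h) \<omega> \<partial>M) = (\<integral>\<omega>. (\<Sum>i\<le>K. I i \<omega> * exp_mart \<theta> (real K * h) \<omega>) \<partial>M)"
    using int by (simp add: step[symmetric])
  moreover have "\<dots> = (\<integral>\<omega>. exp_mart \<theta> (real K * h) \<omega> \<partial>M)"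
    by (rule Bochner_Integration.integral_cong) (use sum_eq(2) in auto)
  moreover have "\<dots> = 1" using exp_mart_integral[OF pos] by (auto simp: has_bochner_integral_iff)
  ultimately have "has_bochner_integral M (\<lambda>\<omega>. \<Sum>i\<le>K. I i \<omega> * exp_mart \<theta> (real i * h) \<omega>) 1" by simp
  then show ?thesis
    by (subst has_bochner_integral_cong[OF refl sum_eq(1) refl])
qed

text \<open>The square of an exponential martingale is, up to a bounded factor, the exponential
  martingale with the doubled parameter; this gives the bound in \<open>L\<^sup>2\<close> that replaces uniform
  integrability.\<close>

lemma exp_mart_bounded_stopping:
  assumes \<tau>: "stopping_time Filt \<tau>" "\<And>\<omega>. \<omega> \<in> space M \<Longrightarrow> 0 \<le> \<tau> \<omega> \<and> \<tau> \<omega> \<le> C"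
  shows "has_bochner_integral M (\<lambda>\<omega>. exp_mart \<theta> (\<tau> \<omega>) \<omega>) 1"
proof -
  define k where "k j \<omega> = nat \<lceil>real (Suc j) * \<tau> \<omega>\<rceil>" for j \<omega>
  let ?u = "\<lambda>j \<omega>. real (k j \<omega>) / real (Suc j)"
  have disc: "has_bochner_integral M (\<lambda>\<omega>. exp_mart \<theta> (?u j \<omega>) \<omega>) 1" for j \<theta>
  proof -
    have "has_bochner_integral M (\<lambda>\<omega>. exp_mart \<theta> (real (k j \<omega>) * (1 / real (Suc j))) \<omega>) 1"
    proof (rule exp_mart_discrete_stopping)
      show "0 < 1 / real (Suc j)" by simp
      fix i
      \<comment> \<open>Rounding up makes this event depend on \<open>\<tau>\<close> only up to the
        grid time itself, so the discretised time is again a stopping time.\<close>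
      have "k j \<omega> \<le> i \<longleftrightarrow> \<tau> \<omega> \<le> real i * (1 / real (Suc j))" for \<omega>
      proof -
        have "k j \<omega> \<le> i \<longleftrightarrow> real (Suc j) * \<tau> \<omega> \<le> real i"
          unfolding k_def nat_le_iff ceiling_le_iff by (simp del: of_nat_Suc)
        then show ?thesis by (simp add: field_simps del: of_nat_Suc)
      qed
      then show "Measurable.pred (Filt (real i * (1 / real (Suc j)))) (\<lambda>\<omega>. k j \<omega> \<le> i)"
        using stopping_timeD[OF \<tau>(1)] by simp
      show "k j \<omega> \<le> nat \<lceil>real (Suc j) * C\<rceil>" if "\<omega> \<in> space M" for \<omega>
        unfolding k_def using \<tau>(2)[OF that] by (intro nat_mono ceiling_mono mult_left_mono) auto
    qed
    then show ?thesis by simp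
  qed
  have sq: "(exp_mart \<theta> u \<omega>)\<^sup>2 = exp_mart (2 * \<theta>) u \<omega> * exp (\<theta>\<^sup>2 * u)" for u \<omega>
    unfolding exp_mart_def exp_add[symmetric] exp_double[symmetric] by (simp add: field_simps)
  have km: "(\<lambda>\<omega>. exp_mart \<theta> (?u j \<omega>) \<omega>) \<in> borel_measurable M" for j
    using disc[of \<theta> j] by (auto simp: has_bochner_integral_iff)
  have le: "(exp_mart \<theta> (?u j \<omega>) \<omega>)\<^sup>2
       \<le> exp (\<theta>\<^sup>2 * (C + 1)) * exp_mart (2 * \<theta>) (?u j \<omega>) \<omega>" if "\<omega> \<in> space M" for j \<omega>
  proof -
    \<comment> \<open>Rounding adds at most 1, so \<open>C + 1\<close> bounds all discretised times
      and the constant is uniform in \<open>j\<close>.\<close>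
    have "1 / real (Suc j) \<le> 1" by simp
    then have "?u j \<omega> \<le> C + 1"
      using nat_ceiling_scaled_tendsto(3)[of "\<tau> \<omega>" j] \<tau>(2)[OF that] unfolding k_def by linarith
    then have "exp (\<theta>\<^sup>2 * (?u j \<omega>)) \<le> exp (\<theta>\<^sup>2 * (C + 1))"
      by (simp only: exp_le_cancel_iff) (intro mult_left_mono, auto)
    then show ?thesis
      unfolding sq by (subst mult.commute, intro mult_right_mono) (auto simp: exp_mart_def)
  qed
  have dint: "integrable M (\<lambda>\<omega>. exp (\<theta>\<^sup>2 * (C + 1)) * exp_mart (2 * \<theta>) (?u j \<omega>) \<omega>)"
    "(\<integral>\<omega>. exp (\<theta>\<^sup>2 * (C + 1)) * exp_mart (2 * \<theta>) (?u j \<omega>) \<omega> \<partial>M) = exp (\<theta>\<^sup>2 * (C + 1))" for j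
    using disc[of "2 * \<theta>" j] by (auto simp: has_bochner_integral_iff)
  have sqint: "integrable M (\<lambda>\<omega>. (exp_mart \<theta> (?u j \<omega>) \<omega>)\<^sup>2)" for j
    by (rule Bochner_Integration.integrable_bound[OF dint(1)[of j]])
       (use km in simp, intro AE_I2, unfold real_norm_def abs_power2, rule order_trans[OF le abs_ge_self])
  show ?thesis
  proof (rule has_bochner_integral_L2_bounded_limit[OF disc _ sqint])
    show "0 \<le> exp_mart \<theta> (?u j \<omega>) \<omega>" for j \<omega> by (simp add: exp_mart_def)
    show "(\<integral>\<omega>. (exp_mart \<theta> (?u j \<omega>) \<omega>)\<^sup>2 \<partial>M) \<le> exp (\<theta>\<^sup>2 * (C + 1))" for j
      using integral_mono[OF sqint dint(1)[of j] le] dint(2)[of j] by simp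
    show "AE \<omega> in M. (\<lambda>j. exp_mart \<theta> (?u j \<omega>) \<omega>) \<longlonglongrightarrow> exp_mart \<theta> (\<tau> \<omega>) \<omega>"
      using exp_mart_continuous[of \<theta>] AE_space
    proof eventually_elim
      case (elim \<omega>)
      have t0: "0 \<le> \<tau> \<omega>" using \<tau>(2)[OF elim(2)] by simp
      show ?case unfolding k_def
        by (rule continuous_on_tendsto_compose[OF elim(1) nat_ceiling_scaled_tendsto(1)[OF t0]])
         (use t0 in simp, rule always_eventually, simp)
    qed
    show "(\<lambda>\<omega>. exp_mart \<theta> (\<tau> \<omega>) \<omega>) \<in> borel_measurable M"
      by (rule borel_measurable_at_random_time[OF exp_mart_measurable exp_mart_continuous stopping_time_measurable[OF \<tau>(1)]])
         (use \<tau>(2) in auto)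
  qed
qed

end

section \<open>The running maximum\<close>

context filtered_brownian_motion
begin

text \<open>The supremum is reduced to countably many times by continuity. Multiples
  \<open>q * u\<close> with fixed \<open>q\<close> allow \<open>u\<close> to be replaced by a random
  time.\<close>

lemma running_max_le_iff:
  assumes "continuous_on {0..} (\<lambda>u. Y u \<omega>)" "0 \<le> u"
  shows "running_max s Y u \<omega> \<le> c \<longleftrightarrow> s \<le> c \<and> (\<forall>q\<in>\<rat> \<inter> {0..1}. Y (q * u) \<omega> \<le> c)"
proof -
  have cont: "continuous_on {0..u} (\<lambda>u. Y u \<omega>)"
    by (rule continuous_on_subset[OF assms(1)]) auto
  then have bdd: "bdd_above ((\<lambda>v. Y v \<omega>) ` {0..u})"
    by (intro bounded_imp_bdd_above compact_imp_bounded compact_continuous_image) auto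
  have "(SUP v\<in>{0..u}. Y v \<omega>) \<le> c \<longleftrightarrow> (\<forall>v\<in>{0..u}. Y v \<omega> \<le> c)"
    using assms(2) by (intro cSUP_le_iff bdd) auto
  also have "\<dots> \<longleftrightarrow> (\<forall>q\<in>\<rat> \<inter> {0..1}. Y (q * u) \<omega> \<le> c)"
  proof (intro iffI ballI)
    fix q :: real assume "\<forall>v\<in>{0..u}. Y v \<omega> \<le> c" "q \<in> \<rat> \<inter> {0..1}"
    then show "Y (q * u) \<omega> \<le> c" using assms(2) by (auto simp: mult_left_le_one_le)
  next
    fix v assume q: "\<forall>q\<in>\<rat> \<inter> {0..1}. Y (q * u) \<omega> \<le> c" and v: "v \<in> {0..u}"
    show "Y v \<omega> \<le> c"
    \<comment> \<open>\<open>closed_rational_multiples\<close> needs a nondegenerate interval, so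
      time 0 is treated separately.\<close>
    proof (cases "u = 0")
      case True
      have "Y (0 * u) \<omega> \<le> c" by (rule q[rule_format]) simp
      then show ?thesis using v True by simp
    next
      case False
      then have u: "0 < u" using assms(2) by simp
      have "(\<lambda>v. Y v \<omega>) v \<in> {..c}"
      proof (rule closed_rational_multiples[OF cont u u closed_atMost _ v])
        fix p :: real assume "p \<in> \<rat>" "0 \<le> p * u" "p * u \<le> u"
        then have "p \<in> \<rat> \<inter> {0..1}" using u by (auto simp: zero_le_mult_iff)
        then show "Y (p * u) \<omega> \<in> {..c}" using q by blast
      qed
      then show ?thesis by simp
    qed
  qed
  finally show ?thesis by (auto simp: running_max_def)
qed

lemma running_max_ge:
  assumes "continuous_on {0..} (\<lambda>u. Y u \<omega>)" "0 \<le> u"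
  shows "s \<le> running_max s Y u \<omega>" "Y u \<omega> \<le> running_max s Y u \<omega>"
proof -
  have "1 \<in> \<rat> \<inter> {0..1::real}" by simp
  then show "s \<le> running_max s Y u \<omega>" "Y u \<omega> \<le> running_max s Y u \<omega>"
    using running_max_le_iff[where Y = Y and \<omega> = \<omega> and s = s and c = "running_max s Y u \<omega>", OF assms] by force+
qed

lemma running_max_measurable:
  assumes Y: "\<And>u. 0 \<le> u \<Longrightarrow> Y u \<in> borel_measurable M" "AE \<omega> in M. continuous_on {0..} (\<lambda>u. Y u \<omega>)"
    and \<tau>: "\<tau> \<in> borel_measurable M" "\<And>\<omega>. \<omega> \<in> space M \<Longrightarrow> 0 \<le> \<tau> \<omega>"
  shows "(\<lambda>\<omega>. running_max s Y (\<tau> \<omega>) \<omega>) \<in> borel_measurable M"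
proof (rule borel_measurableI_le)
  fix c
  have m: "(\<lambda>\<omega>. Y (q * \<tau> \<omega>) \<omega>) \<in> borel_measurable M" if "q \<in> \<rat> \<inter> {0..1}" for q
    by (rule borel_measurable_at_random_time[OF Y]) (use \<tau> that in auto)
  have "Measurable.pred M (\<lambda>\<omega>. \<forall>q\<in>\<rat> \<inter> {0..1}. Y (q * \<tau> \<omega>) \<omega> \<le> c)"
  proof (rule pred_countable_Ball)
    show "countable (\<rat> \<inter> {0..1} :: real set)" by (rule countable_subset[OF _ countable_rat]) auto
    show "Measurable.pred M (\<lambda>\<omega>. Y (q * \<tau> \<omega>) \<omega> \<le> c)" if "q \<in> \<rat> \<inter> {0..1}" for q
      using m[OF that] by measurable
  qed
  then have "{\<omega> \<in> space M. s \<le> c \<and> (\<forall>q\<in>\<rat> \<inter> {0..1}. Y (q * \<tau> \<omega>) \<omega> \<le> c)} \<in> sets M"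
    by (cases "s \<le> c") (auto simp: pred_def)
  moreover have "AE \<omega> in M. \<omega> \<in> {\<omega> \<in> space M. s \<le> c \<and> (\<forall>q\<in>\<rat> \<inter> {0..1}. Y (q * \<tau> \<omega>) \<omega> \<le> c)}
      \<longleftrightarrow> \<omega> \<in> {\<omega> \<in> space M. running_max s Y (\<tau> \<omega>) \<omega> \<le> c}"
    using Y(2) AE_space
  proof eventually_elim
    case (elim \<omega>)
    then show ?case using running_max_le_iff[where Y = Y and \<omega> = \<omega>, OF elim(1) \<tau>(2)[OF elim(2)]] by blast
  qed
  ultimately show "{\<omega> \<in> space M. running_max s Y (\<tau> \<omega>) \<omega> \<le> c} \<in> sets M"
    using complete_measure.in_sets_AE[OF complete] by blast
qed

end

section \<open>Expectation of the stopped value\<close>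

locale gbm_free_boundary = filtered_brownian_motion M Filt W + free_boundary m n H_inf H
  for M :: "'a measure" and Filt W m n H_inf H +
  fixes r \<mu> \<sigma> :: real and X :: "real \<Rightarrow> real \<Rightarrow> 'a \<Rightarrow> real"
  assumes gbm: "\<And>x. 0 < x \<Longrightarrow> geometric_brownian_motion M Filt W \<mu> \<sigma> x (X x)"
    and r: "0 < r"
    and m_root: "1/2 * \<sigma>\<^sup>2 * m\<^sup>2 + (\<mu> - 1/2 * \<sigma>\<^sup>2) * m - r = 0"
    and n_root: "1/2 * \<sigma>\<^sup>2 * n\<^sup>2 + (\<mu> - 1/2 * \<sigma>\<^sup>2) * n - r = 0"
begin

definition bounded_stopping_time :: "('a \<Rightarrow> real) \<Rightarrow> bool" where
  "bounded_stopping_time \<tau> \<longleftrightarrow> stopping_time Filt \<tau> \<and> (\<exists>C. \<forall>\<omega>\<in>space M. 0 \<le> \<tau> \<omega> \<and> \<tau> \<omega> \<le> C)"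

lemma bounded_stopping_timeD:
  assumes "bounded_stopping_time \<tau>"
  shows "\<tau> \<in> borel_measurable M" "\<And>\<omega>. \<omega> \<in> space M \<Longrightarrow> 0 \<le> \<tau> \<omega>"
  using assms stopping_time_measurable unfolding bounded_stopping_time_def by blast+

lemma X_process:
  assumes "0 < x"
  shows "\<And>u. 0 \<le> u \<Longrightarrow> X x u \<in> borel_measurable M" "AE \<omega> in M. continuous_on {0..} (\<lambda>u. X x u \<omega>)"
  using gbm[OF assms] measurable_Filt_M
  unfolding geometric_brownian_motion_def adapted_continuous_def by blast+

text \<open>For a root \<open>k\<close> of the quadratic equation the drift cancels, and the
  discounted power is \<open>x powr k\<close> times the exponential martingale with parameter
  \<open>k * \<sigma>\<close>.\<close>

lemma discounted_power_integral:
  assumes "0 < x" "bounded_stopping_time \<tau>" "1/2 * \<sigma>\<^sup>2 * k\<^sup>2 + (\<mu> - 1/2 * \<sigma>\<^sup>2) * k - r = 0"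
  shows "has_bochner_integral M (\<lambda>\<omega>. exp (- r * \<tau> \<omega>) * X x (\<tau> \<omega>) \<omega> powr k) (x powr k)"
proof (rule has_bochner_integralI_AE)
  note \<tau> = bounded_stopping_timeD[OF assms(2)]
  obtain C where "stopping_time Filt \<tau>" "\<And>\<omega>. \<omega> \<in> space M \<Longrightarrow> 0 \<le> \<tau> \<omega> \<and> \<tau> \<omega> \<le> C"
    using assms(2) unfolding bounded_stopping_time_def by blast
  from has_bochner_integral_mult_right[OF exp_mart_bounded_stopping[OF this, of "k * \<sigma>"], of "x powr k"]
  show "has_bochner_integral M (\<lambda>\<omega>. x powr k * exp_mart (k * \<sigma>) (\<tau> \<omega>) \<omega>) (x powr k)" by simp
  have [measurable]: "(\<lambda>\<omega>. X x (\<tau> \<omega>) \<omega>) \<in> borel_measurable M" "\<tau> \<in> borel_measurable M"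
    using borel_measurable_at_random_time[OF X_process[OF assms(1)] \<tau>] \<tau>(1) by auto
  show "(\<lambda>\<omega>. exp (- r * \<tau> \<omega>) * X x (\<tau> \<omega>) \<omega> powr k) \<in> borel_measurable M" by measurable
  show "AE \<omega> in M. x powr k * exp_mart (k * \<sigma>) (\<tau> \<omega>) \<omega> = exp (- r * \<tau> \<omega>) * X x (\<tau> \<omega>) \<omega> powr k"
    using gbm_explicit[OF gbm[OF assms(1)]] AE_space
  proof eventually_elim
    case (elim \<omega>)
    define u where "u = \<tau> \<omega>"
    have "X x u \<omega> = x * exp (\<sigma> * W u \<omega> + (\<mu> - \<sigma>\<^sup>2 / 2) * u)" using elim(1) \<tau>(2)[OF elim(2)] by (simp add: u_def)
    then have "exp (- r * u) * X x u \<omega> powr k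
        = x powr k * (exp (- r * u) * exp ((\<sigma> * W u \<omega> + (\<mu> - \<sigma>\<^sup>2 / 2) * u) * k))"
      using assms(1) by (simp add: powr_mult exp_powr_real)
    also have "exp (- r * u) * exp ((\<sigma> * W u \<omega> + (\<mu> - \<sigma>\<^sup>2 / 2) * u) * k) = exp_mart (k * \<sigma>) u \<omega>"
    proof -
      \<comment> \<open>The last summand is \<open>u\<close> times the quadratic at
        \<open>k\<close>, which is zero by assumption.\<close>
      have "- r * u + (\<sigma> * W u \<omega> + (\<mu> - \<sigma>\<^sup>2 / 2) * u) * k
         = k * \<sigma> * W u \<omega> - (k * \<sigma>)\<^sup>2 * u / 2 + u * (1/2 * \<sigma>\<^sup>2 * k\<^sup>2 + (\<mu> - 1/2 * \<sigma>\<^sup>2) * k - r)"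
        by (simp add: algebra_simps power_mult_distrib)
      then show ?thesis unfolding exp_mart_def exp_add[symmetric] assms(3) by simp
    qed
    finally show ?case by (simp add: u_def)
  qed
qed

abbreviation max_at :: "real \<Rightarrow> real \<Rightarrow> ('a \<Rightarrow> real) \<Rightarrow> 'a \<Rightarrow> real" where
  "max_at x s \<tau> \<omega> \<equiv> running_max s (X x) (\<tau> \<omega>) \<omega>"

abbreviation w_at :: "real \<Rightarrow> real \<Rightarrow> ('a \<Rightarrow> real) \<Rightarrow> 'a \<Rightarrow> real" where
  "w_at x s \<tau> \<omega> \<equiv> w_fun m n H (X x (\<tau> \<omega>) \<omega>) (max_at x s \<tau> \<omega>)"

abbreviation stopped :: "real \<Rightarrow> real \<Rightarrow> ('a \<Rightarrow> real) \<Rightarrow> 'a \<Rightarrow> real" where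
  "stopped x s \<tau> \<equiv> stopped_value r (w_fun m n H) (X x) s \<tau>"

text \<open>\<open>w_fun\<close> is known to be continuous only on \<open>0 < x \<le> s\<close>, so
  it is cut off by an indicator to get a Borel function on the plane. The process and its maximum
  stay in that region almost surely, and completeness takes care of the null set.\<close>

lemma w_stopped_measurable:
  assumes "0 < x" "x \<le> s" "bounded_stopping_time \<tau>"
  shows "(\<lambda>\<omega>. w_at x s \<tau> \<omega>) \<in> borel_measurable M"
    and "AE \<omega> in M. 0 < X x (\<tau> \<omega>) \<omega> \<and> X x (\<tau> \<omega>) \<omega> \<le> max_at x s \<tau> \<omega> \<and> s \<le> max_at x s \<tau> \<omega>"
proof -
  note \<tau> = bounded_stopping_timeD[OF assms(3)]
  define D where "D = {(x, s). 0 < x \<and> x \<le> (s::real)}"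
  define f where "f = (\<lambda>p. indicator D p *\<^sub>R (case p of (x, s) \<Rightarrow> w_fun m n H x s))"
  show AE: "AE \<omega> in M. 0 < X x (\<tau> \<omega>) \<omega> \<and> X x (\<tau> \<omega>) \<omega> \<le> max_at x s \<tau> \<omega> \<and> s \<le> max_at x s \<tau> \<omega>"
    using gbm_explicit[OF gbm[OF assms(1)]] X_process(2)[OF assms(1)] AE_space
  proof eventually_elim
    case (elim \<omega>)
    have "X x (\<tau> \<omega>) \<omega> = x * exp (\<sigma> * W (\<tau> \<omega>) \<omega> + (\<mu> - \<sigma>\<^sup>2 / 2) * \<tau> \<omega>)"
      by (rule elim(1)[rule_format, OF \<tau>(2)[OF elim(3)]])
    then have "0 < X x (\<tau> \<omega>) \<omega>" using assms(1) by simp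
    then show ?case
      using running_max_ge[where Y = "X x" and \<omega> = \<omega> and s = s, OF elim(2) \<tau>(2)[OF elim(3)]] by blast
  qed
  have "D = {p. 0 < fst p} \<inter> {p. fst p \<le> snd p}" by (auto simp: D_def)
  moreover have "open {p :: real \<times> real. 0 < fst p}" "closed {p :: real \<times> real. fst p \<le> snd p}"
    by (intro open_Collect_less closed_Collect_le continuous_intros)+
  ultimately have "D \<in> sets borel" by (simp only: sets.Int borel_open borel_closed)
  moreover have "continuous_on D (\<lambda>(x, s). w_fun m n H x s)"
    unfolding D_def by (rule C1_on_imp_continuous_on[OF C1_on_w])
  ultimately have f: "f \<in> borel_measurable borel"
    unfolding f_def by (rule borel_measurable_continuous_on_indicator)
  have "(\<lambda>\<omega>. (X x (\<tau> \<omega>) \<omega>, max_at x s \<tau> \<omega>)) \<in> borel_measurable M"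
    using borel_measurable_at_random_time[OF X_process[OF assms(1)] \<tau>]
      running_max_measurable[OF X_process[OF assms(1)] \<tau>] by (rule borel_measurable_Pair)
  from measurable_compose[OF this f]
  have "(\<lambda>\<omega>. f (X x (\<tau> \<omega>) \<omega>, max_at x s \<tau> \<omega>)) \<in> borel_measurable M" .
  moreover have "AE \<omega> in M. w_at x s \<tau> \<omega>
      = f (X x (\<tau> \<omega>) \<omega>, max_at x s \<tau> \<omega>)"
    using AE by eventually_elim (simp add: f_def D_def)
  ultimately show "(\<lambda>\<omega>. w_at x s \<tau> \<omega>) \<in> borel_measurable M"
    by (rule complete_measure.borel_measurable_AE_eq[OF complete])
qed

lemma discount_integrable:
  assumes "bounded_stopping_time \<tau>"
  shows "integrable M (\<lambda>\<omega>. exp (- r * \<tau> \<omega>))"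
proof (rule integrable_const_bound[where B = 1])
  note \<tau> = bounded_stopping_timeD[OF assms]
  show "AE \<omega> in M. norm (exp (- r * \<tau> \<omega>)) \<le> 1" using \<tau>(2) r by (intro AE_I2) simp
  show "(\<lambda>\<omega>. exp (- r * \<tau> \<omega>)) \<in> borel_measurable M" using \<tau>(1) by measurable
qed

text \<open>\<open>C\<close> is chosen before \<open>\<tau>\<close>, so one bound serves a whole
  family of stopping times. This is possible because the maximum never falls below \<open>s\<close>,
  the lower bound fed into \<open>w_growth\<close>.\<close>

lemma stopped_value_estimate:
  assumes x: "0 < x" "x \<le> s" and "0 < \<epsilon>"
  obtains C where "0 \<le> C"
    "\<And>\<tau>. bounded_stopping_time \<tau> \<Longrightarrow> integrable M (stopped x s \<tau>)"
    "\<And>\<tau>. bounded_stopping_time \<tau> \<Longrightarrow>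
       \<bar>(\<integral>\<omega>. stopped x s \<tau> \<omega> \<partial>M) - A_inf * x powr n\<bar>
         \<le> C * (\<integral>\<omega>. exp (- r * \<tau> \<omega>) \<partial>M) + \<epsilon> * x powr n + \<epsilon> * x powr m"
proof -
  have s: "0 < s" using x by simp
  obtain C where C: "0 \<le> C" "\<And>x s'. 0 < x \<Longrightarrow> x \<le> s' \<Longrightarrow> s \<le> s' \<Longrightarrow>
       \<bar>w_fun m n H x s' - A_inf * x powr n\<bar> \<le> C + \<epsilon> * x powr n + \<epsilon> * x powr m"
    by (rule w_growth[OF s assms(3)]) (rule that)
  have est: "integrable M (stopped x s \<tau>) \<and>
     \<bar>(\<integral>\<omega>. stopped x s \<tau> \<omega> \<partial>M) - A_inf * x powr n\<bar>
         \<le> C * (\<integral>\<omega>. exp (- r * \<tau> \<omega>) \<partial>M) + \<epsilon> * x powr n + \<epsilon> * x powr m"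
    if \<tau>: "bounded_stopping_time \<tau>" for \<tau>
  proof -
    define P where "P k \<omega> = exp (- r * \<tau> \<omega>) * X x (\<tau> \<omega>) \<omega> powr k" for k \<omega>
    define sv where "sv = stopped x s \<tau>"
    have P: "integrable M (P n)" "(\<integral>\<omega>. P n \<omega> \<partial>M) = x powr n" "integrable M (P m)" "(\<integral>\<omega>. P m \<omega> \<partial>M) = x powr m"
      using discounted_power_integral[OF x(1) \<tau> n_root] discounted_power_integral[OF x(1) \<tau> m_root]
      unfolding P_def has_bochner_integral_iff by auto
    note E = discount_integrable[OF \<tau>]
    have [measurable]: "\<tau> \<in> borel_measurable M" using bounded_stopping_timeD(1)[OF \<tau>] .
    have [measurable]: "(\<lambda>\<omega>. w_at x s \<tau> \<omega>) \<in> borel_measurable M"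
      by (rule w_stopped_measurable(1)[OF x \<tau>])
    have [measurable]: "sv \<in> borel_measurable M"
      unfolding sv_def stopped_value_def[abs_def] by measurable
    have le: "AE \<omega> in M. \<bar>sv \<omega> - A_inf * P n \<omega>\<bar> \<le> C * exp (- r * \<tau> \<omega>) + \<epsilon> * P n \<omega> + \<epsilon> * P m \<omega>"
      using w_stopped_measurable(2)[OF x \<tau>]
    proof eventually_elim
      case (elim \<omega>)
      define y where "y = X x (\<tau> \<omega>) \<omega>"
      define e where "e = exp (- r * \<tau> \<omega>)"
      have e: "0 \<le> e" by (simp add: e_def)
      have "\<bar>sv \<omega> - A_inf * P n \<omega>\<bar> = e * \<bar>w_fun m n H y (max_at x s \<tau> \<omega>) - A_inf * y powr n\<bar>"
        unfolding sv_def stopped_value_def P_def y_def[symmetric] e_def[symmetric]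
        by (simp only: mult.left_commute[of A_inf] right_diff_distrib[symmetric] abs_mult abs_of_nonneg[OF e])
      also have "\<dots> \<le> e * (C + \<epsilon> * y powr n + \<epsilon> * y powr m)"
        using elim by (intro mult_left_mono C(2) e) (auto simp: y_def)
      finally show ?case unfolding P_def y_def[symmetric] e_def[symmetric] by (simp add: algebra_simps)
    qed
    have I: "integrable M (\<lambda>\<omega>. C * exp (- r * \<tau> \<omega>) + \<epsilon> * P n \<omega> + \<epsilon> * P m \<omega>)" using P E by simp
    have J: "integrable M (\<lambda>\<omega>. sv \<omega> - A_inf * P n \<omega>)"
    proof (rule Bochner_Integration.integrable_bound[OF I])
      show "(\<lambda>\<omega>. sv \<omega> - A_inf * P n \<omega>) \<in> borel_measurable M"
        using borel_measurable_integrable[OF P(1)] by measurable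
      show "AE \<omega> in M. norm (sv \<omega> - A_inf * P n \<omega>) \<le> norm (C * exp (- r * \<tau> \<omega>) + \<epsilon> * P n \<omega> + \<epsilon> * P m \<omega>)"
        using le by eventually_elim simp
    qed
    have svI: "integrable M sv" 
      using Bochner_Integration.integrable_add[OF J integrable_mult_right[OF P(1), of A_inf]] by simp
    have "(\<integral>\<omega>. sv \<omega> \<partial>M) - A_inf * x powr n = (\<integral>\<omega>. sv \<omega> - A_inf * P n \<omega> \<partial>M)"
      using svI P by simp
    also have "\<bar>\<dots>\<bar> \<le> (\<integral>\<omega>. \<bar>sv \<omega> - A_inf * P n \<omega>\<bar> \<partial>M)"
      by (rule integral_abs_bound)
    also have "\<dots> \<le> (\<integral>\<omega>. C * exp (- r * \<tau> \<omega>) + \<epsilon> * P n \<omega> + \<epsilon> * P m \<omega> \<partial>M)"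
      by (intro integral_mono_AE integrable_abs J I le)
    also have "\<dots> = C * (\<integral>\<omega>. exp (- r * \<tau> \<omega>) \<partial>M) + \<epsilon> * x powr n + \<epsilon> * x powr m"
      using P E by simp
    finally show ?thesis using svI unfolding sv_def by blast
  qed
  show ?thesis by (rule that[OF C(1) est[THEN conjunct1] est[THEN conjunct2]])
qed

lemma stopped_value_integrable:
  assumes "0 < x" "x \<le> s" "bounded_stopping_time \<tau>"
  shows "integrable M (stopped x s \<tau>)"
  by (rule stopped_value_estimate[OF assms(1,2) zero_less_one]) (use assms(3) in blast)

text \<open>An arbitrary filter is allowed so that the lemma covers both sequences of stopping times
  and deterministic times tending to infinity.\<close>

lemma stopped_value_tendsto:
  assumes x: "0 < x" "x \<le> s" and \<tau>: "\<And>i. bounded_stopping_time (\<tau> i)"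
    and lim: "((\<lambda>i. \<integral>\<omega>. exp (- r * \<tau> i \<omega>) \<partial>M) \<longlongrightarrow> 0) net"
  shows "((\<lambda>i. \<integral>\<omega>. stopped x s (\<tau> i) \<omega> \<partial>M) \<longlongrightarrow> A_inf * x powr n) net"
proof (rule tendstoI)
  fix \<delta> :: real assume "0 < \<delta>"
  define c where "c = x powr n + x powr m"
  have c: "0 < c" using x by (simp add: c_def add_pos_pos)
  have "0 < \<delta> / (2 * c)" using \<open>0 < \<delta>\<close> c by simp
  then obtain C where C: "0 \<le> C"
    "\<And>\<tau>. bounded_stopping_time \<tau> \<Longrightarrow>
       \<bar>(\<integral>\<omega>. stopped x s \<tau> \<omega> \<partial>M) - A_inf * x powr n\<bar>
         \<le> C * (\<integral>\<omega>. exp (- r * \<tau> \<omega>) \<partial>M) + \<delta> / (2 * c) * x powr n + \<delta> / (2 * c) * x powr m"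
    by (rule stopped_value_estimate[OF x]) (rule that)
  \<comment> \<open>With this choice of the small parameter the two power terms use up half of
    \<open>\<delta>\<close>, and the discount term gets the other half.\<close>
  have half: "\<delta> / (2 * c) * x powr n + \<delta> / (2 * c) * x powr m = \<delta> / 2"
    unfolding distrib_left[symmetric] c_def[symmetric] using c by simp
  have "((\<lambda>i. C * (\<integral>\<omega>. exp (- r * \<tau> i \<omega>) \<partial>M)) \<longlongrightarrow> C * 0) net"
    by (intro tendsto_mult tendsto_const lim)
  then have "\<forall>\<^sub>F i in net. C * (\<integral>\<omega>. exp (- r * \<tau> i \<omega>) \<partial>M) < \<delta> / 2"
    by (rule order_tendstoD) (use \<open>0 < \<delta>\<close> in simp)
  then show "\<forall>\<^sub>F i in net. dist (\<integral>\<omega>. stopped x s (\<tau> i) \<omega> \<partial>M) (A_inf * x powr n) < \<delta>"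
  proof eventually_elim
    case (elim i)
    then show ?case using C(2)[OF \<tau>[of i]] half unfolding dist_real_def by linarith
  qed
qed

lemma exhausting_bounded_stopping_time:
  assumes "exhausting_stopping_times M Filt \<tau>"
  shows "bounded_stopping_time (\<tau> l)"
  using assms unfolding exhausting_stopping_times_def bounded_stopping_time_def by blast

lemma exhausting_discount_tendsto:
  assumes "exhausting_stopping_times M Filt \<tau>"
  shows "(\<lambda>l. \<integral>\<omega>. exp (- r * \<tau> l \<omega>) \<partial>M) \<longlonglongrightarrow> 0"
proof -
  have b: "bounded_stopping_time (\<tau> l)" for l by (rule exhausting_bounded_stopping_time[OF assms])
  have "(\<lambda>l. \<integral>\<omega>. exp (- r * \<tau> l \<omega>) \<partial>M) \<longlonglongrightarrow> (\<integral>\<omega>. 0 \<partial>M)"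
  proof (rule integral_dominated_convergence[where w = "\<lambda>_. 1"])
    show "(\<lambda>\<omega>. exp (- r * \<tau> l \<omega>)) \<in> borel_measurable M" for l
      using discount_integrable[OF b] by auto
    show "AE \<omega> in M. norm (exp (- r * \<tau> l \<omega>)) \<le> 1" for l
      using bounded_stopping_timeD(2)[OF b] r by (intro AE_I2) simp
    have "AE \<omega> in M. filterlim (\<lambda>l. \<tau> l \<omega>) at_top sequentially"
      using assms by (simp add: exhausting_stopping_times_def)
    then show "AE \<omega> in M. (\<lambda>l. exp (- r * \<tau> l \<omega>)) \<longlonglongrightarrow> 0"
    proof eventually_elim
      case (elim \<omega>)
      have "filterlim (\<lambda>l. - r * \<tau> l \<omega>) at_bot sequentially"
        by (rule filterlim_tendsto_neg_mult_at_bot[OF tendsto_const _ elim]) (use r in simp)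
      then show ?case by (rule filterlim_compose[OF exp_at_bot])
    qed
  qed auto
  then show ?thesis by simp
qed

lemma exhausting_stopped_value_tendsto:
  assumes "0 < x" "x \<le> s" "exhausting_stopping_times M Filt \<tau>"
  shows "(\<lambda>l. \<integral>\<omega>. stopped x s (\<tau> l) \<omega> \<partial>M) \<longlonglongrightarrow> A_inf * x powr n"
  by (rule stopped_value_tendsto[OF assms(1,2) exhausting_bounded_stopping_time exhausting_discount_tendsto])
     (use assms(3) in auto)

lemma bounded_stopping_time_const: "0 \<le> T \<Longrightarrow> bounded_stopping_time (\<lambda>_. T)"
  by (auto simp: bounded_stopping_time_def stopping_time_const)

lemma fixed_time_value:
  assumes "0 < x" "x \<le> s"
  shows "\<And>T. 0 \<le> T \<Longrightarrow> integrable M (\<lambda>\<omega>. w_fun m n H (X x T \<omega>) (running_max s (X x) T \<omega>))"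
    and "((\<lambda>T. exp (- r * T) * (\<integral>\<omega>. w_fun m n H (X x T \<omega>) (running_max s (X x) T \<omega>) \<partial>M)) \<longlongrightarrow> A_inf * x powr n) at_top"
proof -
  show "integrable M (\<lambda>\<omega>. w_fun m n H (X x T \<omega>) (running_max s (X x) T \<omega>))" if "0 \<le> T" for T
    using stopped_value_integrable[OF assms bounded_stopping_time_const[OF that]]
    unfolding stopped_value_def[abs_def] by simp
  \<comment> \<open>Negative \<open>T\<close> are moved to 0 because
    \<open>stopped_value_tendsto\<close> wants a bounded stopping time at every index.\<close>
  have "((\<lambda>T. \<integral>\<omega>. exp (- r * max 0 T) \<partial>M) \<longlongrightarrow> 0) at_top"
  proof -
    have max: "filterlim (\<lambda>T::real. max 0 T) at_top at_top"
      by (rule filterlim_at_top_mono[OF filterlim_ident]) auto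
    have "filterlim (\<lambda>T. - r * max 0 T) at_bot at_top"
      by (rule filterlim_tendsto_neg_mult_at_bot[OF tendsto_const _ max]) (use r in simp)
    then have "((\<lambda>T. exp (- r * max 0 T)) \<longlongrightarrow> 0) at_top"
      by (rule filterlim_compose[OF exp_at_bot])
    then show ?thesis by (simp add: prob_space)
  qed
  from stopped_value_tendsto[OF assms bounded_stopping_time_const this]
  have "((\<lambda>T. \<integral>\<omega>. stopped x s (\<lambda>_. max 0 T) \<omega> \<partial>M) \<longlongrightarrow> A_inf * x powr n) at_top" by simp
  moreover have "\<forall>\<^sub>F T in at_top. (\<integral>\<omega>. stopped x s (\<lambda>_. max 0 T) \<omega> \<partial>M)
      = exp (- r * T) * (\<integral>\<omega>. w_fun m n H (X x T \<omega>) (running_max s (X x) T \<omega>) \<partial>M)"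
    using eventually_ge_at_top[of 0] by eventually_elim (simp add: stopped_value_def max_def)
  ultimately show "((\<lambda>T. exp (- r * T) * (\<integral>\<omega>. w_fun m n H (X x T \<omega>) (running_max s (X x) T \<omega>) \<partial>M)) \<longlongrightarrow> A_inf * x powr n) at_top"
    by (rule Lim_transform_eventually)
qed

text \<open>The limit is \<open>A_inf * x powr n\<close> for every initial condition. For
  \<open>x = s = 1\<close> it is \<open>A_inf\<close> itself, so this one condition already
  decides.\<close>

lemma transversality_iff: "transversality M r X (w_fun m n H) \<longleftrightarrow> A_inf = 0"
proof
  assume "transversality M r X (w_fun m n H)"
  then have "((\<lambda>T. exp (- r * T) * (\<integral>\<omega>. w_fun m n H (X 1 T \<omega>) (running_max 1 (X 1) T \<omega>) \<partial>M)) \<longlongrightarrow> 0) at_top"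
    unfolding transversality_def by auto
  from tendsto_unique[OF trivial_limit_at_top_linorder this fixed_time_value(2)[of 1 1]]
  show "A_inf = 0" by simp
next
  assume "A_inf = 0"
  then show "transversality M r X (w_fun m n H)"
    using fixed_time_value unfolding transversality_def by simp
qed

end

section \<open>Translation of the parameter conditions, and the cases by the sign of
  \<open>A_inf\<close>\<close>

theorem theorem4p1:
  fixes M :: "'a measure" and Filt :: "real \<Rightarrow> 'a measure"
    and W :: "real \<Rightarrow> 'a \<Rightarrow> real" and X :: "real \<Rightarrow> real \<Rightarrow> 'a \<Rightarrow> real"
    and r \<mu> \<sigma> m n H_inf :: real and H :: "real \<Rightarrow> real"
    and w :: "real \<Rightarrow> real \<Rightarrow> real"
  assumes "prob_space M" and "usual_conditions M Filt" and "brownian_motion M Filt W"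
    and "\<And>x. 0 < x \<Longrightarrow> geometric_brownian_motion M Filt W \<mu> \<sigma> x (X x)"
    and "r > 0" and "\<sigma> \<noteq> 0" and "\<sigma>\<^sup>2 < r + \<mu>" and "\<sigma>\<^sup>2 \<ge> \<mu>"
    and "m < 0" and "1/2 * \<sigma>\<^sup>2 * m\<^sup>2 + (\<mu> - 1/2 * \<sigma>\<^sup>2) * m - r = 0"
    and "0 < n" and "1/2 * \<sigma>\<^sup>2 * n\<^sup>2 + (\<mu> - 1/2 * \<sigma>\<^sup>2) * n - r = 0"
    and "0 < H_inf" and "H_inf \<le> G_lim m n"
    and "\<And>s. 0 < s \<Longrightarrow> (H has_real_derivative ode_rhs m n s (H s)) (at s)"
    and "\<And>s. 0 < s \<Longrightarrow> 0 < H s \<and> H s < G m n s"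
    and "\<And>s. 0 < s \<Longrightarrow> deriv H s > 0"
    and "(H \<longlongrightarrow> 0) (at_right 0)" and "(H \<longlongrightarrow> H_inf) at_top"
  defines "w \<equiv> w_fun m n H"
  shows
    \<comment> \<open>(I)\<close>
    "(C1_on (\<lambda>(x, s). w x s) {(x, s). 0 < x \<and> x \<le> s} \<and>
      C2_on (\<lambda>(x, s). w x s) {(x, s). 0 < x \<and> x \<le> s \<and> x \<noteq> H s}) \<and>
    \<comment> \<open>(II)\<close>
     (H_circ m < H_inf \<longrightarrow>
        \<not> variational_inequality r \<mu> \<sigma> H w \<and> (\<exists>x s. 0 < x \<and> x \<le> s \<and> w x s < 0)) \<and>
    \<comment> \<open>(III)\<close>
     (H_inf \<le> H_circ m \<longrightarrow>
        (\<forall>x s. 0 < x \<and> x \<le> s \<longrightarrow> 0 < w x s) \<and>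
        variational_inequality r \<mu> \<sigma> H w \<and>
        (\<forall>s>0. ((\<lambda>u. w s u) has_real_derivative 0) (at s within {s..}))) \<and>
    \<comment> \<open>(IV)\<close>
     (H_inf < H_circ m \<longrightarrow>
        \<not> transversality M r X w \<and>
        (\<exists>A_inf>0. \<forall>x s \<tau>. 0 < x \<and> x \<le> s \<and> exhausting_stopping_times M Filt \<tau> \<longrightarrow>
           (\<forall>l. integrable M (stopped_value r w (X x) s (\<tau> l))) \<and>
           (\<exists>L. (\<lambda>l. \<integral>\<omega>. stopped_value r w (X x) s (\<tau> l) \<omega> \<partial>M) \<longlonglongrightarrow> L \<and>
                L \<ge> A_inf * x powr n \<and> A_inf * x powr n > 0))) \<and>
    \<comment> \<open>(V)\<close>
     (H_inf = H_circ m \<longrightarrow>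
        transversality M r X w \<and>
        (\<forall>x s \<tau>. 0 < x \<and> x \<le> s \<and> exhausting_stopping_times M Filt \<tau> \<longrightarrow>
           (\<forall>l. integrable M (stopped_value r w (X x) s (\<tau> l))) \<and>
           (\<lambda>l. \<integral>\<omega>. stopped_value r w (X x) s (\<tau> l) \<omega> \<partial>M) \<longlonglongrightarrow> 0))"
proof -
  define a where "a = 1/2 * \<sigma>\<^sup>2"
  have a: "0 < a" using \<open>\<sigma> \<noteq> 0\<close> by (simp add: a_def)
  note m_root = assms(10) and n_root = assms(12)
  \<comment> \<open>Vieta's formulas again. They give
    \<open>a * ((m + 1) * (n + 1)) = \<sigma>\<^sup>2 - \<mu> - r\<close> and
    \<open>a * (m + n + 1) = \<sigma>\<^sup>2 - \<mu>\<close>, so the two conditions on the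
    parameters become \<open>m < - 1\<close> and \<open>0 \<le> m + n + 1\<close>.\<close>
  have "(m - n) * (a * (m + n) + \<mu> - a)
      = (a * m\<^sup>2 + (\<mu> - a) * m - r) - (a * n\<^sup>2 + (\<mu> - a) * n - r)"
    by (simp add: field_simps power2_eq_square)
  then have "(m - n) * (a * (m + n) + \<mu> - a) = 0"
    using m_root n_root unfolding a_def by simp
  then have sum: "a * (m + n) = a - \<mu>" using \<open>m < 0\<close> \<open>0 < n\<close> by simp
  have "a * (m * n) = m * (a * (m + n)) - a * m\<^sup>2" by (simp add: algebra_simps power2_eq_square)
  also have "\<dots> = - r" unfolding sum using m_root by (simp add: a_def algebra_simps)
  finally have prod: "a * (m * n) = - r" .
  have "a * ((m + 1) * (n + 1)) = a * (m * n) + a * (m + n) + a" by (simp add: algebra_simps)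
  also have "\<dots> < 0" unfolding prod sum using \<open>\<sigma>\<^sup>2 < r + \<mu>\<close> by (simp add: a_def)
  finally have "(m + 1) * (n + 1) < 0" using a by (simp add: mult_less_0_iff)
  then have m: "m < - 1" using \<open>0 < n\<close> by (simp add: mult_less_0_iff)
  have "a * (m + n + 1) = a * (m + n) + a" by (simp add: algebra_simps)
  also have "\<dots> \<ge> 0" unfolding sum using \<open>\<sigma>\<^sup>2 \<ge> \<mu>\<close> by (simp add: a_def)
  finally have mn: "0 \<le> m + n + 1" using a by (simp add: zero_le_mult_iff)
  interpret prob_space M by fact
  interpret gbm_free_boundary M Filt W m n H_inf H r \<mu> \<sigma> X
    by unfold_locales (fact assms m mn)+
  have not_vi: "\<not> variational_inequality r \<mu> \<sigma> H w \<and> (\<exists>x s. 0 < x \<and> x \<le> s \<and> w x s < 0)" if "H_circ m < H_inf"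
  proof -
    have "A_inf < 0" using sgn_A_inf that by (simp add: sgn_if split: if_splits)
    then obtain s where s: "0 < s" "H s < s / 2" "w (s / 2) s < - 1"
      unfolding w_def by (rule exists_w_less_minus_1)
    \<comment> \<open>The payoff exceeds \<open>- 1\<close>, so \<open>w < - 1\<close> makes the
      second entry of the maximum in (VI) positive.\<close>
    have "- 1 < F s / (s / 2) - 1" using F_pos[OF s(1)] s(1) by simp
    then have "0 < max (generator r \<mu> \<sigma> w (s / 2) s) (F s / (s / 2) - 1 - w (s / 2) s)"
      using s(3) unfolding less_max_iff_disj by linarith
    moreover have "0 < s / 2 \<and> s / 2 < s \<and> s / 2 \<noteq> H s" using s by auto
    ultimately have "\<not> variational_inequality r \<mu> \<sigma> H w"
      unfolding variational_inequality_def by (metis less_irrefl)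
    moreover have "0 < s / 2 \<and> s / 2 \<le> s \<and> w (s / 2) s < 0" using s by simp
    ultimately show ?thesis by blast
  qed
  have vi: "(\<forall>x s. 0 < x \<and> x \<le> s \<longrightarrow> 0 < w x s) \<and> variational_inequality r \<mu> \<sigma> H w \<and>
      (\<forall>s>0. ((\<lambda>u. w s u) has_real_derivative 0) (at s within {s..}))" if "H_inf \<le> H_circ m"
  proof -
    have "0 \<le> A_inf" using sgn_A_inf that by (simp add: sgn_if split: if_splits)
    then show ?thesis
      unfolding w_def
      by (intro conjI allI impI w_pos variational_inequality_w \<open>r > 0\<close> \<open>\<sigma> \<noteq> 0\<close> m_root n_root w_diagonal_derivative) auto
  qed
  have not_tv: "\<not> transversality M r X w \<and>
        (\<exists>A_inf>0. \<forall>x s \<tau>. 0 < x \<and> x \<le> s \<and> exhausting_stopping_times M Filt \<tau> \<longrightarrow>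
           (\<forall>l. integrable M (stopped_value r w (X x) s (\<tau> l))) \<and>
           (\<exists>L. (\<lambda>l. \<integral>\<omega>. stopped_value r w (X x) s (\<tau> l) \<omega> \<partial>M) \<longlonglongrightarrow> L \<and>
                L \<ge> A_inf * x powr n \<and> A_inf * x powr n > 0))" if "H_inf < H_circ m"
  proof -
    have A: "0 < A_inf" using sgn_A_inf that by (simp add: sgn_if split: if_splits)
    have val: "(\<forall>l. integrable M (stopped_value r w (X x) s (\<tau> l))) \<and>
           (\<exists>L. (\<lambda>l. \<integral>\<omega>. stopped_value r w (X x) s (\<tau> l) \<omega> \<partial>M) \<longlonglongrightarrow> L \<and>
                L \<ge> A_inf * x powr n \<and> A_inf * x powr n > 0)"
      if "0 < x \<and> x \<le> s \<and> exhausting_stopping_times M Filt \<tau>" for x s \<tau>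
    proof -
      \<comment> \<open>The limit \<open>L\<close> is \<open>A_inf * x powr n\<close> itself, so the
        inequality of (IV) holds with equality.\<close>
      have "0 < A_inf * x powr n" using A that by simp
      then show ?thesis
        using that stopped_value_integrable[OF _ _ exhausting_bounded_stopping_time, of x s \<tau>]
          exhausting_stopped_value_tendsto[of x s \<tau>] unfolding w_def by (auto intro!: exI[of _ "A_inf * x powr n"])
    qed
    have "\<exists>A_inf>0. \<forall>x s \<tau>. 0 < x \<and> x \<le> s \<and> exhausting_stopping_times M Filt \<tau> \<longrightarrow>
           (\<forall>l. integrable M (stopped_value r w (X x) s (\<tau> l))) \<and>
           (\<exists>L. (\<lambda>l. \<integral>\<omega>. stopped_value r w (X x) s (\<tau> l) \<omega> \<partial>M) \<longlonglongrightarrow> L \<and>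
                L \<ge> A_inf * x powr n \<and> A_inf * x powr n > 0)"
      by (rule exI[of _ A_inf], rule conjI[OF A], intro allI impI, rule val)
    moreover have "\<not> transversality M r X w" unfolding w_def transversality_iff using A by simp
    ultimately show ?thesis by (rule conjI[rotated])
  qed
  have tv: "transversality M r X w \<and>
        (\<forall>x s \<tau>. 0 < x \<and> x \<le> s \<and> exhausting_stopping_times M Filt \<tau> \<longrightarrow>
           (\<forall>l. integrable M (stopped_value r w (X x) s (\<tau> l))) \<and>
           (\<lambda>l. \<integral>\<omega>. stopped_value r w (X x) s (\<tau> l) \<omega> \<partial>M) \<longlonglongrightarrow> 0)" if "H_inf = H_circ m"
  proof -
    have A: "A_inf = 0" using sgn_A_inf that by (simp add: sgn_zero_iff)
    have "integrable M (stopped_value r w (X x) s (\<tau> l)) \<and>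
        (\<lambda>l. \<integral>\<omega>. stopped_value r w (X x) s (\<tau> l) \<omega> \<partial>M) \<longlonglongrightarrow> 0"
      if "0 < x \<and> x \<le> s \<and> exhausting_stopping_times M Filt \<tau>" for x s \<tau> l
      using that A stopped_value_integrable[OF _ _ exhausting_bounded_stopping_time, of x s \<tau> l]
        exhausting_stopped_value_tendsto[of x s \<tau>] unfolding w_def by simp
    moreover have "transversality M r X w" unfolding w_def transversality_iff using A .
    ultimately show ?thesis by simp
  qed
  show ?thesis
    by (rule conjI[OF conjI[OF C1_on_w C2_on_w, folded w_def]], rule conjI, rule impI, erule not_vi,
        rule conjI, rule impI, erule vi, rule conjI, rule impI, erule not_tv, rule impI, erule tv)
qed

end
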